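(* Let $k$ be an algebraically closed field of characteristic $p>2$. Let $e_1,\dots,e_n\ge 2$ be integers and $d$ an integer with $\sum_i(e_i-1)=2d-2$ and $e_i\le d$ for all $i$. Suppose $e_1>p$ with $e_1$ prime to $p$, and $e_i<p$ for all $i>1$. Let $P_1,\dots,P_n$ be distinct points of $\mathbb P^1$. If there exists one separable degree-$d$ map $\mathbb P^1\to\mathbb P^1$ ramified to order $e_i$ at $P_i$ for all $i$, then there exist infinitely many such maps, modulo automorphism of the image. In particular, if the $P_i$ are general, there exist no separable degree-$d$ maps $\mathbb P^1\to\mathbb P^1$ ramified to order $e_i$ at $P_i$ for all $i$.
   Context: "Ramified to order $e_i$ at $P_i$" means that the ramification index of the map at $P_i$ is $e_i$. "Modulo automorphism of the image" means $f$ and $\alpha\circ f$ are identified for all $\alpha\in\mathrm{Aut}(\mathbb P^1)$. "General" means: for all $(P_1,\dots,P_n)$ in some nonempty open subset of $(\mathbb P^1)^n$. *)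

theory Defs
  imports "HOL-Computational_Algebra.Computational_Algebra" "HOL-Library.FuncSet"
begin

section \<open>The projective line and its function field\<close>

text \<open>
  The closed points of the projective line over an algebraically closed field. The point
  \<open>Aff a\<close> is $[a:1]$ and \<open>Infty\<close> is $[1:0]$.
\<close>

datatype 'k proj_line = Aff 'k | Infty

fun hcoord_x :: "'k::field proj_line \<Rightarrow> 'k" where
  "hcoord_x (Aff a) = a"
| "hcoord_x Infty = 1"

fun hcoord_y :: "'k::field proj_line \<Rightarrow> 'k" where
  "hcoord_y (Aff a) = 1"
| "hcoord_y Infty = 0"

text \<open>
  The function field $k(t)$. A map from the projective line to itself is represented by the
  rational function which is the pullback of the coordinate \<open>t\<close>; this covers every map except
  the constant map with value \<open>Infty\<close>.
\<close>

type_synonym 'k ratfun = "'k poly fract"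

definition const_rf :: "'k::field \<Rightarrow> 'k ratfun" where
  "const_rf c = to_fract [:c:]"

definition t_rf :: "'k::field ratfun" where
  "t_rf = to_fract [:0, 1:]"

text \<open>
  Numerator and denominator in lowest terms, determined up to a common nonzero scalar. (The
  library function \<open>quot_of_fract\<close> would need a gcd operation on the coefficient field.)
\<close>

definition lowest_terms :: "'k::field ratfun \<Rightarrow> 'k poly \<times> 'k poly" where
  "lowest_terms f = (SOME ND. snd ND \<noteq> 0 \<and> coprime (fst ND) (snd ND) \<and> f = Fract (fst ND) (snd ND))"

definition numer :: "'k::field ratfun \<Rightarrow> 'k poly" where
  "numer f = fst (lowest_terms f)"

definition denom :: "'k::field ratfun \<Rightarrow> 'k poly" where
  "denom f = snd (lowest_terms f)"

lemma lowest_terms_exist: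
  fixes f :: "'k::field ratfun"
  shows "\<exists>N D. D \<noteq> 0 \<and> coprime N D \<and> f = Fract N D"
proof -
  have "\<exists>D. D \<noteq> 0 \<and> (\<exists>N. f = Fract N D)"
    by (cases f) auto
  then obtain D where D: "D \<noteq> 0" "\<exists>N. f = Fract N D"
    and min: "\<And>D'. D' \<noteq> 0 \<and> (\<exists>N. f = Fract N D') \<Longrightarrow> degree D \<le> degree D'"
    using ex_has_least_nat[of "\<lambda>D. D \<noteq> 0 \<and> (\<exists>N. f = Fract N D)" _ degree] by blast
  from D(2) obtain N where N: "f = Fract N D" by blast
  have "coprime N D"
  proof (rule coprimeI)
    fix c assume "c dvd N" "c dvd D"
    then obtain N' D' where nd: "N = c * N'" "D = c * D'" by (auto elim!: dvdE)
    with D(1) have nz: "c \<noteq> 0" "D' \<noteq> 0" by auto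
    have "f = Fract N' D'" using N nd nz D(1) by (simp add: eq_fract)
    with min nz have "degree D \<le> degree D'" by blast
    moreover have "degree D = degree c + degree D'" using nd nz by (simp add: degree_mult_eq)
    ultimately show "is_unit c" using nz by (simp add: is_unit_iff_degree)
  qed
  with D(1) N show ?thesis by blast
qed

lemma numer_denom:
  "denom f \<noteq> 0" "coprime (numer f) (denom f)" "f = Fract (numer f) (denom f)"
proof -
  have "\<exists>ND. snd ND \<noteq> 0 \<and> coprime (fst ND) (snd ND) \<and> f = Fract (fst ND) (snd ND)"
    using lowest_terms_exist[of f] by auto
  then have "denom f \<noteq> 0 \<and> coprime (numer f) (denom f) \<and> f = Fract (numer f) (denom f)"
    unfolding numer_def denom_def lowest_terms_def by (rule someI_ex)
  then show "denom f \<noteq> 0" "coprime (numer f) (denom f)" "f = Fract (numer f) (denom f)"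
    by blast+
qed


section \<open>Maps from the projective line to itself\<close>

definition map_degree :: "'k::field ratfun \<Rightarrow> nat" where
  "map_degree f = max (degree (numer f)) (degree (denom f))"

text \<open>
  The image of a point. At \<open>Infty\<close> the value is read off from the coefficients of
  $t^d$, where $d$ is the degree of the map: these are the values at $[1:0]$ of the numerator
  and the denominator, homogenized to degree $d$.
\<close>

fun map_at :: "'k::field ratfun \<Rightarrow> 'k proj_line \<Rightarrow> 'k proj_line" where
  "map_at f (Aff a) =
     (if poly (denom f) a = 0 then Infty else Aff (poly (numer f) a / poly (denom f) a))"
| "map_at f Infty =
     (if coeff (denom f) (map_degree f) = 0 then Infty
      else Aff (coeff (numer f) (map_degree f) / coeff (denom f) (map_degree f)))"

text \<open>
  \<open>rf_comp g f\<close> is $g \circ f = g(f(t))$. As a function of \<open>g\<close> it is the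
  pullback $f^* : k(t) \to k(t)$. For nonconstant \<open>f\<close> the divisor below is nonzero,
  since \<open>f\<close> is transcendental over \<open>k\<close>.
\<close>

definition rf_comp :: "'k::field ratfun \<Rightarrow> 'k ratfun \<Rightarrow> 'k ratfun" where
  "rf_comp g f = poly (map_poly const_rf (numer g)) f / poly (map_poly const_rf (denom g)) f"

text \<open>The order of vanishing of a nonzero rational function at a point.\<close>

fun ord_at :: "'k::field proj_line \<Rightarrow> 'k ratfun \<Rightarrow> int" where
  "ord_at (Aff a) g = int (order a (numer g)) - int (order a (denom g))"
| "ord_at Infty g = int (degree (denom g)) - int (degree (numer g))"

fun local_param :: "'k::field proj_line \<Rightarrow> 'k ratfun" where
  "local_param (Aff b) = t_rf - const_rf b"
| "local_param Infty = inverse t_rf"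

text \<open>
  The ramification index of a nonconstant map at \<open>P\<close>: the order of vanishing at \<open>P\<close> of the
  pullback of a local parameter at the image of \<open>P\<close>.
\<close>

definition ram_index :: "'k::field ratfun \<Rightarrow> 'k proj_line \<Rightarrow> int" where
  "ram_index f P = ord_at P (rf_comp (local_param (map_at f P)) f)"

text \<open>
  A map is separable if $k(t)$ is a separable algebraic extension of its subfield
  $f^* k(t)$: every element is a root of a separable polynomial with coefficients in
  the subfield. No constant map satisfies this, as \<open>t_rf\<close> is not algebraic over \<open>k\<close>.
\<close>

definition separable_map :: "'k::field ratfun \<Rightarrow> bool" where
  "separable_map f \<longleftrightarrow>
     (\<forall>x :: 'k ratfun. \<exists>Q :: 'k ratfun poly.
        Q \<noteq> 0 \<and> (\<forall>i. coeff Q i \<in> range (\<lambda>g. rf_comp g f)) \<and>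
        coprime Q (pderiv Q) \<and> poly Q x = 0)"

definition proj_aut :: "'k::field ratfun \<Rightarrow> bool" where
  "proj_aut \<alpha> \<longleftrightarrow> (\<exists>\<beta>. rf_comp \<alpha> \<beta> = t_rf \<and> rf_comp \<beta> \<alpha> = t_rf)"

definition ramified_maps ::
    "nat \<Rightarrow> nat \<Rightarrow> (nat \<Rightarrow> nat) \<Rightarrow> (nat \<Rightarrow> 'k::field proj_line) \<Rightarrow> 'k ratfun set" where
  "ramified_maps n d e P =
     {f. separable_map f \<and> map_degree f = d \<and> (\<forall>i\<in>{1..n}. ram_index f (P i) = int (e i))}"

definition mod_image_aut :: "'k::field ratfun set \<Rightarrow> ('k ratfun \<times> 'k ratfun) set" where
  "mod_image_aut S = {(f, g). f \<in> S \<and> g \<in> S \<and> (\<exists>\<alpha>. proj_aut \<alpha> \<and> g = rf_comp \<alpha> f)}"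


section \<open>The Zariski topology on powers of the projective line\<close>

definition proj_line_power :: "nat \<Rightarrow> (nat \<Rightarrow> 'k proj_line) set" where
  "proj_line_power n = {1..n} \<rightarrow>\<^sub>E UNIV"

text \<open>
  The value at \<open>P\<close> of the multihomogeneous polynomial of multidegree \<open>m\<close> in the pairs of
  variables $(x_i, y_i)$, $1 \le i \le n$, in which the monomial
  $\prod_i x_i^{a_i} y_i^{m_i - a_i}$ has coefficient \<open>c a\<close>.
  Whether it is zero does not depend on the choice of homogeneous coordinates.
\<close>

definition multihom_eval ::
    "nat \<Rightarrow> (nat \<Rightarrow> nat) \<Rightarrow> ((nat \<Rightarrow> nat) \<Rightarrow> 'k) \<Rightarrow> (nat \<Rightarrow> 'k::field proj_line) \<Rightarrow> 'k" where
  "multihom_eval n m c P =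
     (\<Sum>a \<in> (\<Pi>\<^sub>E i\<in>{1..n}. {..m i}).
        c a * (\<Prod>i\<in>{1..n}. hcoord_x (P i) ^ a i * hcoord_y (P i) ^ (m i - a i)))"

definition zariski_closed :: "nat \<Rightarrow> (nat \<Rightarrow> 'k::field proj_line) set \<Rightarrow> bool" where
  "zariski_closed n Z \<longleftrightarrow>
     (\<exists>F :: ((nat \<Rightarrow> nat) \<times> ((nat \<Rightarrow> nat) \<Rightarrow> 'k)) set.
        Z = {P \<in> proj_line_power n. \<forall>(m, c)\<in>F. multihom_eval n m c P = 0})"

definition zariski_open :: "nat \<Rightarrow> (nat \<Rightarrow> 'k::field proj_line) set \<Rightarrow> bool" where
  "zariski_open n U \<longleftrightarrow>
     U \<subseteq> proj_line_power n \<and> zariski_closed n (proj_line_power n - U)"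

end

theory Submission
  imports Defs "Jordan_Normal_Form.Determinant"
begin

text \<open>
  Infinitude: after a change of coordinate on the image, \<open>f(P\<^sub>1) = \<infinity>\<close> with ramification
  \<open>e\<^sub>1 > p\<close>. If \<open>u\<close> is a coordinate with its pole at \<open>P\<^sub>1\<close>, then adding \<open>c * u ^ p\<close> to \<open>f\<close> changes neither
  the degree nor the derivative nor, as \<open>e\<^sub>i < p\<close> for \<open>i > 1\<close>, any ramification index, and different
  constants \<open>c\<close> give inequivalent maps.

  Nonexistence: with \<open>P\<^sub>1\<close> moved to infinity, \<open>f'\<close> is a constant times \<open>g / D ^ 2\<close>, where
  \<open>g = \<Prod> (t - x\<^sub>i) ^ (e\<^sub>i - 1)\<close> and \<open>D\<close> is the denominator of \<open>f\<close>. In characteristic \<open>p\<close> this is a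
  derivative if and only if the coefficients of \<open>g * D ^ (p - 2)\<close> at all exponents \<open>p * j + p - 1\<close> vanish:
  a system of forms of degree \<open>p - 2\<close> in the coefficients of \<open>D\<close>. By elimination theory the
  points for which it has a nontrivial solution form a closed set, so it is enough to find one choice
  of points without solutions. The points are chosen one after the other, the new one close to
  infinity; in the limit a solution for the new points degenerates to one for the old points or to
  one for the three points \<open>0\<close>, \<open>1\<close>, \<open>\<infinity>\<close>. In the three point case one can add \<open>p\<close>-th powers to \<open>f\<close>
  until its finite branch values are equal, and then \<open>f\<close> takes this value more often than its degree allows.
\<close>

text \<open>The exponent \<open>p - 2\<close> comes from g / D ^ 2 = g * D ^ (p - 2) / D ^ p, where
  D ^ p is a constant for d/dt. The induction over the points carries an inequality instead of plain
  insolubility: a nonzero solution D for g satisfies deg g + 1 <= 2 * deg D + p. For no points this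
  is 1 <= 2 * deg D + p. A map of degree d would give a solution with deg D <= d - e_1, while deg g
  + 1 = 2 * (d - e_1) + e_1, so e_1 > p contradicts the inequality. The obstacle in the limit is
  that a nonzero solution might tend to zero. The unknowns are therefore rescaled coefficients of D,
  each of which survives at s = 0 in a low part or in a high part, and both parts have to be
  excluded. The low part falls to the inequality for the old points, the high part to a count of
  zeros: an antiderivative of h that vanishes at 0, at 1 and at the other zeros of h to one order
  more than h has degree at least deg h + 2, but one of degree at most deg h + 1 can be
  arranged.\<close>

hide_const (open) Module.smult

section \<open>Polynomials over a field\<close>

text \<open>An element of least degree in the ideal generated by \<open>A\<close> and
  \<open>B\<close> divides all others by division with remainder, so it is a common divisor and
  hence a unit.\<close>

lemma poly_bezout:
  fixes A B :: "'a::field poly"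
  assumes "coprime A B"
  shows "\<exists>u v. u * A + v * B = 1"
proof -
  let ?I = "\<lambda>G. G \<noteq> 0 \<and> (\<exists>u v. G = u * A + v * B)"
  have "A \<noteq> 0 \<or> B \<noteq> 0" using assms by auto
  moreover have "A = 1 * A + 0 * B" "B = 0 * A + 1 * B" by simp_all
  ultimately have "?I A \<or> ?I B" by metis
  then obtain G where G: "?I G" and min: "\<And>G'. ?I G' \<Longrightarrow> degree G \<le> degree G'"
    using ex_has_least_nat[of ?I A degree] ex_has_least_nat[of ?I B degree] by blast
  from G obtain u v where uv: "G = u * A + v * B" by blast
  have "G dvd x * A + y * B" for x y
  proof -
    let ?C = "x * A + y * B"
    have "?C mod G = (x - ?C div G * u) * A + (y - ?C div G * v) * B"
      by (subst minus_div_mult_eq_mod[symmetric], subst (2) uv) (simp add: algebra_simps)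
    then have "?C mod G = 0"
      using min[of "?C mod G"] degree_mod_less[of G ?C] G by (metis leD)
    then show ?thesis by (simp add: mod_eq_0_iff_dvd)
  qed
  from this[of 1 0] this[of 0 1] have "G dvd A" "G dvd B" by simp_all
  then have "is_unit G" using assms by (meson coprime_common_divisor)
  then obtain w where w: "1 = G * w" by (auto elim: dvdE)
  have "(w * u) * A + (w * v) * B = 1" using w uv by (simp add: algebra_simps)
  then show ?thesis by blast
qed

lemma poly_coprime_dvd_mult:
  fixes A B C :: "'a::field poly"
  assumes "coprime A B" "A dvd B * C"
  shows "A dvd C"
proof -
  obtain u v where uv: "u * A + v * B = 1" using poly_bezout[OF assms(1)] by blast
  have "C = (u * A + v * B) * C" by (simp add: uv)
  also have "\<dots> = A * (u * C) + v * (B * C)" by (simp add: algebra_simps)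
  finally show ?thesis using assms(2) by (metis dvd_add dvd_mult dvd_triv_left)
qed

lemma infinite_UNIV_alg_closed: "infinite (UNIV :: 'k::alg_closed_field set)"
proof
  assume fin: "finite (UNIV :: 'k set)"
  define q :: "'k poly" where "q = (\<Prod>a\<in>UNIV. [:-a, 1:]) + 1"
  have "degree (\<Prod>a\<in>(UNIV::'k set). [:-a, 1:]) = card (UNIV :: 'k set)"
    by (subst degree_prod_eq_sum_degree) auto
  moreover have "card (UNIV :: 'k set) > 0" using fin by (simp add: card_gt_0_iff)
  ultimately have "degree q > 0"
    unfolding q_def by (subst degree_add_eq_left) auto
  then obtain x where x: "poly q x = 0" using alg_closed_imp_poly_has_root by blast
  have "poly (\<Prod>a\<in>(UNIV::'k set). [:-a, 1:]) x = 0"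
    using fin by (auto simp: poly_prod prod_zero_iff)
  with x show False by (simp add: q_def)
qed

lemma coprime_no_root:
  fixes A B :: "'k::alg_closed_field poly"
  assumes "A \<noteq> 0 \<or> B \<noteq> 0" "\<And>x. poly A x = 0 \<Longrightarrow> poly B x \<noteq> 0"
  shows "coprime A B"
proof (rule coprimeI)
  fix c assume c: "c dvd A" "c dvd B"
  show "is_unit c"
  proof (rule ccontr)
    assume "\<not> is_unit c"
    moreover have "c \<noteq> 0" using c assms by auto
    ultimately have "degree c > 0" by (simp add: is_unit_iff_degree)
    then obtain x where "poly c x = 0" using alg_closed_imp_poly_has_root by blast
    then show False using c assms(2) by (meson dvd_trans poly_eq_0_iff_dvd)
  qed
qed

lemma degree_pderiv_le: "degree (pderiv A) \<le> degree A - 1" for A :: "'a::idom poly"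
  by (intro degree_le) (auto simp: coeff_pderiv coeff_eq_0 simp del: of_nat_Suc)

lemma pcompose_power: "pcompose (A ^ n) B = pcompose A B ^ n"
  by (induction n) (simp_all add: pcompose_mult pcompose_1)

section \<open>The derivation of the function field\<close>

lemma Fract_eq_0_iff: "B \<noteq> 0 \<Longrightarrow> Fract A B = 0 \<longleftrightarrow> A = (0 :: 'a::idom)"
  by (simp add: Zero_fract_def eq_fract)

lemma numer_denom_cross:
  "B \<noteq> 0 \<Longrightarrow> A * denom (Fract A B) = numer (Fract A B) * B"
  using iffD1[OF eq_fract(1) numer_denom(3)[of "Fract A B"]] numer_denom(1) by blast

lemma lowest_terms_unique:
  fixes A B :: "'k::field poly"
  assumes "coprime A B" "B \<noteq> 0"
  obtains u where "u \<noteq> 0" "numer (Fract A B) = smult u A" "denom (Fract A B) = smult u B"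
proof -
  let ?N = "numer (Fract A B)" and ?D = "denom (Fract A B)"
  have eq: "A * ?D = ?N * B" using assms(2) by (rule numer_denom_cross)
  have "B dvd A * ?D" unfolding eq by simp
  then have "B dvd ?D" using poly_coprime_dvd_mult assms(1) coprime_commute by blast
  then obtain w where w: "?D = B * w" by (elim dvdE)
  have "?D dvd ?N * B" unfolding eq[symmetric] by simp
  then have "?D dvd B" using poly_coprime_dvd_mult numer_denom(2) coprime_commute by blast
  then have "degree ?D \<le> degree B" using assms(2) by (rule dvd_imp_degree_le)
  moreover have "w \<noteq> 0" using w numer_denom(1)[of "Fract A B"] by auto
  ultimately have "degree w = 0" using w assms(2) by (simp add: degree_mult_eq)
  then obtain u where u: "w = [:u:]" by (rule degree_eq_zeroE)
  have "?N * B = smult u A * B" using eq w u by (simp add: mult_ac)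
  then have "?N = smult u A" using assms(2) by (metis mult_right_cancel)
  then show ?thesis using that[of u] w u \<open>w \<noteq> 0\<close> by (auto simp: mult_ac)
qed

lemma to_fract_power: "to_fract (A ^ n) = to_fract A ^ n"
  by (induction n) simp_all

lemma to_fract_sum: "to_fract (\<Sum>i\<in>I. A i) = (\<Sum>i\<in>I. to_fract (A i))"
  by (induction I rule: infinite_finite_induct) simp_all

text \<open>Clears denominators: a polynomial expression of degree at most \<open>n\<close> in
  \<open>g\<close> becomes a polynomial after multiplication by one common power of
  \<open>denom g\<close>.\<close>

lemma power_mult_denom_power:
  fixes g :: "'k::field ratfun"
  assumes "k \<le> n"
  shows "g ^ k * to_fract (denom g) ^ n = to_fract (numer g ^ k * denom g ^ (n - k))"
proof -
  have "g = to_fract (numer g) / to_fract (denom g)"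
    using numer_denom(3)[of g] by (simp only: Fract_conv_to_fract[symmetric])
  then have "g * to_fract (denom g) = to_fract (numer g)"
    using numer_denom(1)[of g] by (metis nonzero_divide_eq_eq to_fract_eq_0_iff)
  moreover have "g ^ k * to_fract (denom g) ^ n = (g * to_fract (denom g)) ^ k * to_fract (denom g) ^ (n - k)"
    using assms by (simp add: power_mult_distrib mult.assoc flip: power_add)
  ultimately show ?thesis by (simp add: to_fract_power)
qed

lemma const_rf_hom [simp]:
  "const_rf 0 = 0" "const_rf 1 = 1" "const_rf (a + b) = const_rf a + const_rf b"
  "const_rf (a - b) = const_rf a - const_rf b" "const_rf (- a) = - const_rf a"
  "const_rf (a * b) = const_rf a * const_rf b"
proof -
  have "[:a + b:] = [:a:] + [:b:]" "[:a - b:] = [:a:] - [:b:]" "[:-a:] = -[:a:]" "[:a*b:] = [:a:] * [:b:]"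
    by simp_all
  then show "const_rf 0 = 0" "const_rf 1 = 1" "const_rf (a + b) = const_rf a + const_rf b"
    "const_rf (a - b) = const_rf a - const_rf b" "const_rf (- a) = - const_rf a"
    "const_rf (a * b) = const_rf a * const_rf b"
    by (simp_all add: const_rf_def pCons_one del: add_pCons diff_pCons minus_pCons mult_pCons_left mult_pCons_right)
qed

lemma const_rf_eq_iff [simp]: "const_rf a = const_rf b \<longleftrightarrow> a = b"
  by (simp add: const_rf_def)

lemma const_rf_eq_0_iff [simp]: "const_rf a = 0 \<longleftrightarrow> a = 0"
  by (simp add: const_rf_def)

section \<open>Substitution of a rational function\<close>

definition rf_eval :: "'k::field poly \<Rightarrow> 'k ratfun \<Rightarrow> 'k ratfun" where
  "rf_eval A f = poly (map_poly const_rf A) f"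

lemma rf_eval_pCons [simp]: "rf_eval (pCons a A) f = const_rf a + f * rf_eval A f"
  by (simp add: rf_eval_def map_poly_pCons)

lemma rf_eval_0 [simp]: "rf_eval 0 f = 0"
  by (simp add: rf_eval_def)

lemma rf_eval_1 [simp]: "rf_eval 1 f = 1"
  by (simp flip: pCons_one)

lemma rf_eval_smult [simp]: "rf_eval (smult c A) f = const_rf c * rf_eval A f"
  by (induction A) (simp_all add: algebra_simps)

lemma rf_eval_add [simp]: "rf_eval (A + B) f = rf_eval A f + rf_eval B f"
  by (induction A B rule: poly_induct2) (simp_all add: algebra_simps)

lemma rf_eval_diff [simp]: "rf_eval (A - B) f = rf_eval A f - rf_eval B f"
  by (metis add_diff_cancel diff_add_cancel rf_eval_add)

lemma rf_eval_mult [simp]: "rf_eval (A * B) f = rf_eval A f * rf_eval B f"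
  by (induction A) (simp_all add: algebra_simps)

lemma rf_eval_sum [simp]: "rf_eval (\<Sum>i\<in>I. A i) f = (\<Sum>i\<in>I. rf_eval (A i) f)"
  by (induction I rule: infinite_finite_induct) simp_all

lemma rf_eval_monom [simp]: "rf_eval (monom c n) f = const_rf c * f ^ n"
  by (induction n) (simp_all add: monom_0 monom_Suc)

lemma rf_comp_Fract_coprime:
  assumes "coprime A B" "B \<noteq> 0"
  shows "rf_comp (Fract A B) f = rf_eval A f / rf_eval B f"
proof -
  obtain u where "u \<noteq> 0" "numer (Fract A B) = smult u A" "denom (Fract A B) = smult u B"
    using lowest_terms_unique[OF assms] .
  then show ?thesis unfolding rf_comp_def rf_eval_def[symmetric] by simp
qed

text \<open>A nonconstant \<open>f\<close> is transcendental over the constants: \<open>A\<close>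
  splits into linear factors, and no factor \<open>f - x\<close> is zero.\<close>

lemma rf_eval_eq_0_iff:
  fixes f :: "'k::alg_closed_field ratfun"
  assumes "\<And>c. f \<noteq> const_rf c"
  shows "rf_eval A f = 0 \<longleftrightarrow> A = 0"
proof
  assume ev: "rf_eval A f = 0"
  show "A = 0"
  proof (rule ccontr)
    assume A: "A \<noteq> 0"
    obtain M where M: "A = smult (lead_coeff A) (\<Prod>x\<in>#M. [:-x, 1:])"
      using alg_closed_imp_factorization[OF A] by blast
    have "rf_eval (\<Prod>x\<in>#M. [:-x, 1:]) f \<noteq> 0"
      using assms by (induction M) (auto simp del: mult_pCons_left)
    moreover have "rf_eval A f = const_rf (lead_coeff A) * rf_eval (\<Prod>x\<in>#M. [:-x, 1:]) f"
      by (subst M) simp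
    ultimately show False using ev A by simp
  qed
qed simp

lemma rf_comp_Fract:
  fixes f :: "'k::alg_closed_field ratfun"
  assumes "\<And>c. f \<noteq> const_rf c" "B \<noteq> 0"
  shows "rf_comp (Fract A B) f = rf_eval A f / rf_eval B f"
proof -
  let ?N = "numer (Fract A B)" and ?D = "denom (Fract A B)"
  have "A * ?D = ?N * B" using assms(2) by (rule numer_denom_cross)
  then have "rf_eval A f * rf_eval ?D f = rf_eval ?N f * rf_eval B f"
    by (metis rf_eval_mult)
  moreover have "rf_eval ?D f \<noteq> 0" "rf_eval B f \<noteq> 0"
    using assms numer_denom(1) by (auto simp: rf_eval_eq_0_iff)
  ultimately show ?thesis
    unfolding rf_comp_def rf_eval_def[symmetric] by (simp add: frac_eq_eq)
qed

lemma
  fixes f :: "'k::alg_closed_field ratfun"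
  assumes f: "\<And>c. f \<noteq> const_rf c"
  shows rf_comp_add: "rf_comp (g + h) f = rf_comp g f + rf_comp h f"
    and rf_comp_mult: "rf_comp (g * h) f = rf_comp g f * rf_comp h f"
proof -
  note c = rf_comp_Fract[OF f] and z = rf_eval_eq_0_iff[OF f]
  show "rf_comp (g + h) f = rf_comp g f + rf_comp h f"
    by (cases g; cases h) (simp add: c z field_simps)
  show "rf_comp (g * h) f = rf_comp g f * rf_comp h f"
    by (cases g; cases h) (simp add: c z field_simps)
qed

lemma rf_comp_to_fract: "rf_comp (to_fract A) f = rf_eval A f"
  using rf_comp_Fract_coprime[of A 1 f] by (simp add: to_fract_def)

section \<open>The derivation d/dt and its constants, the p-th powers\<close>

definition wronskian :: "'k::idom poly \<Rightarrow> 'k poly \<Rightarrow> 'k poly" where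
  "wronskian N D = pderiv N * D - N * pderiv D"

definition rf_deriv :: "'k::field ratfun \<Rightarrow> 'k ratfun" where
  "rf_deriv f = Fract (wronskian (numer f) (denom f)) (denom f ^ 2)"

lemma rf_deriv_Fract:
  fixes A B :: "'k::field poly"
  assumes "B \<noteq> 0"
  shows "rf_deriv (Fract A B) = Fract (wronskian A B) (B ^ 2)"
proof -
  let ?N = "numer (Fract A B)" and ?D = "denom (Fract A B)"
  have eq: "A * ?D = ?N * B" using assms by (rule numer_denom_cross)
  then have "pderiv (A * ?D) = pderiv (?N * B)" by simp
  then have "A * pderiv ?D + ?D * pderiv A = ?N * pderiv B + B * pderiv ?N" by (simp add: pderiv_mult)
  then have eq': "B * pderiv ?N = A * pderiv ?D + ?D * pderiv A - ?N * pderiv B" by simp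
  have "wronskian ?N ?D * B ^ 2 = ?D * B * (B * pderiv ?N) - (?N * B) * (B * pderiv ?D)"
    by (simp add: wronskian_def power2_eq_square algebra_simps)
  also have "\<dots> = ?D * B * (A * pderiv ?D + ?D * pderiv A - ?N * pderiv B) - (A * ?D) * (B * pderiv ?D)"
    by (simp only: eq' eq)
  also have "\<dots> = ?D * B * ?D * pderiv A - (?N * B) * (?D * pderiv B)"
    by (simp add: algebra_simps)
  also have "\<dots> = ?D * B * ?D * pderiv A - (A * ?D) * (?D * pderiv B)"
    by (simp only: eq)
  also have "\<dots> = wronskian A B * ?D ^ 2"
    by (simp add: wronskian_def power2_eq_square algebra_simps)
  finally have "wronskian ?N ?D * B ^ 2 = wronskian A B * ?D ^ 2" .
  then show ?thesis unfolding rf_deriv_def using assms numer_denom(1)[of "Fract A B"]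
    by (subst eq_fract(1)) auto
qed

lemma rf_deriv_const [simp]: "rf_deriv (const_rf c) = 0"
  by (simp add: const_rf_def to_fract_def rf_deriv_Fract wronskian_def pderiv_pCons fract_collapse)

lemma rf_deriv_0 [simp]: "rf_deriv 0 = 0"
  using rf_deriv_const[of 0] by simp

lemma rf_deriv_t [simp]: "rf_deriv t_rf = 1"
  by (simp add: t_rf_def to_fract_def rf_deriv_Fract wronskian_def pderiv_pCons One_fract_def pCons_one)

lemma rf_deriv_add: "rf_deriv (f + g) = rf_deriv f + rf_deriv g"
proof (cases f; cases g)
  fix A B C D :: "'a poly"
  assume fg: "f = Fract A B" "B \<noteq> 0" "g = Fract C D" "D \<noteq> 0"
  show ?thesis
    using fg by (simp add: rf_deriv_Fract eq_fract wronskian_def pderiv_mult pderiv_add power2_eq_square algebra_simps)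
qed

lemma rf_deriv_mult: "rf_deriv (f * g) = f * rf_deriv g + rf_deriv f * g"
proof (cases f; cases g)
  fix A B C D :: "'a poly"
  assume fg: "f = Fract A B" "B \<noteq> 0" "g = Fract C D" "D \<noteq> 0"
  show ?thesis
    using fg by (simp add: rf_deriv_Fract eq_fract wronskian_def pderiv_mult pderiv_add power2_eq_square algebra_simps)
qed

lemma rf_deriv_divide:
  assumes "g \<noteq> 0"
  shows "rf_deriv (f / g) = (rf_deriv f * g - f * rf_deriv g) / g ^ 2"
proof -
  have "rf_deriv f = rf_deriv ((f / g) * g)" using assms by simp
  then have "rf_deriv f = (f / g) * rf_deriv g + rf_deriv (f / g) * g" by (simp only: rf_deriv_mult)
  then show ?thesis using assms by (simp add: field_simps power2_eq_square)
qed

lemma rf_deriv_rf_eval: "rf_deriv (rf_eval A f) = rf_eval (pderiv A) f * rf_deriv f"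
  by (induction A) (simp_all add: rf_deriv_add rf_deriv_mult pderiv_pCons algebra_simps)

lemma rf_deriv_rf_comp:
  fixes f :: "'k::alg_closed_field ratfun"
  assumes f: "\<And>c. f \<noteq> const_rf c"
  shows "rf_deriv (rf_comp g f) = rf_comp (rf_deriv g) f * rf_deriv f"
proof (cases g)
  case (Fract A B)
  then have "rf_eval B f \<noteq> 0" by (simp add: rf_eval_eq_0_iff[OF f])
  with Fract show ?thesis
    by (simp add: rf_comp_Fract[OF f] rf_deriv_Fract rf_deriv_divide rf_deriv_rf_eval
        wronskian_def power2_eq_square) (simp add: field_simps)
qed

lemma rf_deriv_poly:
  "rf_deriv (poly Q x) = poly (map_poly rf_deriv Q) x + poly (pderiv Q) x * rf_deriv x"
  by (induction Q)
    (simp_all add: map_poly_pCons rf_deriv_add rf_deriv_mult pderiv_pCons algebra_simps)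

lemma rf_deriv_eq_0_iff:
  "B \<noteq> 0 \<Longrightarrow> rf_deriv (Fract A B) = 0 \<longleftrightarrow> wronskian A B = 0"
  by (simp add: rf_deriv_Fract Fract_eq_0_iff)

text \<open>Only exponents divisible by \<open>p\<close> survive, the coefficients have
  \<open>p\<close>-th roots because the field is algebraically closed, and taking
  \<open>p\<close>-th powers is additive.\<close>

lemma poly_pderiv_0_imp_power:
  fixes q :: "'k::alg_closed_field poly"
  assumes p: "CHAR('k) = p" "prime p" and q: "pderiv q = 0"
  shows "\<exists>r. q = r ^ p"
proof -
  have p0: "p > 0" using p by (simp add: prime_gt_0_nat)
  have "\<exists>r. coeff q (p * i) = r ^ p" for i
    using nth_root_exists[of p "coeff q (p * i)"] p0 by metis
  then obtain r where r: "\<And>i. coeff q (p * i) = r i ^ p" by metis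
  \<comment> \<open>The bound on \<open>i\<close> only has to let \<open>p * i\<close> reach
    \<open>degree q\<close>; the surplus terms are zero.\<close>
  have "q = (\<Sum>i\<le>degree q. monom (coeff q (p * i)) (p * i))"
  proof (rule poly_eqI)
    fix n
    have co: "coeff (\<Sum>i\<le>degree q. monom (coeff q (p * i)) (p * i)) n =
       (\<Sum>i\<le>degree q. if p * i = n then coeff q n else 0)"
      unfolding coeff_sum by (intro sum.cong) auto
    show "coeff q n = coeff (\<Sum>i\<le>degree q. monom (coeff q (p * i)) (p * i)) n"
    proof (cases "p dvd n")
      case True
      then obtain j where j: "n = p * j" by (auto elim: dvdE)
      have "(\<Sum>i\<le>degree q. if p * i = n then coeff q n else 0) = (\<Sum>i\<le>degree q. if i = j then coeff q n else 0)"
        using p0 j by (intro sum.cong) auto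
      also have "\<dots> = coeff q n"
      proof (cases "j \<le> degree q")
        case False
        then have "degree q < n" using p0 j by (metis le_trans linorder_not_le mult_le_mono1 nat_mult_1 Suc_leI One_nat_def)
        then show ?thesis using False by (simp add: coeff_eq_0)
      qed simp
      finally show ?thesis by (simp add: co)
    next
      case False
      then obtain m where m: "n = Suc m" by (cases n) auto
      have "coeff (pderiv q) m = 0" by (simp add: q)
      moreover have "(of_nat n :: 'k) \<noteq> 0" using False p by (simp add: of_nat_eq_0_iff_char_dvd)
      ultimately have "coeff q n = 0" using m by (simp add: coeff_pderiv del: of_nat_Suc)
      moreover have "(\<Sum>i\<le>degree q. if p * i = n then coeff q n else 0) = 0"
        using False by (intro sum.neutral) auto
      ultimately show ?thesis by (simp add: co)
    qed
  qed
  also have "\<dots> = (\<Sum>i\<le>degree q. monom (r i) i ^ p)"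
    by (intro sum.cong refl) (metis r monom_power mult.commute)
  also have "\<dots> = (\<Sum>i\<le>degree q. monom (r i) i) ^ p"
    using p by (subst freshmans_dream_sum) auto
  finally show ?thesis by blast
qed

text \<open>\<open>N * D ^ (p - 1)\<close> is \<open>D ^ p\<close> times \<open>N / D\<close>, and
  \<open>D ^ p\<close> is constant for the derivation, so the derivative is \<open>D ^ p\<close>
  times \<open>wronskian N D / D ^ 2\<close>.\<close>

lemma pderiv_mult_power_CHAR:
  fixes N D :: "'k::field poly"
  assumes "CHAR('k) = p" "p \<ge> 2"
  shows "pderiv (N * D ^ (p - 1)) = wronskian N D * D ^ (p - 2)"
proof -
  obtain q where q: "p = Suc (Suc q)" using assms(2) by (metis add_2_eq_Suc le_Suc_ex)
  have "(of_nat (Suc q) :: 'k) = - 1"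
    using of_nat_CHAR[where 'a='k] assms(1) q by (simp add: eq_neg_iff_add_eq_0 add.commute)
  then have "pderiv (D ^ Suc q) = - (D ^ q * pderiv D)"
    by (simp only: pderiv_power_Suc) simp
  then show ?thesis by (simp only: q pderiv_mult diff_Suc_1 diff_Suc_Suc diff_zero numeral_2_eq_2)
      (simp add: wronskian_def algebra_simps)
qed

text \<open>Writing \<open>A / B\<close> as \<open>A * B ^ (p - 1) / B ^ p\<close> reduces this to
  polynomials.\<close>

lemma rf_deriv_0_imp_power:
  fixes g :: "'k::alg_closed_field ratfun"
  assumes p: "CHAR('k) = p" "prime p" and g: "rf_deriv g = 0"
  shows "\<exists>r. g = r ^ p"
proof (cases g)
  case (Fract A B)
  obtain q where q: "p = Suc q" using p by (metis not0_implies_Suc not_prime_0)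
  have W: "wronskian A B = 0" using g Fract by (simp add: rf_deriv_eq_0_iff)
  have "pderiv (A * B ^ q) = 0"
    using pderiv_mult_power_CHAR[OF p(1) prime_ge_2_nat[OF p(2)], of A B] by (simp add: q W)
  then obtain r where r: "A * B ^ q = r ^ p" using poly_pderiv_0_imp_power[OF p] by blast
  have pw: "Fract x y ^ n = Fract (x ^ n) (y ^ n)" for x y :: "'k poly" and n
    by (induction n) (simp_all add: One_fract_def)
  have "g = Fract (A * B ^ q) (B * B ^ q)" using Fract by (simp add: eq_fract mult_ac)
  also have "\<dots> = Fract r B ^ p" by (simp add: r pw) (simp add: q)
  finally show ?thesis by blast
qed

lemma char_ratfun: "CHAR('k::field ratfun) = CHAR('k)"
proof (rule CHAR_eqI)
  have of_nat: "(of_nat n :: 'k ratfun) = to_fract (of_nat n)" for n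
    by (simp add: of_nat_fract to_fract_def)
  show "(of_nat CHAR('k) :: 'k ratfun) = 0"
    unfolding of_nat using of_nat_CHAR[where 'a="'k poly"] by simp
  show "CHAR('k) dvd n" if "(of_nat n :: 'k ratfun) = 0" for n
    using that unfolding of_nat by (simp add: of_nat_eq_0_iff_char_dvd)
qed

section \<open>Separable maps\<close>

text \<open>Gaussian elimination: a member with nonzero top coefficient clears that coefficient from
  the others, which leaves one polynomial and one dimension fewer.\<close>

lemma poly_family_dependent:
  fixes v :: "'i \<Rightarrow> 'k::field poly"
  assumes "finite S" "card S > m" "\<And>s i. s \<in> S \<Longrightarrow> m \<le> i \<Longrightarrow> coeff (v s) i = 0"
  shows "\<exists>c. (\<exists>s\<in>S. c s \<noteq> 0) \<and> (\<Sum>s\<in>S. smult (c s) (v s)) = 0"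
  using assms
proof (induction m arbitrary: S v)
  case 0
  then obtain s where "s \<in> S" by (metis card_gt_0_iff ex_in_conv)
  moreover have "v s = 0" if "s \<in> S" for s using 0(3) that by (intro poly_eqI) simp
  ultimately show ?case by (intro exI[of _ "\<lambda>_. 1"]) auto
next
  case (Suc m)
  show ?case
  proof (cases "\<forall>s\<in>S. coeff (v s) m = 0")
    case True
    then have "coeff (v s) i = 0" if "s \<in> S" "m \<le> i" for s i
      using Suc.prems(3)[of s i] that by (cases "i = m") auto
    then show ?thesis using Suc.IH[of S v] Suc.prems by auto
  next
    case False
    then obtain s0 where s0: "s0 \<in> S" "coeff (v s0) m \<noteq> 0" by blast
    define b where "b s = coeff (v s) m / coeff (v s0) m" for s
    define w where "w s = v s - smult (b s) (v s0)" for s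
    have "coeff (w s) i = 0" if "s \<in> S - {s0}" "m \<le> i" for s i
      using Suc.prems(3)[of s i] Suc.prems(3)[of s0 i] that s0 by (cases "i = m") (auto simp: w_def b_def)
    moreover have "card (S - {s0}) > m" using Suc.prems s0 by simp
    ultimately obtain c where c: "\<exists>s\<in>S - {s0}. c s \<noteq> 0" "(\<Sum>s\<in>S - {s0}. smult (c s) (w s)) = 0"
      using Suc.IH[of "S - {s0}" w] Suc.prems(1) by auto
    define c' where "c' = c(s0 := - (\<Sum>s\<in>S - {s0}. c s * b s))"
    have "(\<Sum>s\<in>S. smult (c' s) (v s)) = smult (c' s0) (v s0) + (\<Sum>s\<in>S - {s0}. smult (c s) (v s))"
      using Suc.prems(1) s0(1) by (subst sum.remove[of _ s0]) (auto simp: c'_def intro!: sum.cong)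
    also have "(\<Sum>s\<in>S - {s0}. smult (c s) (v s)) =
        (\<Sum>s\<in>S - {s0}. smult (c s) (w s)) + (\<Sum>s\<in>S - {s0}. smult (c s * b s) (v s0))"
      unfolding sum.distrib[symmetric] by (intro sum.cong refl) (simp add: w_def smult_diff_right)
    also have "\<dots> = smult (\<Sum>s\<in>S - {s0}. c s * b s) (v s0)"
      by (simp add: c(2) smult_sum)
    finally have "(\<Sum>s\<in>S. smult (c' s) (v s)) = 0"
      by (simp add: c'_def smult_add_left[symmetric] del: smult_minus_left)
    moreover have "\<exists>s\<in>S. c' s \<noteq> 0" using c(1) by (auto simp: c'_def)
    ultimately show ?thesis by blast
  qed
qed

text \<open>A dimension count: the products of powers of \<open>f\<close> and \<open>x\<close>,
  cleared of denominators, lie in a space of polynomials of bounded degree.\<close>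

lemma rf_algebraically_dependent:
  fixes f x :: "'k::field ratfun"
  obtains q J where "\<exists>j\<le>J. q j \<noteq> 0" "(\<Sum>j\<le>J. rf_eval (q j) f * x ^ j) = 0"
proof -
  let ?N = "numer f" and ?D = "denom f" and ?A = "numer x" and ?B = "denom x"
  define d where "d = max (degree ?N) (degree ?D)"
  define e where "e = max (degree ?A) (degree ?B)"
  \<comment> \<open>Makes the \<open>I * d + I + d + 1\<close> products outnumber the dimension
    \<open>I * d + d * e + 1\<close>.\<close>
  define I where "I = d * e + 1"
  define v where "v = (\<lambda>(i, j). ?N ^ i * ?D ^ (I - i) * (?A ^ j * ?B ^ (d - j)))"
  let ?S = "{..I} \<times> {..d}"
  have pw: "degree (P ^ k) \<le> k * b" if "degree P \<le> b" for P :: "'k poly" and k b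
    using that by (intro order_trans[OF degree_power_le]) (simp add: mult.commute)
  have pw2: "degree (P ^ k * Q ^ (n - k)) \<le> n * b" if "degree P \<le> b" "degree Q \<le> b" "k \<le> n"
    for P Q :: "'k poly" and k n b
  proof -
    have "degree (P ^ k * Q ^ (n - k)) \<le> k * b + (n - k) * b"
      using that by (intro order_trans[OF degree_mult_le] add_mono pw)
    also have "\<dots> = n * b" using that(3) by (simp flip: add_mult_distrib)
    finally show ?thesis .
  qed
  have deg: "degree (v s) \<le> I * d + d * e" if s: "s \<in> ?S" for s
  proof -
    obtain i j where ij: "s = (i, j)" "i \<le> I" "j \<le> d" using s by auto
    have "degree (?N ^ i * ?D ^ (I - i)) \<le> I * d" by (rule pw2) (use ij in \<open>auto simp: d_def\<close>)
    moreover have "degree (?A ^ j * ?B ^ (d - j)) \<le> d * e" by (rule pw2) (use ij in \<open>auto simp: e_def\<close>)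
    ultimately show ?thesis unfolding v_def ij(1) prod.case
      by (rule order_trans[OF degree_mult_le add_mono])
  qed
  have "card ?S > I * d + d * e + 1" by (simp add: I_def algebra_simps)
  moreover have "coeff (v s) i = 0" if "s \<in> ?S" "I * d + d * e + 1 \<le> i" for s i
    using deg[OF that(1)] that(2) by (intro coeff_eq_0) simp
  ultimately obtain c where c: "\<exists>s\<in>?S. c s \<noteq> 0" "(\<Sum>s\<in>?S. smult (c s) (v s)) = 0"
    using poly_family_dependent[of ?S "I * d + d * e + 1" v] by auto
  define q where "q j = (\<Sum>i\<le>I. monom (c (i, j)) i)" for j
  let ?E = "to_fract ?D ^ I * to_fract ?B ^ d"
  have "(\<Sum>j\<le>d. rf_eval (q j) f * x ^ j) = (\<Sum>j\<le>d. \<Sum>i\<le>I. const_rf (c (i, j)) * f ^ i * x ^ j)"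
    by (simp add: q_def sum_distrib_right)
  also have "\<dots> = (\<Sum>i\<le>I. \<Sum>j\<le>d. const_rf (c (i, j)) * f ^ i * x ^ j)"
    by (rule sum.swap)
  also have "\<dots> = (\<Sum>(i, j)\<in>?S. const_rf (c (i, j)) * f ^ i * x ^ j)"
    by (rule sum.cartesian_product)
  finally have "(\<Sum>j\<le>d. rf_eval (q j) f * x ^ j) * ?E =
      (\<Sum>(i, j)\<in>?S. const_rf (c (i, j)) * f ^ i * x ^ j * ?E)"
    by (simp only: sum_distrib_right case_prod_unfold)
  also have "\<dots> = (\<Sum>s\<in>?S. to_fract (smult (c s) (v s)))"
  proof (intro sum.cong refl)
    fix s assume "s \<in> ?S"
    then obtain i j where s: "s = (i, j)" "i \<le> I" "j \<le> d" by auto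
    have "const_rf (c (i, j)) * f ^ i * x ^ j * ?E =
        const_rf (c (i, j)) * ((f ^ i * to_fract ?D ^ I) * (x ^ j * to_fract ?B ^ d))"
      by (simp only: mult_ac)
    also have "\<dots> = const_rf (c s) * to_fract (v s)"
      unfolding power_mult_denom_power[OF s(2)] power_mult_denom_power[OF s(3)] by (simp add: s(1) v_def)
    also have "\<dots> = to_fract ([:c s:] * v s)" unfolding const_rf_def by (simp only: to_fract_mult)
    finally show "(case s of (i, j) \<Rightarrow> const_rf (c (i, j)) * f ^ i * x ^ j * ?E) = to_fract (smult (c s) (v s))"
      by (simp add: s(1))
  qed
  also have "\<dots> = to_fract (\<Sum>s\<in>?S. smult (c s) (v s))" by (simp only: to_fract_sum)
  finally have "(\<Sum>j\<le>d. rf_eval (q j) f * x ^ j) = 0"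
    using c(2) numer_denom(1)[of f] numer_denom(1)[of x] by simp
  moreover have "\<exists>j\<le>d. q j \<noteq> 0"
  proof -
    obtain i j where ij: "i \<le> I" "j \<le> d" "c (i, j) \<noteq> 0" using c(1) by auto
    then have "coeff (q j) i \<noteq> 0" by (simp add: q_def coeff_sum)
    then have "q j \<noteq> 0" by force
    with ij show ?thesis by blast
  qed
  ultimately show ?thesis using that by blast
qed

text \<open>
  The minimal polynomial of \<open>x\<close> over \<open>k(f)\<close> is separable: applying \<open>d/dt\<close> to \<open>Q(x) = 0\<close> in case
  \<open>Q' = 0\<close> gives a relation of smaller degree, so all coefficients of \<open>Q\<close> have derivative zero
  and \<open>Q\<close> would be a \<open>p\<close>-th power.
\<close>

lemma separable_map_if_rf_deriv:
  fixes f :: "'k::alg_closed_field ratfun"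
  assumes p: "CHAR('k) = p" "prime p" and f': "rf_deriv f \<noteq> 0"
  shows "separable_map f"
  unfolding separable_map_def
proof
  fix x :: "'k ratfun"
  have f: "f \<noteq> const_rf c" for c using f' by auto
  have p0: "p > 0" using p by (simp add: prime_gt_0_nat)
  define \<phi> where "\<phi> = (\<lambda>g. rf_comp g f)"
  have add: "\<phi> (g + h) = \<phi> g + \<phi> h" and mult: "\<phi> (g * h) = \<phi> g * \<phi> h" for g h
    by (simp_all add: \<phi>_def rf_comp_add[OF f] rf_comp_mult[OF f])
  have tofr: "\<phi> (to_fract A) = rf_eval A f" for A by (simp add: \<phi>_def rf_comp_to_fract)
  have zero: "\<phi> 0 = 0" and one: "\<phi> 1 = 1" using tofr[of 0] tofr[of 1] by simp_all
  have inj0: "\<phi> g = 0 \<longleftrightarrow> g = 0" for g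
  proof
    show "g = 0" if "\<phi> g = 0"
    proof (rule ccontr)
      assume "g \<noteq> 0"
      then have "\<phi> g * \<phi> (inverse g) = 1" using mult[of g "inverse g"] one by simp
      with that show False by simp
    qed
  qed (simp add: zero)
  have summ: "\<phi> (\<Sum>i\<in>I. g i) = (\<Sum>i\<in>I. \<phi> (g i))" for I :: "nat set" and g
    by (induction I rule: infinite_finite_induct) (simp_all add: zero add)
  have madd: "map_poly \<phi> (P + Q) = map_poly \<phi> P + map_poly \<phi> Q" for P Q
    by (intro poly_eqI) (simp add: coeff_map_poly zero add)
  have mmult: "map_poly \<phi> (P * Q) = map_poly \<phi> P * map_poly \<phi> Q" for P Q
    by (intro poly_eqI) (simp add: coeff_map_poly zero coeff_mult summ mult)
  have ofn: "\<phi> (of_nat n) = of_nat n" for n by (induction n) (simp_all add: zero one add)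
  have mderiv: "map_poly \<phi> (pderiv Q) = pderiv (map_poly \<phi> Q)" for Q
    by (intro poly_eqI) (simp add: coeff_map_poly zero coeff_pderiv mult ofn del: of_nat_Suc)
  have m1: "map_poly \<phi> 1 = 1" by (intro poly_eqI) (simp add: coeff_map_poly zero one)
  have m0: "map_poly \<phi> Q = 0 \<longleftrightarrow> Q = 0" for Q
    by (auto simp: poly_eq_iff coeff_map_poly zero inj0)
  \<comment> \<open>The subfield is handled through its isomorphic copy k(t): \<open>Q\<close> has
    coefficients in the copy, and \<open>ev Q\<close> is the value at \<open>x\<close> after pulling
    them back along \<open>f\<close>.\<close>
  define ev where "ev Q = poly (map_poly \<phi> Q) x" for Q
  have ev_add: "ev (P + Q) = ev P + ev Q" and ev_mult: "ev (P * Q) = ev P * ev Q" for P Q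
    by (simp_all add: ev_def madd mmult)
  have ev_sum: "ev Q = (\<Sum>i\<le>n. \<phi> (coeff Q i) * x ^ i)" if "degree Q \<le> n" for Q n
  proof -
    have "degree (map_poly \<phi> Q) \<le> n"
      using that by (intro degree_le) (simp add: coeff_map_poly zero coeff_eq_0)
    then have "ev Q = (\<Sum>i\<le>n. coeff (map_poly \<phi> Q) i * x ^ i)"
      unfolding ev_def poly_altdef by (intro sum.mono_neutral_left) (auto simp: coeff_eq_0)
    then show ?thesis by (simp add: coeff_map_poly zero)
  qed
  obtain q J where qJ: "\<exists>j\<le>J. q j \<noteq> 0" "(\<Sum>j\<le>J. rf_eval (q j) f * x ^ j) = 0"
    using rf_algebraically_dependent[of f x] .
  have "\<exists>Q. Q \<noteq> 0 \<and> ev Q = 0"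
  proof (intro exI conjI)
    let ?Q = "\<Sum>j\<le>J. monom (to_fract (q j)) j"
    have co: "coeff ?Q j = (if j \<le> J then to_fract (q j) else 0)" for j
      by (simp add: coeff_sum)
    have "degree ?Q \<le> J" by (rule degree_le) (simp add: co)
    then show "ev ?Q = 0" using qJ(2) by (subst ev_sum[of _ J]) (simp_all add: co tofr)
    show "?Q \<noteq> 0" using qJ(1) co by (metis coeff_0 to_fract_eq_0_iff)
  qed
  then obtain Q1 where Q1: "Q1 \<noteq> 0" "ev Q1 = 0"
    and min1: "\<And>Q. Q \<noteq> 0 \<Longrightarrow> ev Q = 0 \<Longrightarrow> degree Q1 \<le> degree Q"
    using ex_has_least_nat[of "\<lambda>Q. Q \<noteq> 0 \<and> ev Q = 0" _ degree] by blast
  \<comment> \<open>The leading coefficient 1 has derivative zero, so differentiating the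
    coefficients lowers the degree.\<close>
  define Q0 where "Q0 = [:inverse (lead_coeff Q1):] * Q1"
  have Q0: "Q0 \<noteq> 0" "ev Q0 = 0" "lead_coeff Q0 = 1" "degree Q0 = degree Q1"
    using Q1 unfolding Q0_def by (simp_all only: ev_mult) (simp_all add: lead_coeff_smult)
  have min: "degree Q0 \<le> degree Q" if "Q \<noteq> 0" "ev Q = 0" for Q
    using min1[OF that] Q0(4) by simp
  have deg0: "degree Q0 > 0"
  proof (rule ccontr)
    assume "\<not> degree Q0 > 0"
    then have "Q0 = 1" using Q0(3) by (metis degree_eq_zeroE lead_coeff_pCons(2) gr0I one_pCons)
    then show False using Q0(2) by (simp add: ev_def m1)
  qed
  have pd: "pderiv Q0 \<noteq> 0"
  proof
    assume pd: "pderiv Q0 = 0"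
    have hd: "rf_deriv (\<phi> g) = \<phi> (rf_deriv g) * rf_deriv f" for g
      by (simp add: \<phi>_def rf_deriv_rf_comp[OF f])
    have "map_poly rf_deriv (map_poly \<phi> Q0) = map_poly (\<lambda>g. \<phi> (rf_deriv g) * rf_deriv f) Q0"
      by (intro poly_eqI) (simp add: coeff_map_poly zero hd)
    also have "\<dots> = map_poly \<phi> (map_poly rf_deriv Q0) * [:rf_deriv f:]"
      by (intro poly_eqI) (simp add: coeff_map_poly zero mult.commute)
    finally have "rf_deriv (ev Q0) = ev (map_poly rf_deriv Q0) * rf_deriv f"
      unfolding ev_def rf_deriv_poly mderiv[symmetric] pd by simp
    then have ev0: "ev (map_poly rf_deriv Q0) = 0" using f' Q0(2) by simp
    have "degree (map_poly rf_deriv Q0) < degree Q0"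
    proof (rule degree_lessI)
      show "\<forall>k\<ge>degree Q0. coeff (map_poly rf_deriv Q0) k = 0"
      proof (intro allI impI)
        fix k assume "k \<ge> degree Q0"
        then show "coeff (map_poly rf_deriv Q0) k = 0"
          using Q0(3) rf_deriv_const[of "1::'k"]
          by (cases "k = degree Q0") (simp_all add: coeff_map_poly coeff_eq_0)
      qed
    qed (use deg0 in simp)
    then have "map_poly rf_deriv Q0 = 0" using min[OF _ ev0] by (metis leD)
    then have "rf_deriv (coeff Q0 i) = 0" for i by (metis coeff_0 coeff_map_poly rf_deriv_0)
    then have "\<exists>r. coeff Q0 i = r ^ p" for i using rf_deriv_0_imp_power[OF p] by blast
    then obtain r where r: "\<And>i. coeff Q0 i = r i ^ p" by metis
    let ?n = "degree Q0"
    \<comment> \<open>A \<open>p\<close>-th root of \<open>Q0\<close> in the sense that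
      \<open>ev S ^ p = ev Q0\<close>; its degree is smaller, against minimality.\<close>
    define S where "S = (\<Sum>i\<le>?n. monom (r (p * i)) i)"
    have coS: "coeff S i = (if i \<le> ?n then r (p * i) else 0)" for i
      unfolding S_def by (simp add: coeff_sum)
    have dS: "degree S \<le> ?n" by (rule degree_le) (simp add: coS)
    have pw: "\<phi> (g ^ m) = \<phi> g ^ m" for g m by (induction m) (simp_all add: one mult)
    have coQ: "coeff Q0 j = 0" if nd: "\<not> p dvd j" for j
    proof -
      obtain m where m: "j = Suc m" using nd by (cases j) auto
      have "(of_nat j :: 'k ratfun) \<noteq> 0" using nd p by (simp add: of_nat_eq_0_iff_char_dvd char_ratfun)
      moreover have "coeff (pderiv Q0) m = 0" by (simp add: pd)
      ultimately show ?thesis using m by (simp add: coeff_pderiv del: of_nat_Suc)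
    qed
    have "ev S ^ p = (\<Sum>i\<le>?n. (\<phi> (r (p * i)) * x ^ i) ^ p)"
      unfolding ev_sum[OF dS] using p
      by (subst freshmans_dream_sum) (auto simp: char_ratfun coS intro!: sum.cong)
    also have "\<dots> = (\<Sum>i\<le>?n. \<phi> (coeff Q0 (p * i)) * x ^ (p * i))"
      by (simp add: r pw power_mult_distrib power_mult mult.commute[of p] flip: power_mult)
    also have "\<dots> = (\<Sum>j\<in>(*) p ` {..?n}. \<phi> (coeff Q0 j) * x ^ j)"
      using p0 by (subst sum.reindex) (auto simp: inj_on_def)
    also have "\<dots> = (\<Sum>j\<le>p * ?n. \<phi> (coeff Q0 j) * x ^ j)"
    proof (intro sum.mono_neutral_left ballI)
      fix j assume j: "j \<in> {..p * ?n} - (*) p ` {..?n}"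
      then have "\<not> p dvd j" using p0 by (auto elim!: dvdE)
      then show "\<phi> (coeff Q0 j) * x ^ j = 0" by (simp add: coQ zero)
    qed auto
    also have "\<dots> = ev Q0" using p0 by (intro ev_sum[symmetric]) simp
    finally have "ev S = 0" using Q0(2) p0 by simp
    have "p dvd ?n" using coQ[of ?n] Q0(3) by auto
    then obtain j where j: "?n = p * j" by (auto elim: dvdE)
    then have "r (p * j) \<noteq> 0" using r[of "p * j"] Q0(3) p0 by (metis power_0_left gr_implies_not0 zero_neq_one)
    moreover have "j \<le> ?n" using j p0 by simp
    ultimately have "S \<noteq> 0" using coS[of j] by auto
    then have "?n \<le> degree S" using min \<open>ev S = 0\<close> by blast
    moreover have "coeff S i = 0" if "i \<ge> ?n" for i
    proof -
      have "p * i > ?n"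
      proof -
        have "p * i \<ge> 2 * i" using p by (intro mult_le_mono1) (rule prime_ge_2_nat)
        then show ?thesis using that deg0 by linarith
      qed
      then have "r (p * i) ^ p = 0" using r[of "p * i"] by (simp add: coeff_eq_0)
      then show ?thesis by (simp add: coS)
    qed
    then have "degree S < ?n" using deg0 by (intro degree_lessI) auto
    ultimately show False by simp
  qed
  have "coprime Q0 (pderiv Q0)"
  proof (rule coprimeI)
    fix c assume c: "c dvd Q0" "c dvd pderiv Q0"
    from c(1) obtain h where h: "Q0 = c * h" by (elim dvdE)
    then have ch0: "c \<noteq> 0" "h \<noteq> 0" using Q0(1) by auto
    have "degree c \<le> degree (pderiv Q0)" using c(2) pd by (rule dvd_imp_degree_le)
    also have "\<dots> \<le> degree Q0 - 1" by (rule degree_pderiv_le)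
    also have "\<dots> < degree Q0" using deg0 by simp
    finally have "ev c \<noteq> 0" using min[OF ch0(1)] by fastforce
    then have "ev h = 0" using h Q0(2) by (auto simp: ev_mult)
    then have "degree Q0 \<le> degree h" using min ch0 by blast
    then have "degree c = 0" using h ch0 by (simp add: degree_mult_eq)
    then show "is_unit c" using ch0 by (simp add: is_unit_iff_degree)
  qed
  \<comment> \<open>A Bezout identity carries coprimality over to the polynomials with coefficients
    in the subfield.\<close>
  then obtain u v where "u * Q0 + v * pderiv Q0 = 1" using poly_bezout by blast
  then have "map_poly \<phi> (u * Q0 + v * pderiv Q0) = 1" by (simp add: m1)
  then have bez: "map_poly \<phi> u * map_poly \<phi> Q0 + map_poly \<phi> v * pderiv (map_poly \<phi> Q0) = 1"
    by (simp only: madd mmult mderiv)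
  have "coprime (map_poly \<phi> Q0) (pderiv (map_poly \<phi> Q0))"
  proof (rule coprimeI)
    fix c assume "c dvd map_poly \<phi> Q0" "c dvd pderiv (map_poly \<phi> Q0)"
    then show "is_unit c" using bez by (metis dvd_add dvd_mult)
  qed
  moreover have "\<forall>i. coeff (map_poly \<phi> Q0) i \<in> range (\<lambda>g. rf_comp g f)"
    by (auto simp: coeff_map_poly zero) (simp add: \<phi>_def)
  ultimately show "\<exists>Q. Q \<noteq> 0 \<and> (\<forall>i. coeff Q i \<in> range (\<lambda>g. rf_comp g f)) \<and>
      coprime Q (pderiv Q) \<and> poly Q x = 0"
    using Q0 m0 by (intro exI[of _ "map_poly \<phi> Q0"]) (simp add: ev_def)
qed

text \<open>If \<open>f\<close> has derivative zero, so does every element of the subfield.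
  Differentiating Q(t) = 0 then gives Q'(t) = 0, which is impossible for \<open>Q\<close> coprime to
  its derivative.\<close>

lemma rf_deriv_nonzero_if_separable_map:
  fixes f :: "'k::field ratfun"
  assumes "separable_map f"
  shows "rf_deriv f \<noteq> 0"
proof
  assume f': "rf_deriv f = 0"
  obtain Q :: "'k ratfun poly" where Q: "\<And>i. coeff Q i \<in> range (\<lambda>g. rf_comp g f)"
    "coprime Q (pderiv Q)" "poly Q t_rf = 0"
    using assms unfolding separable_map_def by blast
  have "rf_deriv (rf_comp g f) = 0" for g
  \<comment> \<open>For constant \<open>f\<close> the divisor can be zero;
    \<open>rf_comp g f\<close> is then 0 by the convention for division.\<close>
  proof (cases "rf_eval (denom g) f = 0")
    case False
    then show ?thesis
      by (simp add: rf_comp_def rf_eval_def[symmetric] rf_deriv_divide rf_deriv_rf_eval f')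
  qed (simp add: rf_comp_def rf_eval_def[symmetric])
  then have "rf_deriv (coeff Q i) = 0" for i using Q(1)[of i] by auto
  then have "map_poly rf_deriv Q = 0" by (intro poly_eqI) (simp add: coeff_map_poly)
  then have "poly (pderiv Q) t_rf = 0"
    using rf_deriv_poly[of Q t_rf] Q(3) by simp
  moreover obtain u v where "u * Q + v * pderiv Q = 1" using poly_bezout[OF Q(2)] by blast
  then have "poly (u * Q + v * pderiv Q) t_rf = 1" by simp
  ultimately show False using Q(3) by simp
qed

section \<open>Ramification of maps in reduced form\<close>

text \<open>The value and the order of vanishing at \<open>P\<close> of a polynomial regarded as a binary form of degree \<open>d\<close>.\<close>

fun hval :: "nat \<Rightarrow> 'k::field proj_line \<Rightarrow> 'k poly \<Rightarrow> 'k" where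
  "hval d (Aff a) N = poly N a"
| "hval d Infty N = coeff N d"

fun vord :: "nat \<Rightarrow> 'k::field proj_line \<Rightarrow> 'k poly \<Rightarrow> nat" where
  "vord d (Aff a) s = order a s"
| "vord d Infty s = d - degree s"

text \<open>Unlike \<open>vord\<close>, this treats the zero polynomial as vanishing to every
  order.\<close>

fun vanishes_to :: "nat \<Rightarrow> 'k::field proj_line \<Rightarrow> nat \<Rightarrow> 'k poly \<Rightarrow> bool" where
  "vanishes_to d (Aff a) m s \<longleftrightarrow> [:-a, 1:] ^ m dvd s"
| "vanishes_to d Infty m s \<longleftrightarrow> s = 0 \<or> degree s + m \<le> d"

text \<open>The binary form of degree \<open>d\<close> that cuts out the fibre of [N : D] through
  \<open>P\<close>. It involves no division, so poles of the map are not special.\<close>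

definition fibre_form :: "nat \<Rightarrow> 'k::field poly \<Rightarrow> 'k poly \<Rightarrow> 'k proj_line \<Rightarrow> 'k poly" where
  "fibre_form d N D P = smult (hval d P D) N - smult (hval d P N) D"

lemma hval_linear [simp]:
  "hval d P (A + B) = hval d P A + hval d P B" "hval d P (A - B) = hval d P A - hval d P B"
  "hval d P (smult c A) = c * hval d P A"
  by (cases P; simp)+

lemma vord_smult [simp]: "c \<noteq> 0 \<Longrightarrow> vord d P (smult c s) = vord d P s"
  by (cases P) (simp_all add: order_smult)

lemma vord_uminus [simp]: "vord d P (- s) = vord d P s"
  by (cases P) simp_all

lemma vord_add_vanishes_to:
  assumes "s \<noteq> 0" "degree s \<le> d" "vord d P s < p" "vanishes_to d P p s'"
  shows "vord d P (s + s') = vord d P s" "s + s' \<noteq> 0"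
proof -
  have "vord d P (s + s') = vord d P s \<and> s + s' \<noteq> 0"
  proof (cases P)
    case (Aff a)
    let ?e = "order a s" and ?X = "[:-a, 1:]"
    have X: "?X ^ p dvd s'" "?e < p" using assms Aff by simp_all
    then have "?X ^ ?e dvd s'" "?X ^ Suc ?e dvd s'"
      by (meson dvd_trans le_imp_power_dvd less_imp_le Suc_leI)+
    moreover have "?X ^ ?e dvd s" by (rule order_1)
    moreover have "\<not> ?X ^ Suc ?e dvd s" using assms(1) by (rule order_2)
    ultimately have 1: "?X ^ ?e dvd s + s'" and 2: "\<not> ?X ^ Suc ?e dvd s + s'"
      by (simp_all only: dvd_add dvd_add_left_iff not_False_eq_True)
    then show ?thesis using Aff by (auto simp: order_divides simp del: power_Suc)
  next
    case Infty
    show ?thesis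
    proof (cases "s' = 0")
      case False
      then have "degree s' < degree s" using assms Infty by auto
      then show ?thesis using Infty assms(1) by (auto simp: degree_add_eq_left add_eq_0_iff)
    qed (use assms in auto)
  qed
  then show "vord d P (s + s') = vord d P s" "s + s' \<noteq> 0" by auto
qed

definition reduced_pair :: "nat \<Rightarrow> 'k::field poly \<Rightarrow> 'k poly \<Rightarrow> bool" where
  "reduced_pair d N D \<longleftrightarrow> coprime N D \<and> d = max (degree N) (degree D) \<and> d > 0"

lemma coprime_not_both_root:
  fixes N D :: "'k::field poly"
  assumes "coprime N D"
  shows "poly N a \<noteq> 0 \<or> poly D a \<noteq> 0"
proof -
  obtain u v where "u * N + v * D = 1" using poly_bezout[OF assms] by blast
  then have "poly (u * N + v * D) a = 1" by simp
  then show ?thesis by auto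
qed

lemma reduced_pair_hval:
  assumes "reduced_pair d N D"
  shows "hval d P N \<noteq> 0 \<or> hval d P D \<noteq> 0"
proof (cases P)
  case (Aff a)
  then show ?thesis using assms coprime_not_both_root[of N D a] by (simp add: reduced_pair_def)
next
  case Infty
  then show ?thesis using assms
    by (auto simp: reduced_pair_def max_def split: if_splits)
qed

lemma reduced_pair_not_proportional:
  assumes "reduced_pair d N D" "smult a N = smult b D"
  shows "a = 0 \<and> b = 0"
proof (rule ccontr)
  assume ab: "\<not> ?thesis"
  have u: "degree A = 0 \<and> degree B = 0"
    if "coprime A B" "smult a A = smult b B" "a \<noteq> 0" for A B :: "'a poly" and a b
  proof -
    have "smult (1 / a) (smult a A) = smult (1 / a) (smult b B)" by (simp only: that(2))
    then have "A = smult (b / a) B" using that(3) by simp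
    then have "B dvd A" by (metis dvd_refl dvd_smult)
    then have "is_unit B" using that(1) by (meson coprime_common_divisor dvd_refl)
    then have "degree B = 0" by (auto simp: is_unit_poly_iff)
    then show ?thesis using \<open>A = smult (b / a) B\<close> by (metis degree_smult_le le_zero_eq)
  qed
  have "degree N = 0 \<and> degree D = 0"
  proof (cases "a = 0")
    case True
    then show ?thesis using u[of D N b a] assms ab by (auto simp: reduced_pair_def coprime_commute)
  next
    case False
    then show ?thesis using u[of N D a b] assms by (auto simp: reduced_pair_def)
  qed
  with assms(1) show False by (auto simp: reduced_pair_def)
qed

lemma reduced_pair_nonzero:
  assumes "reduced_pair d N D"
  shows "N \<noteq> 0" "D \<noteq> 0"
  using reduced_pair_not_proportional[OF assms, of 1 0] reduced_pair_not_proportional[OF assms, of 0 1]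
  by auto

lemma fibre_form_nonzero:
  assumes "reduced_pair d N D"
  shows "fibre_form d N D P \<noteq> 0"
  using reduced_pair_not_proportional[OF assms] reduced_pair_hval[OF assms]
  unfolding fibre_form_def by auto

lemma degree_fibre_form_le:
  assumes "reduced_pair d N D"
  shows "degree (fibre_form d N D P) \<le> d"
  unfolding fibre_form_def using assms
  by (intro degree_diff_le) (auto intro: order_trans[OF degree_smult_le] simp: reduced_pair_def)

section \<open>Degree, values and ramification read off from a reduced pair\<close>

lemma map_degree_Fract:
  assumes "reduced_pair d N D"
  shows "map_degree (Fract N D) = d"
proof -
  obtain u where "u \<noteq> 0" "numer (Fract N D) = smult u N" "denom (Fract N D) = smult u D"
    using lowest_terms_unique[of N D] assms reduced_pair_nonzero[OF assms] by (auto simp: reduced_pair_def)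
  then show ?thesis using assms by (simp add: map_degree_def reduced_pair_def)
qed

lemma map_at_Fract:
  assumes "reduced_pair d N D"
  shows "map_at (Fract N D) P = (if hval d P D = 0 then Infty else Aff (hval d P N / hval d P D))"
proof -
  obtain u where "u \<noteq> 0" "numer (Fract N D) = smult u N" "denom (Fract N D) = smult u D"
    using lowest_terms_unique[of N D] assms reduced_pair_nonzero[OF assms] by (auto simp: reduced_pair_def)
  then show ?thesis by (cases P) (simp_all add: map_degree_Fract[OF assms])
qed

lemma ord_at_Fract:
  assumes "A \<noteq> 0" "B \<noteq> 0"
  shows "ord_at (Aff a) (Fract A B) = int (order a A) - int (order a B)"
    and "ord_at Infty (Fract A B) = int (degree B) - int (degree A)"
proof -
  let ?N = "numer (Fract A B)" and ?D = "denom (Fract A B)"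
  have eq: "A * ?D = ?N * B" using assms(2) by (rule numer_denom_cross)
  have D0: "?D \<noteq> 0" by (rule numer_denom)
  then have N0: "?N \<noteq> 0" using eq assms by auto
  have "order a (A * ?D) = order a (?N * B)" "degree (A * ?D) = degree (?N * B)" by (simp_all add: eq)
  then have "order a A + order a ?D = order a ?N + order a B" "degree A + degree ?D = degree ?N + degree B"
    using assms D0 N0 by (simp_all add: order_mult degree_mult_eq)
  then show "ord_at (Aff a) (Fract A B) = int (order a A) - int (order a B)"
    "ord_at Infty (Fract A B) = int (degree B) - int (degree A)" by simp_all
qed

lemma rf_comp_local_param_Aff: "rf_comp (local_param (Aff b)) f = f - const_rf b"
proof -
  have "local_param (Aff b) = to_fract [:-b, 1:]" by (simp add: t_rf_def const_rf_def flip: to_fract_diff)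
  then show ?thesis by (simp add: rf_comp_to_fract)
qed

lemma rf_comp_local_param_Infty:
  fixes f :: "'k::field ratfun"
  shows "rf_comp (local_param Infty) f = 1 / f"
proof -
  have "local_param Infty = Fract 1 [:0, 1::'k:]" by (simp add: t_rf_def to_fract_def)
  then show ?thesis by (simp add: rf_comp_Fract_coprime[of 1 "[:0, 1:]"] del: local_param.simps)
qed

text \<open>The pulled back local parameter is \<open>D / N\<close> at a pole and
  \<open>(N - b D) / D\<close> elsewhere. In both cases the denominator does not vanish at
  \<open>P\<close> as a form of degree \<open>d\<close>, and the numerator is the fibre form up to a
  scalar.\<close>

lemma ram_index_Fract:
  assumes N: "reduced_pair d N D"
  shows "ram_index (Fract N D) P = int (vord d P (fibre_form d N D P))"
proof -
  note nz = reduced_pair_nonzero[OF N]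
  have deg: "degree N \<le> d" "degree D \<le> d" using N by (auto simp: reduced_pair_def)
  show ?thesis
  proof (cases "hval d P D = 0")
    case True
    then have N0: "hval d P N \<noteq> 0" using reduced_pair_hval[OF N] by blast
    have "ram_index (Fract N D) P = ord_at P (Fract D N)"
      unfolding ram_index_def map_at_Fract[OF N] using True nz
      by (simp add: rf_comp_local_param_Infty One_fract_def del: local_param.simps)
    also have "\<dots> = int (vord d P D)"
    proof (cases P)
      case (Aff a)
      then show ?thesis using N0 nz by (simp add: ord_at_Fract order_0I del: ord_at.simps)
    next
      case Infty
      then have "degree N = d" using N0 deg by (simp add: antisym le_degree)
      then show ?thesis using Infty nz deg by (simp add: ord_at_Fract of_nat_diff del: ord_at.simps)
    qed
    also have "vord d P D = vord d P (fibre_form d N D P)"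
      using True N0 by (simp add: fibre_form_def)
    finally show ?thesis .
  next
    case False
    let ?b = "hval d P N / hval d P D"
    let ?s = "fibre_form d N D P"
    have s: "N - smult ?b D = smult (1 / hval d P D) ?s"
      using False by (simp add: fibre_form_def smult_diff_right)
    have "ram_index (Fract N D) P = ord_at P (Fract N D - const_rf ?b)"
      unfolding ram_index_def map_at_Fract[OF N] using False
      by (simp add: rf_comp_local_param_Aff del: local_param.simps)
    also have "Fract N D - const_rf ?b = Fract (N - smult ?b D) D"
      using nz by (simp add: const_rf_def to_fract_def)
    also have "ord_at P \<dots> = int (vord d P (N - smult ?b D))"
    proof -
      have n0: "N - smult ?b D \<noteq> 0" unfolding s using fibre_form_nonzero[OF N] False by simp
      show ?thesis
      proof (cases P)
        case (Aff a)
        then show ?thesis using False nz n0 by (simp add: ord_at_Fract order_0I del: ord_at.simps)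
      next
        case Infty
        then have "degree D = d" using False deg by (simp add: antisym le_degree)
        moreover have "degree (N - smult ?b D) \<le> d" unfolding s
          using degree_fibre_form_le[OF N] by (meson degree_smult_le order_trans)
        ultimately show ?thesis using Infty nz n0 by (simp add: ord_at_Fract of_nat_diff del: ord_at.simps)
      qed
    qed
    also have "\<dots> = int (vord d P ?s)" unfolding s using False by simp
    finally show ?thesis .
  qed
qed

lemma ramified_maps_Fract_iff:
  fixes N D :: "'k::alg_closed_field poly"
  assumes "CHAR('k) = p" "prime p" "reduced_pair d N D"
  shows "Fract N D \<in> ramified_maps n d e P \<longleftrightarrow>
    wronskian N D \<noteq> 0 \<and> (\<forall>i\<in>{1..n}. vord d (P i) (fibre_form d N D (P i)) = e i)"
proof -
  have "separable_map (Fract N D) \<longleftrightarrow> wronskian N D \<noteq> 0"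
    using separable_map_if_rf_deriv[OF assms(1,2), of "Fract N D"]
      rf_deriv_nonzero_if_separable_map[of "Fract N D"] reduced_pair_nonzero[OF assms(3)]
    by (auto simp: rf_deriv_eq_0_iff)
  then show ?thesis
    using assms(3) by (simp add: ramified_maps_def map_degree_Fract ram_index_Fract)
qed

text \<open>A Moebius transformation of the image moves the value at a given point to infinity.\<close>

lemma ramified_map_with_pole:
  fixes P :: "nat \<Rightarrow> 'k::alg_closed_field proj_line"
  assumes p: "CHAR('k) = p" "prime p" and d: "d > 0" and f: "f \<in> ramified_maps n d e P"
  obtains N D where "reduced_pair d N D" "hval d Q D = 0" "Fract N D \<in> ramified_maps n d e P"
proof -
  define N0 where "N0 = numer f"
  define D0 where "D0 = denom f"
  have f_eq: "f = Fract N0 D0" using numer_denom(3)[of f] by (simp add: N0_def D0_def)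
  have r0: "reduced_pair d N0 D0"
    using f d numer_denom(2)[of f]
    by (auto simp: ramified_maps_def map_degree_def reduced_pair_def N0_def D0_def)
  show ?thesis
  proof (cases "hval d Q D0 = 0")
    case True
    then show ?thesis using that[OF r0] f f_eq by simp
  next
    case False
    define b where "b = hval d Q N0 / hval d Q D0"
    \<comment> \<open>The new map is \<open>1 / (f - b)\<close>; its Wronskian and fibre forms
      change only by a sign.\<close>
    let ?D = "N0 - smult b D0"
    have "coprime D0 ?D"
    proof (rule coprimeI)
      fix c assume c: "c dvd D0" "c dvd ?D"
      then have "c dvd ?D + smult b D0" by (intro dvd_add dvd_smult)
      then have "c dvd N0" by simp
      then show "is_unit c" using c(1) r0 by (meson coprime_common_divisor reduced_pair_def)
    qed
    moreover have "d = max (degree D0) (degree ?D)"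
    proof -
      have 1: "degree (smult b D0) \<le> degree D0" by (rule degree_smult_le)
      have "degree ?D \<le> max (degree N0) (degree (smult b D0))" by (rule degree_diff_le_max)
      moreover have "degree (?D + smult b D0) \<le> max (degree ?D) (degree (smult b D0))" by (rule degree_add_le_max)
      ultimately show ?thesis using r0 1 by (simp add: reduced_pair_def)
    qed
    ultimately have r: "reduced_pair d D0 ?D" using d by (simp add: reduced_pair_def)
    have W: "wronskian D0 ?D = - wronskian N0 D0"
      by (simp add: wronskian_def pderiv_diff pderiv_smult algebra_simps)
    have "fibre_form d D0 ?D R = - fibre_form d N0 D0 R" for R
      by (simp add: fibre_form_def algebra_simps smult_diff_left smult_diff_right)
    with W f have "Fract D0 ?D \<in> ramified_maps n d e P"
      unfolding f_eq ramified_maps_Fract_iff[OF p r0] ramified_maps_Fract_iff[OF p r] by simp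
    moreover have "hval d Q ?D = 0" using False by (simp add: b_def)
    ultimately show ?thesis using that[OF r] by blast
  qed
qed

section \<open>Infinitely many maps\<close>

lemma linear_power_CHAR:
  fixes a :: "'k::field"
  assumes "CHAR('k) = p" "prime p"
  shows "[:-a, 1:] ^ p = monom 1 p - [:a ^ p:]"
proof -
  have "([:0, 1:] - [:a:]) ^ p = [:0, 1:] ^ p - [:a:] ^ p"
  proof -
    have "([:0, 1:] - [:a:] + [:a:]) ^ p = ([:0, 1:] - [:a:]) ^ p + [:a:] ^ p"
      using assms by (intro freshmans_dream) auto
    then show ?thesis by simp
  qed
  moreover have "[:a:] ^ p = [:a ^ p:]" by (rule poly_const_pow)
  ultimately show ?thesis by (simp add: monom_altdef)
qed

text \<open>
  If \<open>D\<close> vanishes to order more than \<open>p\<close> at \<open>Q\<close>, then \<open>K / D\<close> is the \<open>p\<close>-th power of a coordinate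
  with its pole at \<open>Q\<close>: \<open>K = t ^ p * D\<close> if \<open>Q\<close> is \<open>Infty\<close>, and \<open>D = (t - a) ^ p * K\<close> if \<open>Q\<close> is \<open>Aff a\<close>.
\<close>

lemma pth_power_with_pole:
  fixes D :: "'k::field poly"
  assumes p: "CHAR('k) = p" "prime p" and D: "D \<noteq> 0" "degree D \<le> d" and Q: "vord d Q D > p"
  obtains K where "degree K < d" "\<And>b. poly D b = 0 \<Longrightarrow> poly K b = 0" "wronskian K D = 0"
    "\<And>l. K \<noteq> smult l D" "\<And>R. R \<noteq> Q \<Longrightarrow> vanishes_to d R p (fibre_form d K D R)"
    "fibre_form d K D Q = 0"
proof -
  have p0: "p > 0" using p by (simp add: prime_gt_0_nat)
  have dp: "pderiv (monom (1::'k) p) = 0" using p by (simp add: pderiv_monom of_nat_eq_0_iff_char_dvd)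
  show ?thesis
  proof (cases Q)
    case Infty
    let ?K = "monom 1 p * D"
    have dK: "degree ?K = p + degree D" using D by (simp add: degree_mult_eq degree_monom_eq)
    have deg: "degree ?K < d" using Q Infty dK by simp
    show ?thesis
    proof (rule that[of ?K])
      show "degree ?K < d" by (rule deg)
      show "poly ?K b = 0" if "poly D b = 0" for b using that by simp
      show "wronskian ?K D = 0" by (simp add: wronskian_def pderiv_mult dp)
      show "?K \<noteq> smult l D" for l
      proof
        assume "?K = smult l D"
        then have "degree ?K \<le> degree D" by (metis degree_smult_le)
        then show False using dK p0 by simp
      qed
      show "fibre_form d ?K D Q = 0"
        using Infty deg Q by (simp add: fibre_form_def coeff_eq_0)
      show "vanishes_to d R p (fibre_form d ?K D R)" if "R \<noteq> Q" for R
      proof (cases R)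
        case (Aff b)
        have "fibre_form d ?K D R = smult (poly D b) ((monom 1 p - [:b ^ p:]) * D)"
          using Aff by (simp add: fibre_form_def poly_monom algebra_simps smult_diff_right)
        then show ?thesis using Aff by (simp add: linear_power_CHAR[OF p, symmetric] dvd_smult)
      qed (use that Infty in simp)
    qed
  next
    case (Aff a)
    then have ord: "order a D > p" using Q by simp
    then have "[:-a, 1:] ^ p dvd D" using D by (simp add: order_divides)
    then obtain K where K: "D = [:-a, 1:] ^ p * K" by (elim dvdE)
    then have K0: "K \<noteq> 0" using D by auto
    have dD: "degree D = p + degree K" using K0 by (simp add: K degree_mult_eq degree_power_eq)
    have Ka: "poly K a = 0"
    proof -
      have "order a D = p + order a K" using D by (simp add: K order_mult order_power_n_n)
      then show ?thesis using ord K0 by (simp add: order_root)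
    qed
    show ?thesis
    proof (rule that[of K])
      show "degree K < d" using dD D p0 by simp
      show "poly K b = 0" if "poly D b = 0" for b
        using that Ka p0 by (auto simp: K poly_power)
      show "wronskian K D = 0"
        by (simp add: K linear_power_CHAR[OF p] wronskian_def pderiv_mult pderiv_diff pderiv_pCons dp)
      show "K \<noteq> smult l D" for l
      proof
        assume "K = smult l D"
        then have "degree K = degree D" using K0 by (auto split: if_splits)
        then show False using dD p0 by simp
      qed
      have Da: "poly D a = 0" using p0 by (simp add: K poly_power)
      then show "fibre_form d K D Q = 0" using Aff Ka by (simp add: fibre_form_def)
      show "vanishes_to d R p (fibre_form d K D R)" if "R \<noteq> Q" for R
      proof (cases R)
        case (Aff b)
        have "fibre_form d K D R = smult (poly K b) (smult (poly ([:-a, 1:] ^ p) b) K - [:-a, 1:] ^ p * K)"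
          using Aff by (simp add: fibre_form_def K smult_diff_right mult.commute)
        also have "\<dots> = smult (poly K b) (- (monom 1 p - [:b ^ p:]) * K)"
          unfolding linear_power_CHAR[OF p] by (simp add: poly_monom algebra_simps smult_diff_left)
        finally show ?thesis using Aff by (simp add: linear_power_CHAR[OF p, symmetric] dvd_smult)
      next
        case Infty
        have "degree K + p \<le> d" using dD D by simp
        then have "coeff K d = 0" using p0 by (intro coeff_eq_0) simp
        then have "fibre_form d K D R = smult (coeff D d) K" using Infty by (simp add: fibre_form_def)
        then show ?thesis using Infty \<open>degree K + p \<le> d\<close> by simp
      qed
    qed
  qed
qed

text \<open>
  Clearing denominators in \<open>\<alpha>(\<beta>(t)) = t\<close> shows that the denominator of \<open>\<beta>\<close> divides \<open>a_r - t b_r\<close> and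
  its numerator divides \<open>a_0 - t b_0\<close>, where \<open>\<alpha>\<close> is the quotient of \<open>\<Sum> a_i t ^ i\<close> and \<open>\<Sum> b_i t ^ i\<close>.
\<close>

lemma degree_right_inverse_le_1:
  fixes \<alpha> \<beta> :: "'k::alg_closed_field ratfun"
  assumes "rf_comp \<alpha> \<beta> = t_rf"
  shows "degree (numer \<beta>) \<le> 1" "degree (denom \<beta>) \<le> 1"
proof -
  let ?A = "numer \<alpha>" and ?B = "denom \<alpha>" and ?N = "numer \<beta>" and ?D = "denom \<beta>"
  define r where "r = max (degree ?A) (degree ?B)"
  define H where "H A = (\<Sum>i\<le>r. smult (coeff A i) (?N ^ i * ?D ^ (r - i)))" for A
  have ev: "rf_eval A \<beta> * to_fract ?D ^ r = to_fract (H A)" if "degree A \<le> r" for A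
  proof -
    have "rf_eval A \<beta> = (\<Sum>i\<le>r. const_rf (coeff A i) * \<beta> ^ i)"
      using that poly_as_sum_of_monoms'[OF that] by (metis (no_types, lifting) rf_eval_monom rf_eval_sum sum.cong)
    then have "rf_eval A \<beta> * to_fract ?D ^ r = (\<Sum>i\<le>r. const_rf (coeff A i) * (\<beta> ^ i * to_fract ?D ^ r))"
      by (simp add: sum_distrib_right mult.assoc)
    also have "\<dots> = (\<Sum>i\<le>r. to_fract (smult (coeff A i) (?N ^ i * ?D ^ (r - i))))"
    proof (intro sum.cong refl)
      fix i assume "i \<in> {..r}"
      then have "const_rf (coeff A i) * (\<beta> ^ i * to_fract ?D ^ r) =
          to_fract ([:coeff A i:] * (?N ^ i * ?D ^ (r - i)))"
        unfolding const_rf_def by (simp only: to_fract_mult power_mult_denom_power atMost_iff)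
      then show "const_rf (coeff A i) * (\<beta> ^ i * to_fract ?D ^ r) =
          to_fract (smult (coeff A i) (?N ^ i * ?D ^ (r - i)))" by simp
    qed
    also have "\<dots> = to_fract (H A)" by (simp only: to_fract_sum H_def)
    finally show ?thesis .
  qed
  have comp: "rf_eval ?A \<beta> / rf_eval ?B \<beta> = t_rf"
    using assms unfolding rf_comp_def rf_eval_def .
  have t0: "t_rf \<noteq> (0 :: 'k ratfun)" by (simp add: t_rf_def)
  have "rf_eval ?B \<beta> \<noteq> 0" using comp t0 by auto
  then have "rf_eval ?A \<beta> = t_rf * rf_eval ?B \<beta>" using comp by (simp add: field_simps)
  then have "rf_eval ?A \<beta> * to_fract ?D ^ r = t_rf * (rf_eval ?B \<beta> * to_fract ?D ^ r)" by simp
  then have "to_fract (H ?A) = to_fract ([:0, 1:] * H ?B)"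
    using ev[of ?A] ev[of ?B] by (simp only: to_fract_mult t_rf_def) (simp add: r_def)
  then have HAB: "H ?A = [:0, 1:] * H ?B" by (simp only: to_fract_eq_iff)
  have top: "?D dvd H A - smult (coeff A r) (?N ^ r)" for A
  proof -
    have "H A = smult (coeff A r) (?N ^ r) + (\<Sum>i<r. smult (coeff A i) (?N ^ i * ?D ^ (r - i)))"
      unfolding H_def lessThan_Suc_atMost[symmetric] by simp
    moreover have "?D dvd (\<Sum>i<r. smult (coeff A i) (?N ^ i * ?D ^ (r - i)))"
      by (intro dvd_sum dvd_smult dvd_mult dvd_power) simp
    ultimately show ?thesis by simp
  qed
  have bot: "?N dvd H A - smult (coeff A 0) (?D ^ r)" for A
  proof -
    have "H A = smult (coeff A 0) (?D ^ r) + (\<Sum>i\<in>{..r} - {0}. smult (coeff A i) (?N ^ i * ?D ^ (r - i)))"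
      unfolding H_def by (subst sum.remove[of _ 0]) simp_all
    moreover have "?N dvd (\<Sum>i\<in>{..r} - {0}. smult (coeff A i) (?N ^ i * ?D ^ (r - i)))"
      by (intro dvd_sum dvd_smult dvd_mult2 dvd_power) auto
    ultimately show ?thesis by simp
  qed
  have key: "degree E \<le> 1"
    if cop: "coprime E F" and dv: "\<And>A. E dvd H A - smult (coeff A m) (F ^ r)"
      and nz: "coeff ?A m \<noteq> 0 \<or> coeff ?B m \<noteq> 0" for E F m
  proof -
    let ?L = "[:coeff ?A m, - coeff ?B m:]"
    have "E dvd [:0, 1:] * (H ?B - smult (coeff ?B m) (F ^ r)) - (H ?A - smult (coeff ?A m) (F ^ r))"
      by (intro dvd_diff dvd_mult dv)
    also have "\<dots> = F ^ r * ?L" by (simp add: HAB algebra_simps)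
    finally have "E dvd F ^ r * ?L" .
    have "E dvd F ^ n * C \<Longrightarrow> E dvd C" for n C
    proof (induction n)
      case (Suc n)
      then have "E dvd F * (F ^ n * C)" by (simp only: power_Suc mult.assoc)
      then have "E dvd F ^ n * C" by (rule poly_coprime_dvd_mult[OF cop])
      then show ?case by (rule Suc.IH)
    qed simp
    then have "E dvd ?L" using \<open>E dvd F ^ r * ?L\<close> .
    moreover have "?L \<noteq> 0" using nz by auto
    ultimately have "degree E \<le> degree ?L" by (rule dvd_imp_degree_le)
    also have "\<dots> \<le> 1" by simp
    finally show ?thesis .
  qed
  have "coeff ?A r \<noteq> 0 \<or> coeff ?B r \<noteq> 0"
  proof (cases "degree ?B \<le> degree ?A \<and> ?A \<noteq> 0")
    case False
    then have "r = degree ?B" by (auto simp: r_def)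
    then show ?thesis using numer_denom(1)[of \<alpha>] by simp
  qed (simp add: r_def)
  moreover have "coprime ?D ?N" using numer_denom(2)[of \<beta>] by (subst coprime_commute)
  ultimately show "degree ?D \<le> 1" using top by (intro key)
  have "coeff ?A 0 \<noteq> 0 \<or> coeff ?B 0 \<noteq> 0"
    using coprime_not_both_root[OF numer_denom(2)[of \<alpha>], of 0] by (simp add: poly_0_coeff_0)
  then show "degree ?N \<le> 1" using numer_denom(2)[of \<beta>] bot by (intro key)
qed

lemma proj_aut_t: "proj_aut (t_rf :: 'k::field ratfun)" and rf_comp_t: "rf_comp t_rf f = f"
proof -
  show t: "rf_comp t_rf f = f" for f :: "'b::field ratfun"
    unfolding t_rf_def by (simp add: rf_comp_to_fract)
  show "proj_aut (t_rf :: 'k ratfun)" unfolding proj_aut_def by (intro exI[of _ t_rf]) (simp add: t)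
qed

lemma infinitely_many_ramified_maps:
  fixes P :: "nat \<Rightarrow> 'k::alg_closed_field proj_line"
  assumes p: "CHAR('k) = p" "prime p" and n: "n \<ge> 1" and d: "d > 0"
    and e: "e 1 > p" "\<forall>i\<in>{2..n}. e i < p" and inj: "inj_on P {1..n}"
    and ne: "ramified_maps n d e P \<noteq> {}"
  shows "infinite (ramified_maps n d e P // mod_image_aut (ramified_maps n d e P))"
proof -
  define S where "S = ramified_maps n d e P"
  obtain f where "f \<in> S" using ne by (auto simp: S_def)
  then obtain N D where ND: "reduced_pair d N D" "hval d (P 1) D = 0" "Fract N D \<in> S"
    unfolding S_def using ramified_map_with_pole[OF p d] by metis
  then have W: "wronskian N D \<noteq> 0"
    and v: "\<And>i. i \<in> {1..n} \<Longrightarrow> vord d (P i) (fibre_form d N D (P i)) = e i"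
    using ramified_maps_Fract_iff[OF p ND(1)] by (auto simp: S_def)
  have N1: "hval d (P 1) N \<noteq> 0" using reduced_pair_hval[OF ND(1), of "P 1"] ND(2) by simp
  have "vord d (P 1) D = e 1"
    using v[of 1] n N1 ND(2) by (simp add: fibre_form_def)
  moreover have deg: "degree N \<le> d" "degree D \<le> d" "N \<noteq> 0" "D \<noteq> 0"
    using ND(1) reduced_pair_nonzero[OF ND(1)] by (auto simp: reduced_pair_def)
  ultimately obtain K where K: "degree K < d" "\<And>b. poly D b = 0 \<Longrightarrow> poly K b = 0" "wronskian K D = 0"
    "\<And>l. K \<noteq> smult l D" "\<And>R. R \<noteq> P 1 \<Longrightarrow> vanishes_to d R p (fibre_form d K D R)"
    "fibre_form d K D (P 1) = 0"
    using pth_power_with_pole[OF p, of D d "P 1"] e(1) by metis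
  define M where "M c = N + smult c K" for c
  have red: "reduced_pair d (M c) D" for c
  proof -
    have "coprime D (M c)"
    proof (rule coprime_no_root)
      fix x assume "poly D x = 0"
      then show "poly (M c) x \<noteq> 0"
        using K(2)[of x] coprime_not_both_root[of N D x] ND(1) by (auto simp: M_def reduced_pair_def)
    qed (use deg in simp)
    moreover have "d = max (degree (M c)) (degree D)"
    proof -
      have cK: "degree (smult c K) < d" using K(1) degree_smult_le[of c K] by simp
      show ?thesis
      proof (cases "degree N = d")
        case True
        then have "degree (M c) = d" unfolding M_def using cK by (subst degree_add_eq_left) auto
        then show ?thesis using deg by simp
      next
        case False
        then have "degree (M c) < d" unfolding M_def using cK deg by (intro degree_add_less) auto
        then show ?thesis using ND(1) False by (auto simp: reduced_pair_def)
      qed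
    qed
    ultimately show ?thesis using d by (simp add: reduced_pair_def coprime_commute)
  qed
  have cop: "coprime D (M c)" for c
    using red[of c] by (subst coprime_commute) (simp add: reduced_pair_def)
  have WM: "wronskian (M c) D = wronskian N D" for c
  proof -
    have "wronskian (M c) D = wronskian N D + smult c (wronskian K D)"
      by (simp add: M_def wronskian_def pderiv_add pderiv_smult algebra_simps smult_diff_right)
    then show ?thesis using K(3) by simp
  qed
  have ff: "fibre_form d (M c) D R = fibre_form d N D R + smult c (fibre_form d K D R)" for c R
    by (simp add: fibre_form_def M_def algebra_simps smult_add_left smult_add_right smult_diff_right)
  have inS: "Fract (M c) D \<in> S" for c
    unfolding S_def ramified_maps_Fract_iff[OF p red] WM
  proof (intro conjI ballI W)
    fix i assume i: "i \<in> {1..n}"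
    show "vord d (P i) (fibre_form d (M c) D (P i)) = e i"
    proof (cases "i = 1")
      case True
      then show ?thesis using K(6) v[OF i] by (simp add: ff)
    next
      case False
      then have "P i \<noteq> P 1" using inj_onD[OF inj, of i 1] i n by auto
      then have "vanishes_to d (P i) p (fibre_form d K D (P i))" by (rule K(5))
      then have "vanishes_to d (P i) p (smult c (fibre_form d K D (P i)))"
        by (cases "P i") (auto intro: dvd_smult)
      moreover have "vord d (P i) (fibre_form d N D (P i)) < p"
        using v[OF i] e(2) i False by simp
      ultimately show ?thesis
        unfolding ff using v[OF i]
        by (subst vord_add_vanishes_to[OF fibre_form_nonzero[OF ND(1)] degree_fibre_form_le[OF ND(1)]])
    qed
  qed
  have distinct: "c = c'" if rel: "(Fract (M c) D, Fract (M c') D) \<in> mod_image_aut S" for c c'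
  proof (rule ccontr)
    assume cc: "c \<noteq> c'"
    let ?f = "Fract (M c) D"
    obtain \<alpha> \<beta> where \<alpha>: "Fract (M c') D = rf_comp \<alpha> ?f" "rf_comp \<beta> \<alpha> = t_rf"
      using rel by (auto simp: mod_image_aut_def proj_aut_def)
    have nc: "?f \<noteq> const_rf a" for a
    proof
      assume "?f = const_rf a"
      then have "rf_deriv ?f = 0" by simp
      then show False using W deg by (simp add: rf_deriv_eq_0_iff WM)
    qed
    have form: "\<exists>a b. A = [:a, b:]" if "degree A \<le> 1" for A :: "'k poly"
      using that by (intro exI[of _ "coeff A 0"] exI[of _ "coeff A 1"] poly_eqI)
        (auto simp: coeff_pCons coeff_eq_0 split: nat.split)
    \<comment> \<open>\<open>\<alpha>\<close> has the left inverse \<open>\<beta>\<close>, so it is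
      a quotient of polynomials of degree at most 1.\<close>
    obtain a0 a1 where A: "numer \<alpha> = [:a0, a1:]" using form degree_right_inverse_le_1[OF \<alpha>(2)] by blast
    obtain b0 b1 where B: "denom \<alpha> = [:b0, b1:]" using form degree_right_inverse_le_1[OF \<alpha>(2)] by blast
    have lin: "rf_eval [:a, b:] ?f = Fract (smult a D + smult b (M c)) D" for a b
      using deg by (simp add: const_rf_def to_fract_def eq_fract algebra_simps)
    have B0: "rf_eval [:b0, b1:] ?f \<noteq> 0"
      using rf_eval_eq_0_iff[OF nc] numer_denom(1)[of \<alpha>] unfolding B by blast
    have "Fract (M c') D = rf_eval [:a0, a1:] ?f / rf_eval [:b0, b1:] ?f"
      unfolding \<alpha>(1) rf_comp_def rf_eval_def A B ..
    then have "Fract (M c') D * rf_eval [:b0, b1:] ?f = rf_eval [:a0, a1:] ?f"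
      unfolding nonzero_eq_divide_eq[OF B0] .
    then have "(M c' * (smult b0 D + smult b1 (M c))) * D = (smult a0 D + smult a1 (M c)) * D * D"
      unfolding lin using deg by (simp add: eq_fract mult_ac)
    then have eq: "M c' * (smult b0 D + smult b1 (M c)) = (smult a0 D + smult a1 (M c)) * D"
      using deg(4) by (metis mult_right_cancel)
    \<comment> \<open>Both maps have the same poles, so \<open>\<alpha>\<close> must fix
      infinity.\<close>
    have b1: "b1 = 0"
    proof (rule ccontr)
      assume b1: "b1 \<noteq> 0"
      have "M c' * smult b1 (M c) = (smult a0 D + smult a1 (M c)) * D - M c' * smult b0 D"
        using eq by (simp add: algebra_simps)
      also have "D dvd \<dots>" by (intro dvd_diff dvd_mult dvd_smult) simp_all
      finally have "D dvd M c' * smult b1 (M c)" .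
      then have "D dvd smult b1 (M c)"
        by (rule poly_coprime_dvd_mult[OF cop])
      then have "D dvd M c" using b1 by (simp add: dvd_smult_iff)
      then have "is_unit D" using cop[of c] by (meson coprime_common_divisor dvd_refl)
      \<comment> \<open>The only pole is now at infinity, where degrees take the place of
        divisibility.\<close>
      then have D0: "degree D = 0" by (auto simp: is_unit_poly_iff)
      then have dM: "degree (M x) = d" for x using red[of x] by (simp add: reduced_pair_def)
      have "degree (smult b0 D + smult b1 (M c)) = d"
        using b1 dM D0 d degree_smult_le[of b0 D] by (subst degree_add_eq_right) auto
      then have "degree (M c' * (smult b0 D + smult b1 (M c))) = d + d"
        using dM[of c'] d by (subst degree_mult_eq) auto
      moreover have "degree ((smult a0 D + smult a1 (M c)) * D) \<le> d + 0"
        using D0 dM by (intro order_trans[OF degree_mult_le] add_mono degree_add_le)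
          (auto intro: order_trans[OF degree_smult_le])
      ultimately show False using eq d by simp
    qed
    then have b0: "b0 \<noteq> 0" using B0 by auto
    have "smult b0 (M c') * D = (smult a0 D + smult a1 (M c)) * D" using eq b1 by simp
    then have eq2: "smult b0 (M c') = smult a0 D + smult a1 (M c)" using deg(4) by (metis mult_right_cancel)
    \<comment> \<open>Both maps have the same derivative, so the affine map \<open>\<alpha>\<close>
      has slope 1. It is then a translation, which would make \<open>K / D\<close> constant.\<close>
    have "wronskian (smult b0 (M c')) D = wronskian (smult a0 D + smult a1 (M c)) D" by (simp only: eq2)
    moreover have "wronskian (smult b0 (M c')) D = smult b0 (wronskian N D)"
      unfolding WM[of c', symmetric] by (simp add: wronskian_def pderiv_smult smult_diff_right)
    moreover have "wronskian (smult a0 D + smult a1 (M c)) D = smult a1 (wronskian N D)"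
      unfolding WM[of c, symmetric]
      by (simp add: wronskian_def pderiv_add pderiv_smult smult_diff_right algebra_simps)
    ultimately have "smult (a1 - b0) (wronskian N D) = 0" by (simp add: smult_diff_left)
    then have "a1 = b0" using W by simp
    then have "smult (b0 * (c' - c)) K = smult a0 D"
      using eq2 by (simp add: M_def smult_add_right algebra_simps smult_diff_left)
    then have "smult (1 / (b0 * (c' - c))) (smult (b0 * (c' - c)) K) = smult (1 / (b0 * (c' - c))) (smult a0 D)"
      by simp
    then have "K = smult (1 / (b0 * (c' - c)) * a0) D" using b0 cc by simp
    then show False using K(4) by blast
  qed
  have refl: "(f, f) \<in> mod_image_aut S" if "f \<in> S" for f
    using that proj_aut_t rf_comp_t[of f] by (auto simp: mod_image_aut_def intro!: exI[of _ t_rf])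
  let ?cl = "\<lambda>c. mod_image_aut S `` {Fract (M c) D}"
  have "inj ?cl"
  proof (rule injI)
    fix c c' assume "?cl c = ?cl c'"
    then have "Fract (M c') D \<in> ?cl c" using refl[OF inS[of c']] by blast
    then show "c = c'" using distinct by blast
  qed
  then have "infinite (range ?cl)" using infinite_UNIV_alg_closed finite_imageD by blast
  moreover have "range ?cl \<subseteq> S // mod_image_aut S" using inS by (auto intro: quotientI)
  ultimately have "infinite (S // mod_image_aut S)" using finite_subset by blast
  then show ?thesis by (simp add: S_def)
qed

section \<open>Polynomials with vanishing Cartier image\<close>

text \<open>The Cartier operator annihilates the differential \<open>h dt\<close>, equivalently \<open>h dt\<close> is exact.\<close>

definition cartier_zero :: "nat \<Rightarrow> 'k::zero poly \<Rightarrow> bool" where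
  "cartier_zero p h \<longleftrightarrow> (\<forall>j. coeff h (p * j + p - 1) = 0)"

lemma cartier_zero_pderiv:
  fixes B :: "'k::field poly"
  assumes "CHAR('k) = p" "p > 0"
  shows "cartier_zero p (pderiv B)"
  unfolding cartier_zero_def
proof
  fix j
  have "Suc (p * j + p - 1) = p * (j + 1)" using assms by simp
  then have "(of_nat (Suc (p * j + p - 1)) :: 'k) = 0"
    using assms(1) by (simp only: of_nat_eq_0_iff_char_dvd) simp
  then show "coeff (pderiv B) (p * j + p - 1) = 0"
    by (simp only: coeff_pderiv mult_zero_left)
qed

lemma antiderivative_exists:
  fixes h :: "'k::field poly"
  assumes p: "CHAR('k) = p" "p > 0" and h: "cartier_zero p h"
  shows "\<exists>B. pderiv B = h \<and> degree B \<le> Suc (degree h)"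
proof -
  \<comment> \<open>Where \<open>Suc i\<close> is zero in the field, the quotient is 0 by
    convention. This is harmless because \<open>h\<close> has coefficient zero at these
    exponents.\<close>
  define B where "B = (\<Sum>i\<le>degree h. monom (coeff h i / of_nat (Suc i)) (Suc i))"
  have "coeff (pderiv B) n = coeff h n" for n
  proof -
    have "coeff B (Suc n) = (\<Sum>i\<le>degree h. if i = n then coeff h n / of_nat (Suc n) else 0)"
      unfolding B_def coeff_sum by (intro sum.cong refl) (auto simp del: of_nat_Suc)
    also have "\<dots> = coeff h n / of_nat (Suc n)"
      by (simp add: coeff_eq_0 del: of_nat_Suc)
    finally have *: "coeff B (Suc n) = coeff h n / of_nat (Suc n)" .
    show ?thesis
    proof (cases "(of_nat (Suc n) :: 'k) = 0")
      case True
      then have "p dvd Suc n" using p(1) by (simp only: of_nat_eq_0_iff_char_dvd)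
      then obtain j where j: "Suc n = p * j" by (auto elim!: dvdE)
      then obtain i where "j = Suc i" by (cases j) auto
      with j p have "n = p * i + p - 1" by simp
      then have "coeff h n = 0" using h by (simp add: cartier_zero_def)
      then show ?thesis using True by (simp add: coeff_pderiv del: of_nat_Suc)
    next
      case False
      then show ?thesis by (simp add: coeff_pderiv * del: of_nat_Suc)
    qed
  qed
  then have "pderiv B = h" by (intro poly_eqI)
  moreover have "degree B \<le> Suc (degree h)"
    unfolding B_def by (intro degree_sum_le order_trans[OF degree_monom_le]) auto
  ultimately show ?thesis by blast
qed

text \<open>In the product rule for \<open>(t - s) ^ r * V\<close> the term that differentiates the
  power has order exactly \<open>r - 1\<close>, because \<open>r\<close> is nonzero in the
  field.\<close>

lemma order_power_not_dvd_pderiv: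
  fixes Z :: "'k::field poly"
  assumes "Z \<noteq> 0" "(of_nat (order s Z) :: 'k) \<noteq> 0"
  shows "\<not> [:-s, 1:] ^ order s Z dvd pderiv Z"
proof
  let ?r = "order s Z" and ?X = "[:-s, 1:]"
  assume dvd: "?X ^ ?r dvd pderiv Z"
  obtain V where V: "Z = ?X ^ ?r * V" "\<not> ?X dvd V"
    using order_decomp[OF assms(1)] by blast
  obtain r' where r': "?r = Suc r'" using assms(2) by (cases ?r) auto
  have "pderiv Z = ?X ^ ?r * pderiv V + smult (of_nat ?r) (?X ^ r' * V)"
    by (subst V(1)) (simp add: r' pderiv_mult pderiv_power pderiv_pCons pCons_one mult.commute del: power_Suc mult_pCons_left mult_pCons_right of_nat_Suc)
  with dvd have "?X ^ ?r dvd smult (of_nat ?r) (?X ^ r' * V)"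
    by (metis dvd_add_right_iff dvd_triv_left)
  then have "?X ^ Suc r' dvd ?X ^ r' * V" using assms(2) r' by (metis dvd_smult_cancel)
  then have "?X ^ r' * ?X dvd ?X ^ r' * V" by (simp only: power_Suc2)
  then have "?X dvd V" by (subst (asm) dvd_times_left_cancel_iff) auto
  with V(2) show False ..
qed

text \<open>
  Newton interpolation by polynomials in \<open>t ^ p\<close>: at each point in turn the lowest coefficient
  of the remainder is removed; the first surviving exponent prime to \<open>p\<close> is visible in the derivative.
\<close>

lemma interpolation_pth_powers:
  fixes B :: "'k::field poly"
  assumes p: "CHAR('k) = p" "p > 0"
  shows "\<exists>R. pderiv R = 0 \<and> degree R \<le> p * (size M - 1) \<and>
     (\<forall>s. [:-s, 1:] ^ min (p * count M s) (order s (pderiv B) + 1) dvd B + R)"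
proof (induction M)
  case empty
  then show ?case by (intro exI[of _ 0]) simp
next
  case (add x M)
  then obtain R' where R': "pderiv R' = 0" "degree R' \<le> p * (size M - 1)"
    and d: "\<And>s. [:-s, 1:] ^ min (p * count M s) (order s (pderiv B) + 1) dvd B + R'"
    by blast
  \<comment> \<open>The next Newton basis polynomial: constant for the derivation, with a zero of
    order \<open>p * count M s\<close> at each earlier point.\<close>
  define T where "T = (\<Prod>s\<in>#M. [:-s, 1:] ^ p)"
  have T': "pderiv T = 0"
    unfolding T_def
  proof (induction M)
    case (add x M)
    have "pderiv ([:-x, 1:] ^ p) = 0"
      using p(1) by (simp add: pderiv_power of_nat_eq_0_iff_char_dvd)
    with add show ?case by (simp add: pderiv_mult)
  qed simp
  have T0: "T \<noteq> 0" unfolding T_def by (induction M) auto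
  have degT: "degree T = p * size M"
    unfolding T_def
  proof (induction M)
    case (add x M)
    have "(\<Prod>s\<in>#M. [:-s, 1:] ^ p) \<noteq> 0" by (induction M) auto
    then show ?case using add by (simp add: degree_mult_eq degree_power_eq)
  qed simp
  have ordT: "order s T = p * count M s" for s
    unfolding T_def
  proof (induction M)
    case (add x M)
    have nz: "(\<Prod>s\<in>#M. [:-s, 1:] ^ p) \<noteq> 0" by (induction M) auto
    have "order s ([:-x, 1:] ^ p) = (if x = s then p else 0)"
      by (cases "x = s") (auto simp: order_power_n_n order_0I)
    then show ?case using add nz by (simp add: order_mult del: mult_pCons_left)
  qed (simp add: order_0I)
  let ?c = "p * count M x" and ?o = "order x (pderiv B)"
  have "\<exists>l. [:-x, 1:] ^ min (?c + p) (?o + 1) dvd B + R' - smult l T"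
  proof (cases "?o + 1 \<le> ?c")
    case True
    then show ?thesis using d[of x] by (intro exI[of _ 0]) (simp add: min_def split: if_splits)
  next
    case False
    then have "[:-x, 1:] ^ ?c dvd B + R'" using d[of x] by (simp add: min_def)
    then obtain Y where Y: "B + R' = [:-x, 1:] ^ ?c * Y" by (elim dvdE)
    obtain T2 where T2: "T = [:-x, 1:] ^ ?c * T2" "\<not> [:-x, 1:] dvd T2"
      using order_decomp[OF T0, of x] ordT by auto
    define l where "l = poly Y x / poly T2 x"
    let ?Z = "B + R' - smult l T"
    have "poly (Y - smult l T2) x = 0"
      using T2(2) unfolding l_def poly_eq_0_iff_dvd[symmetric] by simp
    then have "[:-x, 1:] dvd Y - smult l T2" using poly_eq_0_iff_dvd by blast
    then have "[:-x, 1:] ^ ?c * [:-x, 1:] dvd [:-x, 1:] ^ ?c * (Y - smult l T2)" by (rule mult_dvd_mono[OF dvd_refl])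
    also have "[:-x, 1:] ^ ?c * (Y - smult l T2) = ?Z"
      by (subst T2(1)) (simp only: Y right_diff_distrib mult_smult_right)
    finally have Zd: "[:-x, 1:] ^ Suc ?c dvd ?Z" by (simp add: mult.commute)
    have Z': "pderiv ?Z = pderiv B" using R' T' by (simp add: pderiv_add pderiv_diff pderiv_smult)
    have "[:-x, 1:] ^ min (?c + p) (?o + 1) dvd ?Z"
    proof (cases "?Z = 0")
      case False
      let ?r = "order x ?Z"
      have r: "Suc ?c \<le> ?r" using Zd False by (simp add: order_divides del: power_Suc)
      have "min (?c + p) (?o + 1) \<le> ?r"
      proof (cases "?c + p \<le> ?r")
        case f: False
        \<comment> \<open>The order lies strictly between two consecutive multiples of
          \<open>p\<close>.\<close>
        have "\<not> p dvd ?r"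
        proof
          assume "p dvd ?r"
          then obtain q where q: "?r = p * q" by (auto elim: dvdE)
          have "p * count M x < p * q" "p * q < p * count M x + p" using r f q by linarith+
          then have "p * q < p * (count M x + 1)" by simp
          then have "q \<le> count M x" unfolding mult_less_cancel1 by simp
          then have "p * q \<le> p * count M x" by simp
          with \<open>p * count M x < p * q\<close> show False by simp
        qed
        then have "(of_nat ?r :: 'k) \<noteq> 0" using p by (simp add: of_nat_eq_0_iff_char_dvd)
        then have n: "\<not> [:-x, 1:] ^ ?r dvd pderiv B"
          using order_power_not_dvd_pderiv[OF False] Z' by metis
        have "?o < ?r"
        proof (rule ccontr)
          assume "\<not> ?o < ?r"
          then have "[:-x, 1:] ^ ?r dvd [:-x, 1:] ^ ?o" by (intro le_imp_power_dvd) simp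
          with n show False using order_1 dvd_trans by blast
        qed
        then show ?thesis by simp
      qed simp
      then show ?thesis by (meson order_divides)
    qed simp
    then show ?thesis by blast
  qed
  then obtain l where l: "[:-x, 1:] ^ min (?c + p) (?o + 1) dvd B + R' - smult l T" by blast
  show ?case
  proof (intro exI[of _ "R' - smult l T"] conjI allI)
    show "pderiv (R' - smult l T) = 0" using R' T' by (simp add: pderiv_diff pderiv_smult)
    have "degree R' \<le> p * size M" using R'(2) by (meson diff_le_self le_trans mult_le_mono2)
    then show "degree (R' - smult l T) \<le> p * (size (add_mset x M) - 1)"
      using degT by (intro degree_diff_le) (auto intro: order_trans[OF degree_smult_le])
    fix s
    show "[:-s, 1:] ^ min (p * count (add_mset x M) s) (order s (pderiv B) + 1) dvd B + (R' - smult l T)"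
    proof (cases "s = x")
      case True
      then show ?thesis using l by (simp add: algebra_simps)
    next
      case False
      let ?m = "min (p * count M s) (order s (pderiv B) + 1)"
      have "[:-s, 1:] ^ ?m dvd [:-s, 1:] ^ (p * count M s)" by (intro le_imp_power_dvd) simp
      then have "[:-s, 1:] ^ ?m dvd T" using ordT order_1 by (metis dvd_trans)
      then have "[:-s, 1:] ^ ?m dvd (B + R') - smult l T" using d[of s] by (intro dvd_diff dvd_smult)
      then show ?thesis using False by (simp add: algebra_simps)
    qed
  qed
qed

text \<open>The hypotheses \<open>A\<close> and \<open>a\<close> allow an antiderivative of the
  product to be corrected so that it vanishes at 0, at 1 and at the roots of \<open>E\<close> to one
  order more than the product. The hypothesis \<open>big\<close> keeps the correction within one
  more than the degree of the product, while at least two distinct zeros force two more.\<close>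

lemma three_point_obstruction:
  fixes E :: "'k::alg_closed_field poly"
  assumes p: "CHAR('k) = p" "2 \<le> p" and E: "E \<noteq> 0" and a: "a < p"
    and A: "A + 1 \<le> 2 * order 0 E + p" and big: "2 * degree E + p < A + a + 1"
  shows "\<not> cartier_zero p (monom 1 A * [:1, -1:] ^ a * E ^ (p - 2))"
proof
  define h where "h = monom 1 A * [:1, -1:] ^ a * E ^ (p - 2)"
  assume "cartier_zero p (monom 1 A * [:1, -1:] ^ a * E ^ (p - 2))"
  then obtain B where B: "pderiv B = h" "degree B \<le> Suc (degree h)"
    using antiderivative_exists[of p h] p by (auto simp: h_def)
  obtain q where q: "p = q + 2" using p(2) by (metis add.commute le_Suc_ex)
  obtain M0 where M0: "size M0 = degree E" "E = smult (lead_coeff E) (\<Prod>x\<in>#M0. [:-x, 1:])"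
    using alg_closed_imp_factorization[OF E] by blast
  have countM0: "count M0 s = order s E" for s
  proof -
    have nz: "(\<Prod>x\<in>#N. [:-x, 1:]) \<noteq> 0" for N :: "'k multiset"
      by (auto simp: prod_mset_zero_iff)
    have "order s (\<Prod>x\<in>#N. [:-x, 1:]) = count N s" for N :: "'k multiset"
    proof (induction N)
      case (add x N)
      have "order s [:-x, 1:] = (if x = s then 1 else 0)"
        using order_power_n_n[of s 1] by (auto intro: order_0I)
      then show ?case using add nz[of "add_mset x N"]
        by (simp add: order_mult del: mult_pCons_left)
    qed (simp add: order_0I)
    then show ?thesis using M0(2) E by (metis order_smult leading_coeff_0_iff)
  qed
  \<comment> \<open>0 and 1 occur once more than in \<open>E\<close>. This makes them interpolation
    points in any case and absorbs the factors \<open>t ^ A\<close> and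
    \<open>(1 - t) ^ a\<close>.\<close>
  define M where "M = add_mset 0 (add_mset 1 M0)"
  obtain R where R: "pderiv R = 0" "degree R \<le> p * (size M - 1)"
    "\<And>s. [:-s, 1:] ^ min (p * count M s) (order s (pderiv B) + 1) dvd B + R"
    using interpolation_pth_powers[of p M B] p by auto
  define Z where "Z = B + R"
  have h0: "h \<noteq> 0" using E by (simp add: h_def)
  have Z': "pderiv Z = h" using B R by (simp add: Z_def pderiv_add)
  then have Z0: "Z \<noteq> 0" using h0 by auto
  have degh: "degree h = A + a + q * degree E"
    using E by (simp add: h_def degree_mult_eq degree_power_eq degree_monom_eq q)
  have ordh: "order s h = (if s = 0 then A else 0) + (if s = 1 then a else 0) + q * order s E" for s
  proof -
    have "monom (1::'k) A = [:-0, 1:] ^ A" by (simp add: monom_altdef)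
    then have 1: "order s (monom (1::'k) A) = (if s = 0 then A else 0)"
      using order_power_n_n[of "0::'k" A] by (cases "s = 0") (simp_all add: order_0I)
    have "[:1, -1::'k:] ^ a = smult ((-1) ^ a) ([:-1, 1:] ^ a)"
      by (simp flip: smult_power)
    then have 2: "order s ([:1, -1::'k:] ^ a) = (if s = 1 then a else 0)"
      by (cases "s = 1") (simp_all add: order_power_n_n order_smult order_0I del: mult_pCons_left)
    have 3: "order s (E ^ n) = n * order s E" for n
      using E by (induction n) (auto simp: order_mult)
    show ?thesis using h0 unfolding h_def by (simp add: order_mult 1 2 3 q)
  qed
  have ordZ: "order s h + 1 \<le> order s Z" if "s \<in># M" for s
  proof -
    have "order s h + 1 \<le> p * count M s"
    proof (cases "s = 0 \<or> s = 1")
      case True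
      then show ?thesis using A a by (auto simp: ordh M_def countM0 q algebra_simps)
    next
      case False
      with that have "order s E > 0" using countM0[of s] by (simp add: M_def flip: count_greater_zero_iff)
      then show ?thesis using False by (simp add: ordh M_def countM0 q algebra_simps)
    qed
    then show ?thesis using R(3)[of s] Z0 B(1) by (simp add: Z_def order_divides min_def split: if_splits)
  qed
  have "degree Z \<le> Suc (degree h)"
  proof -
    have "p * (size M - 1) \<le> Suc (degree h)"
      using big by (simp add: M_def M0(1) degh q algebra_simps)
    then show ?thesis unfolding Z_def using B(2) R(2) by (intro degree_add_le) auto
  qed
  moreover have "degree h + 2 \<le> degree Z"
  proof -
    have sub: "{0, 1} \<subseteq> set_mset M" by (simp add: M_def)
    have "(\<Sum>s\<in>set_mset M. order s E) = degree E"
    proof -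
      have "(\<Sum>s\<in>set_mset M. order s E) = (\<Sum>s\<in>set_mset M0. order s E)"
      proof (intro sum.mono_neutral_right ballI)
        fix s assume "s \<in> set_mset M - set_mset M0"
        then have "count M0 s = 0" by (simp add: not_in_iff)
        then show "order s E = 0" by (simp add: countM0)
      qed (auto simp: M_def)
      then show ?thesis using M0(1) by (simp add: size_multiset_overloaded_eq countM0)
    qed
    moreover have "(\<Sum>s\<in>set_mset M. if s = 0 then A else 0) = A" "(\<Sum>s\<in>set_mset M. if s = 1 then a else 0) = a"
      using sub by simp_all
    ultimately have "degree h = (\<Sum>s\<in>set_mset M. order s h)"
      by (simp only: ordh sum.distrib degh flip: sum_distrib_left)
    moreover have "2 \<le> card (set_mset M)"
      using card_mono[OF _ sub] by simp
    ultimately have "degree h + 2 \<le> (\<Sum>s\<in>set_mset M. order s h + 1)"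
      unfolding sum.distrib by simp
    also have "\<dots> \<le> (\<Sum>s\<in>set_mset M. order s Z)" by (intro sum_mono ordZ)
    also have "\<dots> \<le> (\<Sum>s\<in>set_mset (proots Z). order s Z)"
    proof (intro sum_mono2)
      show "set_mset M \<subseteq> set_mset (proots Z)"
      proof
        fix s assume "s \<in># M"
        then have "order s Z \<noteq> 0" using ordZ[of s] by linarith
        then show "s \<in># proots Z" using Z0 by (simp add: order_root)
      qed
    qed simp_all
    also have "\<dots> = size (proots Z)"
      using Z0 by (simp add: size_multiset_overloaded_eq)
    also have "\<dots> \<le> degree Z" by (rule size_proots_le)
    finally show ?thesis .
  qed
  ultimately show False by simp
qed

section \<open>Elimination theory\<close>

text \<open>
  Rows \<open>i < n\<close> hold the coefficients of \<open>t ^ i * a(t)\<close> and rows \<open>n + i\<close> those of \<open>t ^ i * b(t)\<close>, where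
  both polynomials have formal degree \<open>n\<close>.
\<close>

definition syl_entry :: "nat \<Rightarrow> (nat \<Rightarrow> 'k::zero) \<Rightarrow> (nat \<Rightarrow> 'k) \<Rightarrow> nat \<Rightarrow> nat \<Rightarrow> 'k" where
  "syl_entry n a b i j =
     (let r = i mod n in if r \<le> j \<and> j \<le> r + n then (if i < n then a else b) (j - r) else 0)"

definition syl_mat :: "nat \<Rightarrow> (nat \<Rightarrow> 'k::zero) \<Rightarrow> (nat \<Rightarrow> 'k) \<Rightarrow> 'k mat" where
  "syl_mat n a b = mat (2 * n) (2 * n) (\<lambda>(i, j). syl_entry n a b i j)"

lemma sum_two_halves:
  fixes f :: "nat \<Rightarrow> 'a::comm_monoid_add"
  shows "(\<Sum>i<2*n. f i) = (\<Sum>i<n. f i) + (\<Sum>i<n. f (n + i))"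
proof -
  have "(\<Sum>i<2*n. f i) = (\<Sum>i\<in>{..<n} \<union> {n..<2*n}. f i)"
    by (intro sum.cong) auto
  also have "\<dots> = (\<Sum>i<n. f i) + (\<Sum>i\<in>{n..<2*n}. f i)"
    by (intro sum.union_disjoint) auto
  also have "(\<Sum>i\<in>{n..<2*n}. f i) = (\<Sum>i<n. f (n + i))"
    by (intro sum.reindex_bij_witness[of _ "\<lambda>i. n + i" "\<lambda>i. i - n"]) auto
  finally show ?thesis .
qed

lemma syl_mat_mult_powers:
  fixes a b :: "nat \<Rightarrow> 'k::comm_ring_1"
  assumes "i < 2 * n"
  shows "(\<Sum>j<2*n. syl_entry n a b i j * x ^ j) =
         x ^ (i mod n) * (\<Sum>j\<le>n. (if i < n then a else b) j * x ^ j)"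
proof -
  let ?r = "i mod n" and ?c = "if i < n then a else b"
  have n: "n > 0" using assms by (cases n) auto
  then have r: "?r + n < 2 * n" by simp
  have "(\<Sum>j<2*n. syl_entry n a b i j * x ^ j) = (\<Sum>j\<in>{?r..?r+n}. ?c (j - ?r) * x ^ j)"
    using r by (intro sum.mono_neutral_cong_right) (auto simp: syl_entry_def Let_def)
  also have "\<dots> = (\<Sum>j\<le>n. ?c j * x ^ (j + ?r))"
    by (intro sum.reindex_bij_witness[of _ "\<lambda>j. j + ?r" "\<lambda>j. j - ?r"]) auto
  finally show ?thesis by (simp add: power_add sum_distrib_left mult_ac)
qed

text \<open>The powers of a common root form a kernel vector. Conversely a left kernel vector is a
  relation \<open>r * P + s * Q = 0\<close> with \<open>s\<close> nonzero of degree below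
  \<open>n\<close>; as \<open>P\<close> has degree exactly \<open>n\<close>, it cannot divide
  \<open>s\<close>, so it shares a root with \<open>Q\<close>. The polynomial \<open>Q\<close> may
  have any degree up to \<open>n\<close> or be zero.\<close>

lemma det_syl_mat_zero_iff:
  fixes a b :: "nat \<Rightarrow> 'k::alg_closed_field"
  assumes "a n \<noteq> 0" "n > 0"
  shows "det (syl_mat n a b) = 0 \<longleftrightarrow>
     (\<exists>x. (\<Sum>j\<le>n. a j * x ^ j) = 0 \<and> (\<Sum>j\<le>n. b j * x ^ j) = 0)"
proof
  assume "\<exists>x. (\<Sum>j\<le>n. a j * x ^ j) = 0 \<and> (\<Sum>j\<le>n. b j * x ^ j) = 0"
  then obtain x where x: "(\<Sum>j\<le>n. a j * x ^ j) = 0" "(\<Sum>j\<le>n. b j * x ^ j) = 0" by blast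
  have S: "syl_mat n a b \<in> carrier_mat (2*n) (2*n)" by (simp add: syl_mat_def)
  let ?v = "vec (2*n) (\<lambda>j. x ^ j)"
  have "?v $ 0 = 1" using assms by simp
  then have "?v \<noteq> 0\<^sub>v (2*n)" using assms by (metis index_zero_vec(1) mult_pos_pos zero_less_numeral zero_neq_one)
  moreover have "syl_mat n a b *\<^sub>v ?v = 0\<^sub>v (2*n)"
  proof (rule eq_vecI)
    fix i assume "i < dim_vec (0\<^sub>v (2*n) :: 'k vec)"
    then have i: "i < 2*n" by simp
    have "(syl_mat n a b *\<^sub>v ?v) $ i = (\<Sum>j<2*n. syl_entry n a b i j * x ^ j)"
      using i by (simp add: syl_mat_def scalar_prod_def atLeast0LessThan)
    also have "\<dots> = 0" using x by (simp add: syl_mat_mult_powers[OF i])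
    finally show "(syl_mat n a b *\<^sub>v ?v) $ i = 0\<^sub>v (2*n) $ i" using i by simp
  qed (simp add: syl_mat_def)
  ultimately show "det (syl_mat n a b) = 0"
    using det_0_iff_vec_prod_zero_field[OF S] by (meson vec_carrier)
next
  assume det0: "det (syl_mat n a b) = 0"
  have S: "(syl_mat n a b)\<^sup>T \<in> carrier_mat (2*n) (2*n)" by (simp add: syl_mat_def)
  have "det ((syl_mat n a b)\<^sup>T) = 0"
    using det0 by (subst det_transpose[of _ "2*n"]) (auto simp: syl_mat_def)
  then obtain v where v: "v \<in> carrier_vec (2*n)" "v \<noteq> 0\<^sub>v (2*n)" "(syl_mat n a b)\<^sup>T *\<^sub>v v = 0\<^sub>v (2*n)"
    using det_0_iff_vec_prod_zero_field[OF S] by blast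
  have col: "(\<Sum>i<2*n. syl_entry n a b i j * v $ i) = 0" if "j < 2*n" for j
  proof -
    have "((syl_mat n a b)\<^sup>T *\<^sub>v v) $ j = (\<Sum>i<2*n. syl_entry n a b i j * v $ i)"
      using that v(1) by (auto simp: syl_mat_def scalar_prod_def atLeast0LessThan intro!: sum.cong)
    with v(3) that show ?thesis by simp
  qed
  define P where "P = (\<Sum>i\<le>n. monom (a i) i)"
  define Q where "Q = (\<Sum>i\<le>n. monom (b i) i)"
  define r where "r = (\<Sum>i<n. monom (v $ i) i)"
  define s where "s = (\<Sum>i<n. monom (v $ (n + i)) i)"
  have sum_monom: "coeff (\<Sum>i\<in>I. monom (c i) i) j = (if j \<in> I then c j else 0)" if "finite I"
    for c :: "nat \<Rightarrow> 'k" and I j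
    using that by (simp add: coeff_sum)
  have cP: "coeff P j = (if j \<le> n then a j else 0)" for j
    unfolding P_def by (subst sum_monom) auto
  have cQ: "coeff Q j = (if j \<le> n then b j else 0)" for j
    unfolding Q_def by (subst sum_monom) auto
  have cr: "coeff r j = (if j < n then v $ j else 0)" for j
    unfolding r_def by (subst sum_monom) auto
  have cs: "coeff s j = (if j < n then v $ (n + j) else 0)" for j
    unfolding s_def by (subst sum_monom) auto
  have degs: "degree P \<le> n" "degree Q \<le> n" "degree r < n" "degree s < n"
    using assms(2) by (auto intro!: degree_le degree_lessI simp: cP cQ cr cs)
  have degP: "degree P = n"
    using degs(1) assms(1) by (intro antisym le_degree) (auto simp: cP)
  have "r * P + s * Q = 0"
  proof (rule poly_eqI)
    fix j
    show "coeff (r * P + s * Q) j = coeff 0 j"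
    proof (cases "j < 2 * n")
      case True
      have conv: "coeff (w * W) j = (\<Sum>i<n. if i \<le> j \<and> j \<le> i + n then coeff w i * coeff W (j - i) else 0)"
        if "\<And>i. i \<ge> n \<Longrightarrow> coeff w i = 0" "\<And>i. i > n \<Longrightarrow> coeff W i = 0" for w W :: "'k poly"
      proof -
        have "coeff (w * W) j = (\<Sum>i\<le>j. coeff w i * coeff W (j - i))" by (rule coeff_mult)
        also have "\<dots> = (\<Sum>i\<in>{i. i < n \<and> i \<le> j \<and> j \<le> i + n}. coeff w i * coeff W (j - i))"
        proof (intro sum.mono_neutral_right ballI)
          fix i assume i: "i \<in> {..j} - {i. i < n \<and> i \<le> j \<and> j \<le> i + n}"
          then have "n \<le> i \<or> n < j - i" by auto
          then show "coeff w i * coeff W (j - i) = 0" using that by auto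
        qed auto
        also have "\<dots> = (\<Sum>i<n. if i \<le> j \<and> j \<le> i + n then coeff w i * coeff W (j - i) else 0)"
          by (intro sum.mono_neutral_cong_left) auto
        finally show ?thesis .
      qed
      have "coeff (r * P) j = (\<Sum>i<n. syl_entry n a b i j * v $ i)"
        by (subst conv) (auto simp: cr cP syl_entry_def intro!: sum.cong)
      moreover have "coeff (s * Q) j = (\<Sum>i<n. syl_entry n a b (n + i) j * v $ (n + i))"
        by (subst conv) (auto simp: cs cQ syl_entry_def intro!: sum.cong)
      ultimately show ?thesis using col[OF True] by (simp add: sum_two_halves)
    next
      case False
      have "degree (r * P) < 2 * n" "degree (s * Q) < 2 * n"
        using degs degree_mult_le[of r P] degree_mult_le[of s Q] by linarith+
      then show ?thesis using False by (simp add: coeff_eq_0)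
    qed
  qed
  then have eq: "P * r = Q * (- s)" by (simp add: algebra_simps eq_neg_iff_add_eq_0)
  have P0: "P \<noteq> 0" using degP assms(2) by auto
  have s0: "s \<noteq> 0"
  proof
    assume "s = 0"
    with eq P0 have "r = 0" by simp
    have "v $ i = 0" if "i < 2*n" for i
    proof (cases "i < n")
      case True
      then show ?thesis using cr[of i] \<open>r = 0\<close> by simp
    next
      case False
      then have "i - n < n" "n + (i - n) = i" using that by auto
      then show ?thesis using cs[of "i - n"] \<open>s = 0\<close> by simp
    qed
    then have "v = 0\<^sub>v (2*n)" using v(1) by (intro eq_vecI) auto
    with v(2) show False ..
  qed
  have "\<not> coprime P Q"
  proof
    assume "coprime P Q"
    moreover have "P dvd Q * (- s)" using eq by (metis dvd_triv_left)
    ultimately have "P dvd - s" by (rule poly_coprime_dvd_mult)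
    then have "degree P \<le> degree (- s)" using s0 by (intro dvd_imp_degree_le) auto
    with degs degP show False by simp
  qed
  then obtain c where c: "c dvd P" "c dvd Q" "\<not> is_unit c" using coprimeI by blast
  then have "degree c > 0" using P0 by (auto simp: is_unit_iff_degree)
  then obtain x where "poly c x = 0" using alg_closed_imp_poly_has_root by blast
  then have "poly P x = 0" "poly Q x = 0" using c by (auto elim!: dvdE)
  then show "\<exists>x. (\<Sum>j\<le>n. a j * x ^ j) = 0 \<and> (\<Sum>j\<le>n. b j * x ^ j) = 0"
    by (intro exI[of _ x]) (simp add: P_def Q_def poly_sum poly_monom)
qed

section \<open>Forms with coefficients in a ring of functions on a parameter space\<close>

definition function_ring :: "('y \<Rightarrow> 'k::comm_ring_1) set \<Rightarrow> bool" where
  "function_ring A \<longleftrightarrow> (\<forall>c. (\<lambda>_. c) \<in> A) \<and>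
     (\<forall>f\<in>A. \<forall>g\<in>A. (\<lambda>y. f y + g y) \<in> A \<and> (\<lambda>y. f y * g y) \<in> A)"

text \<open>Forms of degree \<open>e\<close> in the variables \<open>D 0\<close>, ...,
  \<open>D (m - 1)\<close>, kept as functions of parameter and variables. The degree is an attribute
  of the construction, not of the function: zero has every degree.\<close>

inductive hform :: "('y \<Rightarrow> 'k::comm_ring_1) set \<Rightarrow> nat \<Rightarrow> nat \<Rightarrow> ('y \<Rightarrow> (nat \<Rightarrow> 'k) \<Rightarrow> 'k) \<Rightarrow> bool"
  for A m where
  hform_coef: "a \<in> A \<Longrightarrow> hform A m 0 (\<lambda>y D. a y)"
| hform_zero: "hform A m e (\<lambda>y D. 0)"
| hform_var: "i < m \<Longrightarrow> hform A m 1 (\<lambda>y D. D i)"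
| hform_add: "hform A m e F \<Longrightarrow> hform A m e G \<Longrightarrow> hform A m e (\<lambda>y D. F y D + G y D)"
| hform_mult: "hform A m e F \<Longrightarrow> hform A m e' G \<Longrightarrow> hform A m (e + e') (\<lambda>y D. F y D * G y D)"

lemma hform_degree_0:
  assumes "hform A m e F" "function_ring A" "e = 0"
  shows "\<exists>a\<in>A. F = (\<lambda>y D. a y)"
  using assms
proof (induction rule: hform.induct)
  case (hform_zero e)
  then show ?case by (intro bexI[of _ "\<lambda>_. 0"]) (auto simp: function_ring_def)
next
  case (hform_add e F G)
  then obtain a b where "a \<in> A" "F = (\<lambda>y D. a y)" "b \<in> A" "G = (\<lambda>y D. b y)" by blast
  then show ?case using hform_add.prems
    by (intro bexI[of _ "\<lambda>y. a y + b y"]) (auto simp: function_ring_def)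
next
  case (hform_mult e F e' G)
  then obtain a b where "a \<in> A" "F = (\<lambda>y D. a y)" "b \<in> A" "G = (\<lambda>y D. b y)" by auto
  then show ?case using hform_mult.prems
    by (intro bexI[of _ "\<lambda>y. a y * b y"]) (auto simp: function_ring_def)
qed auto

lemma hform_vanishes_at_0:
  assumes "hform A m e F" "e > 0" "\<And>i. i < m \<Longrightarrow> D i = 0"
  shows "F y D = 0"
  using assms by (induction rule: hform.induct) auto

lemma hform_cong:
  assumes "hform A m e F" "\<And>i. i < m \<Longrightarrow> D i = D' i"
  shows "F y D = F y D'"
  using assms by (induction rule: hform.induct) auto

lemma hform_sum:
  assumes "\<And>i. i \<in> I \<Longrightarrow> hform A m e (F i)"
  shows "hform A m e (\<lambda>y D. \<Sum>i\<in>I. F i y D)"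
  using assms by (induction I rule: infinite_finite_induct) (auto intro: hform_zero hform_add)

lemma hform_const: "function_ring A \<Longrightarrow> hform A m 0 (\<lambda>y D. c)"
  using hform_coef[of "\<lambda>_. c" A m] by (simp add: function_ring_def)

lemma hform_cmult:
  assumes "function_ring A" "hform A m e F"
  shows "hform A m e (\<lambda>y D. c * F y D)"
  using hform_mult[OF hform_const[OF assms(1), of m c] assms(2)] by simp

lemma hform_prod:
  assumes "function_ring A" "\<And>i. i \<in> I \<Longrightarrow> hform A m (e i) (F i)"
  shows "hform A m (\<Sum>i\<in>I. e i) (\<lambda>y D. \<Prod>i\<in>I. F i y D)"
  using assms(2)
  by (induction I rule: infinite_finite_induct) (auto intro: hform_const[OF assms(1)] hform_mult)

text \<open>The clause for \<open>i > e\<close> makes the truncated degree \<open>e - i\<close>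
  harmless and allows the Cauchy product in the case of a product.\<close>

lemma hform_expand_last:
  fixes A :: "('y \<Rightarrow> 'k::idom) set"
  assumes fr: "function_ring A" and "hform A (Suc m) e F"
  shows "\<exists>f. (\<forall>i. hform A m (e - i) (f i)) \<and> (\<forall>i>e. f i = (\<lambda>y D. 0)) \<and>
     (\<forall>y D. F y D = (\<Sum>i\<le>e. f i y D * D m ^ i))"
  using assms(2)
proof (induction rule: hform.induct)
  case (hform_coef a)
  then show ?case
    by (intro exI[of _ "\<lambda>i. if i = 0 then (\<lambda>y D. a y) else (\<lambda>y D. 0)"])
      (auto intro: hform.intros)
next
  case (hform_zero e)
  then show ?case by (intro exI[of _ "\<lambda>i y D. 0"]) (auto intro: hform.intros)
next
  case (hform_var i)
  show ?case
  proof (cases "i = m")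
    case True
    have "hform A m (1 - j) ((\<lambda>j y D. if j = 1 then 1 else 0) j)" for j
      using hform_const[OF fr, of m "1::'k"] by (cases "j = 1") (auto intro: hform_zero)
    then show ?thesis using True
      by (intro exI[of _ "\<lambda>j y D. if j = 1 then 1 else 0"]) auto
  next
    case False
    then have "hform A m (1 - j) ((\<lambda>j y D. if j = 0 then D i else 0) j)" for j
      using hform_var hform.hform_var[of i m A] by (cases "j = 0") (auto intro: hform_zero)
    then show ?thesis
      by (intro exI[of _ "\<lambda>j y D. if j = 0 then D i else 0"]) auto
  qed
next
  case (hform_add e F G)
  obtain f where f: "\<forall>i. hform A m (e - i) (f i)" "\<forall>i>e. f i = (\<lambda>y D. 0)" "\<forall>y D. F y D = (\<Sum>i\<le>e. f i y D * D m ^ i)"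
    using hform_add.IH(1) by blast
  obtain g where g: "\<forall>i. hform A m (e - i) (g i)" "\<forall>i>e. g i = (\<lambda>y D. 0)" "\<forall>y D. G y D = (\<Sum>i\<le>e. g i y D * D m ^ i)"
    using hform_add.IH(2) by blast
  with f show ?case
    by (intro exI[of _ "\<lambda>i y D. f i y D + g i y D"])
      (auto intro: hform.hform_add simp: sum.distrib algebra_simps)
next
  case (hform_mult e F e' G)
  obtain f where f: "\<And>i. hform A m (e - i) (f i)" "\<And>i. i > e \<Longrightarrow> f i = (\<lambda>y D. 0)" "\<And>y D. F y D = (\<Sum>i\<le>e. f i y D * D m ^ i)"
    using hform_mult.IH(1) by blast
  obtain g where g: "\<And>i. hform A m (e' - i) (g i)" "\<And>i. i > e' \<Longrightarrow> g i = (\<lambda>y D. 0)" "\<And>y D. G y D = (\<Sum>i\<le>e'. g i y D * D m ^ i)"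
    using hform_mult.IH(2) by blast
  let ?h = "\<lambda>r y D. \<Sum>i\<le>r. f i y D * g (r - i) y D"
  have "hform A m (e + e' - r) (\<lambda>y D. f i y D * g (r - i) y D)" if "i \<le> r" for i r
  proof (cases "i \<le> e \<and> r - i \<le> e'")
    case True
    then have deg: "e + e' - r = (e - i) + (e' - (r - i))" using that by linarith
    show ?thesis unfolding deg by (rule hform.hform_mult[OF f(1) g(1)])
  next
    case False
    then show ?thesis using f(2)[of i] g(2)[of "r - i"] by (auto intro: hform_zero)
  qed
  then have "hform A m (e + e' - r) (?h r)" for r by (intro hform_sum) auto
  moreover have "?h r = (\<lambda>y D. 0)" if "r > e + e'" for r
  proof -
    have "f i y D * g (r - i) y D = 0" if "i \<le> r" for i y D
      using f(2)[of i] g(2)[of "r - i"] that \<open>r > e + e'\<close> by (cases "i > e") auto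
    then show ?thesis by (intro ext sum.neutral) simp
  qed
  moreover have "F y D * G y D = (\<Sum>i\<le>e + e'. ?h i y D * D m ^ i)" for y D
    unfolding f(3) g(3) by (rule polynomial_product) (simp_all add: f(2) g(2))
  ultimately show ?case by (intro exI[of _ ?h]) blast
qed

text \<open>This is the degree of the resultant: the entry in row \<open>i\<close> and column
  \<open>j\<close> of the Sylvester matrix has degree \<open>i mod n + n - j\<close>, and a
  permutation only reorders the columns that are summed.\<close>

lemma sum_diff_permutation:
  fixes n :: nat
  assumes "perm permutes {..<2*n}" "\<And>i. i < 2 * n \<Longrightarrow> perm i \<le> i mod n + n"
  shows "(\<Sum>i<2*n. i mod n + n - perm i) = n * n"
proof -
  have "int (\<Sum>i<2*n. i mod n + n - perm i) = (\<Sum>i<2*n. int (i mod n + n) - int (perm i))"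
    unfolding of_nat_sum using assms(2) by (intro sum.cong refl) (simp add: of_nat_diff)
  also have "\<dots> = (\<Sum>i<2*n. int (i mod n + n)) - (\<Sum>i<2*n. int (perm i))"
    by (rule sum_subtractf)
  also have "(\<Sum>i<2*n. int (perm i)) = (\<Sum>i<2*n. int i)"
    using sum.permute[OF assms(1), of int] by (simp add: comp_def)
  also have "(\<Sum>i<2*n. int (i mod n + n)) = 2 * (\<Sum>i<n. int i + int n)"
    unfolding sum_two_halves by (simp add: sum.distrib)
  also have "(\<Sum>i<2*n. int i) = (\<Sum>i<n. int i) + (\<Sum>i<n. int i + int n)"
    unfolding sum_two_halves by (simp add: add.commute)
  finally have "int (\<Sum>i<2*n. i mod n + n - perm i) = int (n * n)"
    by (simp add: sum.distrib)
  then show ?thesis by (simp only: of_nat_eq_iff)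
qed

lemma hform_det_syl_mat:
  assumes fr: "function_ring A"
    and a: "\<And>i. i \<le> n \<Longrightarrow> hform A m (n - i) (a i)" and b: "\<And>i. i \<le> n \<Longrightarrow> hform A m (n - i) (b i)"
  shows "hform A m (n * n) (\<lambda>y D. det (syl_mat n (\<lambda>i. a i y D) (\<lambda>i. b i y D)))"
proof -
  let ?S = "\<lambda>i j y D. syl_entry n (\<lambda>i. a i y D) (\<lambda>i. b i y D) i j"
  have entry: "hform A m (i mod n + n - j) (?S i j)" for i j
  proof (cases "i mod n \<le> j \<and> j \<le> i mod n + n")
    case True
    then have "i mod n + n - j = n - (j - i mod n)" "j - i mod n \<le> n" by auto
    then show ?thesis using True a[of "j - i mod n"] b[of "j - i mod n"]
      by (cases "i < n") (simp_all add: syl_entry_def Let_def)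
  next
    case False
    then have "?S i j = (\<lambda>y D. 0)" by (auto simp: syl_entry_def Let_def)
    then show ?thesis by (auto intro: hform_zero)
  qed
  have summand: "hform A m (n * n) (\<lambda>y D. \<Prod>i<2*n. ?S i (perm i) y D)" if perm: "perm permutes {..<2*n}" for perm
  proof (cases "\<forall>i<2*n. perm i \<le> i mod n + n")
    case True
    then show ?thesis
      using hform_prod[OF fr, of "{..<2*n}" m "\<lambda>i. i mod n + n - perm i" "\<lambda>i. ?S i (perm i)"]
        entry sum_diff_permutation[OF perm] by simp
  next
    case False
    then obtain i where "i < 2*n" "\<not> perm i \<le> i mod n + n" by blast
    then have "(\<lambda>y D. \<Prod>i<2*n. ?S i (perm i) y D) = (\<lambda>y D. 0)"
      by (intro ext prod_zero) (auto simp: syl_entry_def Let_def intro!: bexI[of _ i])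
    then show ?thesis by (auto intro: hform_zero)
  qed
  have "hform A m (n * n) (\<lambda>y D. \<Sum>perm | perm permutes {..<2*n}. signof perm * (\<Prod>i<2*n. ?S i (perm i) y D))"
    by (intro hform_sum hform_cmult[OF fr] summand) simp
  moreover have "det (syl_mat n (\<lambda>i. a i y D) (\<lambda>i. b i y D)) =
     (\<Sum>perm | perm permutes {..<2*n}. signof perm * (\<Prod>i<2*n. ?S i (perm i) y D))" for y D
    unfolding det_def by (auto simp: syl_mat_def atLeast0LessThan permutes_in_image intro!: sum.cong prod.cong)
  ultimately show ?thesis by simp
qed

text \<open>Induction on the number of variables, projecting from the point whose only nonzero
  coordinate is the last. At \<open>y0\<close> some form \<open>F1\<close> does not vanish there;
  wherever its coefficient \<open>c\<close> of the pure power is nonzero, resultants with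
  \<open>F1\<close> describe the projection of the set of solutions.\<close>

theorem main_theorem_of_elimination:
  fixes A :: "('y \<Rightarrow> 'k::alg_closed_field) set"
  assumes fr: "function_ring A" and "n > 0"
    and "\<And>F. F \<in> Fs \<Longrightarrow> hform A m n F"
    and "\<And>D. \<exists>i<m. D i \<noteq> 0 \<Longrightarrow> \<exists>F\<in>Fs. F y0 D \<noteq> 0"
  shows "\<exists>h\<in>A. h y0 \<noteq> 0 \<and> (\<forall>y D. h y \<noteq> 0 \<longrightarrow> (\<exists>i<m. D i \<noteq> 0) \<longrightarrow> (\<exists>F\<in>Fs. F y D \<noteq> 0))"
  using assms(2-)
proof (induction m arbitrary: n Fs)
  case 0
  then show ?case using fr by (intro bexI[of _ "\<lambda>_. 1"]) (auto simp: function_ring_def)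
next
  case (Suc m)
  have "\<exists>F\<in>Fs. F y0 (\<lambda>i. if i = m then 1 else 0) \<noteq> 0" by (rule Suc.prems(3)) auto
  then obtain F1 where F1: "F1 \<in> Fs" "F1 y0 (\<lambda>i. if i = m then 1 else 0) \<noteq> 0" by blast
  have "\<forall>F\<in>Fs. \<exists>f. (\<forall>i. hform A m (n - i) (f i)) \<and> (\<forall>y D. F y D = (\<Sum>i\<le>n. f i y D * D m ^ i))"
    using hform_expand_last[OF fr Suc.prems(2)] by blast
  then obtain cf where "\<forall>F\<in>Fs. (\<forall>i. hform A m (n - i) (cf F i)) \<and> (\<forall>y D. F y D = (\<Sum>i\<le>n. cf F i y D * D m ^ i))"
    unfolding bchoice_iff by blast
  then have cf: "\<And>F i. F \<in> Fs \<Longrightarrow> hform A m (n - i) (cf F i)"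
    "\<And>F y D. F \<in> Fs \<Longrightarrow> F y D = (\<Sum>i\<le>n. cf F i y D * D m ^ i)"
    by blast+
  obtain c where c: "c \<in> A" "cf F1 n = (\<lambda>y D. c y)"
    using hform_degree_0[OF cf(1)[OF F1(1), of n] fr] by auto
  have top: "F1 y D = c y * D m ^ n" if D0: "\<And>i. i < m \<Longrightarrow> D i = 0" for y D
  proof -
    have "cf F1 i y D = 0" if "i < n" for i
      by (rule hform_vanishes_at_0[OF cf(1)[OF F1(1), of i]]) (use that D0 in auto)
    then have "(\<Sum>i\<le>n. cf F1 i y D * D m ^ i) = (\<Sum>i\<in>{n}. cf F1 i y D * D m ^ i)"
      by (intro sum.mono_neutral_right) auto
    also have "\<dots> = c y * D m ^ n" using c(2) by simp
    finally show ?thesis by (simp only: cf(2)[OF F1(1)])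
  qed
  have c0: "c y0 \<noteq> 0" using F1(2) by (subst (asm) top) auto
  have upd: "F y (D(m := x)) = (\<Sum>i\<le>n. cf F i y D * x ^ i)" if "F \<in> Fs" for F y D x
    using hform_cong[OF cf(1)[OF that], where y = y and D = "D(m := x)" and D' = D] by (simp add: cf(2)[OF that])
  \<comment> \<open>A root shared with each form separately need not be common to all of them. So
    \<open>F1\<close> is paired with combinations of finitely many forms by powers of a parameter
    \<open>u\<close>.\<close>
  define comb where "comb Gs u i y D = (\<Sum>k<length Gs. u ^ k * cf (Gs ! k) i y D)"
    for Gs :: "('y \<Rightarrow> (nat \<Rightarrow> 'k) \<Rightarrow> 'k) list" and u i y D
  define Res where "Res Gs u y D = det (syl_mat n (\<lambda>i. cf F1 i y D) (\<lambda>i. comb Gs u i y D))" for Gs u y D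
  define Rs where "Rs = {Res Gs u | Gs u. set Gs \<subseteq> Fs}"
  have comb_sum: "(\<Sum>i\<le>n. comb Gs u i y D * x ^ i) = (\<Sum>k<length Gs. u ^ k * (Gs ! k) y (D(m := x)))"
    if "set Gs \<subseteq> Fs" for Gs u y D x
  proof -
    have "(\<Sum>i\<le>n. comb Gs u i y D * x ^ i) = (\<Sum>k<length Gs. u ^ k * (\<Sum>i\<le>n. cf (Gs ! k) i y D * x ^ i))"
      unfolding comb_def sum_distrib_right sum_distrib_left by (subst sum.swap) (simp add: mult_ac)
    also have "\<dots> = (\<Sum>k<length Gs. u ^ k * (Gs ! k) y (D(m := x)))"
      using that by (intro sum.cong refl) (auto simp: upd dest!: nth_mem)
    finally show ?thesis .
  qed
  have Res0: "Res Gs u y D = 0 \<longleftrightarrow>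
      (\<exists>x. F1 y (D(m := x)) = 0 \<and> (\<Sum>k<length Gs. u ^ k * (Gs ! k) y (D(m := x))) = 0)"
    if "c y \<noteq> 0" "set Gs \<subseteq> Fs" for Gs u y D
    unfolding Res_def using that c(2) Suc.prems(1)
    by (subst det_syl_mat_zero_iff) (auto simp: comb_sum upd[OF F1(1)])
  have proj: "(\<forall>R\<in>Rs. R y D = 0) \<longleftrightarrow> (\<exists>x. \<forall>F\<in>Fs. F y (D(m := x)) = 0)" if cy: "c y \<noteq> 0" for y D
  proof
    assume "\<exists>x. \<forall>F\<in>Fs. F y (D(m := x)) = 0"
    then obtain x where x: "\<And>F. F \<in> Fs \<Longrightarrow> F y (D(m := x)) = 0" by blast
    have "(\<Sum>k<length Gs. u ^ k * (Gs ! k) y (D(m := x))) = 0" if "set Gs \<subseteq> Fs" for Gs u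
      using that by (intro sum.neutral) (auto simp: x dest!: nth_mem)
    then show "\<forall>R\<in>Rs. R y D = 0" using Res0[OF cy] x[OF F1(1)] unfolding Rs_def by blast
  next
    assume R0: "\<forall>R\<in>Rs. R y D = 0"
    show "\<exists>x. \<forall>F\<in>Fs. F y (D(m := x)) = 0"
    proof (rule ccontr)
      assume "\<not> ?thesis"
      \<comment> \<open>\<open>w x\<close> is a form that excludes \<open>x\<close>, and
        \<open>Gs\<close> lists one for each root of \<open>F1\<close>. Every \<open>u\<close>
        yields a root; some root serves infinitely many \<open>u\<close>, which forces all forms in
        the list to vanish there, including the one that excludes it.\<close>
      then obtain w where w: "\<And>x. w x \<in> Fs" "\<And>x. w x y (D(m := x)) \<noteq> 0" by metis
      define X where "X = {x. F1 y (D(m := x)) = 0}"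
      have "finite X"
      proof -
        let ?q = "\<Sum>i\<le>n. monom (cf F1 i y D) i"
        have "coeff ?q n = c y" using c(2) by (simp add: coeff_sum)
        then have "?q \<noteq> 0" using cy by force
        then have "finite {x. poly ?q x = 0}" by (rule poly_roots_finite)
        then show ?thesis by (simp add: X_def upd[OF F1(1)] poly_sum poly_monom)
      qed
      then obtain Gs where Gs: "set Gs = w ` X" using finite_list[of "w ` X"] by auto
      then have sub: "set Gs \<subseteq> Fs" using w by auto
      have "\<exists>x\<in>X. (\<Sum>k<length Gs. u ^ k * (Gs ! k) y (D(m := x))) = 0" for u
        using R0 Res0[OF cy sub, of u D] sub unfolding X_def Rs_def by blast
      then obtain z where z: "\<And>u. z u \<in> X" "\<And>u. (\<Sum>k<length Gs. u ^ k * (Gs ! k) y (D(m := z u))) = 0"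
        by metis
      have "finite (z ` UNIV)" using z(1) \<open>finite X\<close> by (meson finite_subset image_subsetI)
      then obtain u0 where u0: "infinite {u \<in> UNIV. z u = z u0}"
        using pigeonhole_infinite[OF infinite_UNIV_alg_closed] by blast
      let ?x = "z u0"
      let ?q = "\<Sum>k<length Gs. monom ((Gs ! k) y (D(m := ?x))) k"
      have "{u \<in> UNIV. z u = z u0} \<subseteq> {u. poly ?q u = 0}"
      proof
        fix u assume "u \<in> {u \<in> UNIV. z u = z u0}"
        then have "(\<Sum>k<length Gs. u ^ k * (Gs ! k) y (D(m := ?x))) = 0" using z(2)[of u] by simp
        then show "u \<in> {u. poly ?q u = 0}" by (simp add: poly_sum poly_monom mult.commute)
      qed
      with u0 have "infinite {u. poly ?q u = 0}" using finite_subset by blast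
      then have q0: "?q = 0" using poly_roots_finite by blast
      obtain k where k: "k < length Gs" "Gs ! k = w ?x"
        using Gs z(1)[of u0] by (metis imageI in_set_conv_nth)
      have "coeff ?q k = (Gs ! k) y (D(m := ?x))" using k(1) by (simp add: coeff_sum)
      with q0 k(2) w(2) show False by simp
    qed
  qed
  have "\<exists>h\<in>A. h y0 \<noteq> 0 \<and> (\<forall>y D. h y \<noteq> 0 \<longrightarrow> (\<exists>i<m. D i \<noteq> 0) \<longrightarrow> (\<exists>F\<in>Rs. F y D \<noteq> 0))"
  proof (rule Suc.IH[of "n * n"])
    show "n * n > 0" using Suc.prems(1) by simp
    show "hform A m (n * n) F" if F': "F \<in> Rs" for F
    proof -
      obtain Gs u where F: "F = Res Gs u" "set Gs \<subseteq> Fs" using F' unfolding Rs_def by blast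
      have cm: "hform A m (n - i) (comb Gs u i)" for i
        unfolding comb_def using F(2)
        by (intro hform_sum hform_cmult[OF fr] cf(1)) (auto dest!: nth_mem)
      show ?thesis unfolding F(1) Res_def
        by (rule hform_det_syl_mat[OF fr, of n m "cf F1" "comb Gs u", OF cf(1)[OF F1(1)] cm])
    qed
    show "\<exists>F\<in>Rs. F y0 D \<noteq> 0" if D: "\<exists>i<m. D i \<noteq> 0" for D
    proof (rule ccontr)
      assume "\<not> (\<exists>F\<in>Rs. F y0 D \<noteq> 0)"
      then obtain x where "\<forall>F\<in>Fs. F y0 (D(m := x)) = 0" using proj[OF c0, of D] by blast
      moreover have "\<exists>i<Suc m. (D(m := x)) i \<noteq> 0" using D by (metis fun_upd_apply less_SucI less_irrefl)
      ultimately show False using Suc.prems(3)[of "D(m := x)"] by blast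
    qed
  qed
  then obtain h where h: "h \<in> A" "h y0 \<noteq> 0"
    "\<forall>y D. h y \<noteq> 0 \<longrightarrow> (\<exists>i<m. D i \<noteq> 0) \<longrightarrow> (\<exists>F\<in>Rs. F y D \<noteq> 0)" by (elim bexE conjE)
  show ?case
  proof (intro bexI[of _ "\<lambda>y. h y * c y"] conjI allI impI)
    show "(\<lambda>y. h y * c y) \<in> A" using fr h(1) c(1) by (simp add: function_ring_def)
    show "h y0 * c y0 \<noteq> 0" using h(2) c0 by simp
    fix y and D :: "nat \<Rightarrow> 'k" assume hc: "h y * c y \<noteq> 0" and D: "\<exists>i<Suc m. D i \<noteq> 0"
    show "\<exists>F\<in>Fs. F y D \<noteq> 0"
    proof (cases "\<exists>i<m. D i \<noteq> 0")
      case True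
      then have "\<not> (\<forall>R\<in>Rs. R y D = 0)" using h(3) hc by (metis mult_zero_left)
      then have "\<not> (\<exists>x. \<forall>F\<in>Fs. F y (D(m := x)) = 0)"
        using proj[of y D] hc by (metis mult_zero_right)
      then have "\<not> (\<forall>F\<in>Fs. F y (D(m := D m)) = 0)" by blast
      then show ?thesis by simp
    next
      case False
      then have "D m \<noteq> 0" "F1 y D = c y * D m ^ n" using D less_Suc_eq top by auto
      then show ?thesis using F1(1) hc by (intro bexI[of _ F1]) auto
    qed
  qed
qed

section \<open>Degeneration of the points\<close>

lemma hform_coeff_mult:
  assumes "\<And>i. hform A m e (\<lambda>y D. coeff (F y D) i)" "\<And>i. hform A m e' (\<lambda>y D. coeff (G y D) i)"
  shows "hform A m (e + e') (\<lambda>y D. coeff (F y D * G y D) i)"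
  unfolding coeff_mult by (intro hform_sum hform_mult assms)

lemma hform_coeff_power:
  assumes "function_ring A" "\<And>i. hform A m e (\<lambda>y D. coeff (F y D) i)"
  shows "hform A m (k * e) (\<lambda>y D. coeff (F y D ^ k) i)"
proof (induction k arbitrary: i)
  case 0
  show ?case using hform_const[OF assms(1)] by simp
next
  case (Suc k)
  then show ?case using hform_coeff_mult[OF assms(2) Suc] by simp
qed

lemma hform_coeff_prod:
  assumes "function_ring A" "\<And>j i. j \<in> I \<Longrightarrow> hform A m 0 (\<lambda>y D. coeff (F j y D) i)"
  shows "hform A m 0 (\<lambda>y D. coeff (\<Prod>j\<in>I. F j y D) i)"
  using assms(2)
proof (induction I arbitrary: i rule: infinite_finite_induct)
  case (insert j I)
  then show ?case
    using hform_coeff_mult[of A m 0 "F j" 0 "\<lambda>y D. \<Prod>j\<in>I. F j y D"] by simp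
qed (auto intro: hform_const[OF assms(1)])

lemma hform_coeff_form:
  assumes "\<And>i. i < m \<Longrightarrow> w i \<in> A"
  shows "hform A m 1 (\<lambda>y D. coeff (\<Sum>i<m. monom (D i * w i y) i) k)"
proof (cases "k < m")
  case True
  have "hform A m (1 + 0) (\<lambda>y D. D k * w k y)"
    by (intro hform_mult hform_var hform_coef assms True)
  moreover have "(\<lambda>y D. coeff (\<Sum>i<m. monom (D i * w i y) i) k) = (\<lambda>y D. D k * w k y)"
    using True by (simp add: fun_eq_iff coeff_sum)
  ultimately show ?thesis by simp
next
  case False
  then have "(\<lambda>y D. coeff (\<Sum>i<m. monom (D i * w i y) i) k) = (\<lambda>y D. 0)"
    by (auto simp: fun_eq_iff coeff_sum intro!: sum.neutral)
  then show ?thesis by (simp add: hform_zero)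
qed

lemma function_ring_poly: "function_ring (range (poly :: 'k::comm_ring_1 poly \<Rightarrow> _))"
  unfolding function_ring_def
proof (intro conjI allI ballI)
  show "(\<lambda>_. c) \<in> range poly" for c :: 'k
    by (rule range_eqI[of _ _ "[:c:]"]) (simp add: fun_eq_iff)
  fix f g :: "'k \<Rightarrow> 'k" assume "f \<in> range poly" "g \<in> range poly"
  then obtain q r where fg: "f = poly q" "g = poly r" by auto
  show "(\<lambda>y. f y + g y) \<in> range poly" by (rule range_eqI[of _ _ "q + r"]) (simp add: fun_eq_iff fg)
  show "(\<lambda>y. f y * g y) \<in> range poly" by (rule range_eqI[of _ _ "q * r"]) (simp add: fun_eq_iff fg)
qed

text \<open>
  Adjoining a point \<open>1 / s\<^sup>2\<close> that tends to infinity as \<open>s\<close> tends to 0. With \<open>D\<^sub>i\<close> scaled by a power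
  of \<open>s\<close> that is a piecewise linear function of \<open>i\<close>, the equations decouple at \<open>s = 0\<close> into those
  for the old points (low coefficients) and those for \<open>t ^ G * (1 - t) ^ a\<close> (high coefficients).
\<close>

lemma degeneration_step:
  fixes g :: "'k::alg_closed_field poly"
  assumes p: "CHAR('k) = p" "2 < p" and a: "a < p" and g: "g \<noteq> 0"
    and old: "\<And>D. D \<noteq> 0 \<Longrightarrow> cartier_zero p (g * D ^ (p - 2)) \<Longrightarrow> degree g + 1 \<le> 2 * degree D + p"
  obtains h :: "'k poly" where "h \<noteq> 0"
    "\<And>s D. s \<noteq> 0 \<Longrightarrow> poly h s \<noteq> 0 \<Longrightarrow> D \<noteq> 0 \<Longrightarrow>
      cartier_zero p (g * [:1, -(s ^ 2):] ^ a * D ^ (p - 2)) \<Longrightarrow> degree g + a + 1 \<le> 2 * degree D + p"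
proof -
  define G where "G = degree g"
  obtain q where q: "p = q + 2" "q > 0" using p(2) by (metis add.commute less_imp_add_positive)
  \<comment> \<open>\<open>degree D < M\<close> says just that the desired inequality fails, so
    \<open>M\<close> is the number of unknown coefficients of a counterexample.\<close>
  obtain M where M: "\<And>x. x < M \<longleftrightarrow> 2 * x + p < G + a + 1"
  proof
    show "x < (G + a + 2 - p) div 2 \<longleftrightarrow> 2 * x + p < G + a + 1" for x by linarith
  qed
  \<comment> \<open>By truncated subtraction \<open>lo i\<close> is zero up to the break
    \<open>2 * i + p - 1 = G\<close> and \<open>hi i\<close> from there on, so at
    \<open>s = 0\<close> each \<open>D i\<close> survives in \<open>Dp lo\<close> or in
    \<open>Dp hi\<close>. The break is where the inequality of \<open>old\<close>, with
    \<open>i\<close> as the degree, changes its truth value.\<close>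
  define lo where "lo i = 2 * i + p - 1 - G" for i
  define hi where "hi i = G - (2 * i + p - 1)" for i
  define Dp where "Dp u s D = (\<Sum>i<M. monom (D i * s ^ u i) i)" for u and s :: 'k and D
  \<comment> \<open>For nonzero \<open>s\<close> this is \<open>g(t / s ^ 2)\<close> times
    \<open>s ^ (2 * G)\<close>; at \<open>s = 0\<close> only the leading term is left.\<close>
  define gm where "gm s = (\<Sum>l\<le>G. monom (coeff g l * s ^ (2 * (G - l))) l)" for s
  define low where "low j s D = coeff (g * [:1, -(s ^ 2):] ^ a * Dp lo s D ^ (p - 2)) (p * j + p - 1)" for j s D
  define high where "high j s D = coeff (gm s * [:1, -1:] ^ a * Dp hi s D ^ (p - 2)) (p * j + p - 1)" for j s D
  \<comment> \<open>For nonzero \<open>s\<close>, \<open>low j\<close> and \<open>high j\<close> are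
    one equation written in two coordinates, up to a nonzero factor; in the second the new point
    \<open>1 / s ^ 2\<close> has moved to 1. One version is kept for each \<open>j\<close>, split at
    the break of the weights.\<close>
  define Fs where "Fs = {low j | j. 2 * j + p - 1 < G} \<union> {high j | j. G \<le> 2 * j + p - 1}"
  let ?A = "range (poly :: 'k poly \<Rightarrow> _)"
  note fr = function_ring_poly[where 'k='k]
  have pow: "(\<lambda>s. c * s ^ k) \<in> ?A" for c :: 'k and k
    by (intro range_eqI[of _ _ "monom c k"]) (simp add: fun_eq_iff poly_monom)
  have hDp: "hform ?A M ((p - 2) * 1) (\<lambda>s D. coeff (Dp u s D ^ (p - 2)) i)" for u i
    unfolding Dp_def using pow[of 1]
    by (intro hform_coeff_power[OF fr] hform_coeff_form) simp
  have hconst: "hform ?A M 0 (\<lambda>s D. coeff (P s) i)" if "(\<lambda>s. coeff (P s) i) \<in> ?A" for P :: "'k \<Rightarrow> 'k poly" and i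
    by (rule hform_coef[OF that])
  have const_in: "(\<lambda>s. c) \<in> ?A" for c :: 'k using pow[of c 0] by simp
  have hlow: "hform ?A M (p - 2) (low j)" for j
  proof -
    have "(\<lambda>s. coeff [:1, -(s ^ 2):] i) \<in> ?A" for i
    proof -
      have "(\<lambda>s. coeff [:1, -(s ^ 2):] i) = (\<lambda>s::'k. if i = 0 then 1 else if i = 1 then (-1) * s ^ 2 else 0)"
        by (auto simp: fun_eq_iff coeff_pCons split: nat.split)
      then show ?thesis using const_in[of 0] const_in[of 1] pow[of "-1" 2]
        by (cases "i = 0"; cases "i = 1") simp_all
    qed
    then have 1: "hform ?A M (a * 0) (\<lambda>s D. coeff ([:1, -(s ^ 2):] ^ a) i)" for i
      by (intro hform_coeff_power[OF fr] hconst)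
    have 2: "hform ?A M 0 (\<lambda>s D. coeff g i)" for i by (intro hconst const_in)
    have "hform ?A M (0 + a * 0 + (p - 2) * 1) (low j)"
      unfolding low_def by (intro hform_coeff_mult 1 2 hDp)
    then show ?thesis by simp
  qed
  have hhigh: "hform ?A M (p - 2) (high j)" for j
  proof -
    have "(\<lambda>s. coeff (gm s) i) \<in> ?A" for i
    proof -
      have "(\<lambda>s. coeff (gm s) i) = (\<lambda>s. coeff g i * s ^ (2 * (G - i)))"
        by (auto simp: gm_def fun_eq_iff coeff_sum G_def coeff_eq_0 not_le)
      then show ?thesis using pow by simp
    qed
    then have 2: "hform ?A M 0 (\<lambda>s D. coeff (gm s) i)" for i by (rule hconst)
    have 1: "hform ?A M 0 (\<lambda>s D. coeff ([:1, -1:] ^ a) i)" for i by (intro hconst const_in)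
    have "hform ?A M (0 + 0 + (p - 2) * 1) (high j)"
      unfolding high_def by (intro hform_coeff_mult 1 2 hDp)
    then show ?thesis by simp
  qed
  have coDp: "coeff (Dp u s D) i = (if i < M then D i * s ^ u i else 0)" for u s D i
    by (simp add: Dp_def coeff_sum)
  have degDp: "degree (Dp u s D) < M" if "Dp u s D \<noteq> 0" for u s D
    using that coDp[of u s D "degree (Dp u s D)"] by (metis leading_coeff_0_iff)
  have special: "\<exists>F\<in>Fs. F 0 D \<noteq> 0" if D: "\<exists>i<M. D i \<noteq> 0" for D
  proof (rule ccontr)
    assume "\<not> ?thesis"
    then have F0: "F 0 D = 0" if "F \<in> Fs" for F using that by blast
    have low0: "low j 0 D = 0" if "2 * j + p - 1 < G" for j
      using that by (intro F0) (auto simp: Fs_def)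
    have high0: "high j 0 D = 0" if "G \<le> 2 * j + p - 1" for j
      using that by (intro F0) (auto simp: Fs_def)
    let ?L = "Dp lo 0 D" and ?H = "Dp hi 0 D"
    have H0: "?H = 0"
    proof (rule ccontr)
      assume H: "?H \<noteq> 0"
      define i0 where "i0 = (LEAST i. G \<le> 2 * i + p - 1)"
      have i0: "G \<le> 2 * i0 + p - 1" unfolding i0_def
        by (rule LeastI[where P = "\<lambda>i. G \<le> 2 * i + p - 1" and k = G]) (use p in simp)
      have i0': "i0 \<le> i" if "G \<le> 2 * i + p - 1" for i unfolding i0_def
        by (rule Least_le) (rule that)
      have coH: "coeff ?H k = 0" if "k < i0" for k
      proof -
        have "hi k > 0" using i0'[of k] that unfolding hi_def by linarith
        then show ?thesis by (simp add: coDp)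
      qed
      then have dvd: "monom 1 i0 dvd ?H" by (simp add: monom_1_dvd_iff')
      have "order 0 ?H \<ge> i0"
      proof -
        have "monom (1::'k) i0 = [:-0, 1:] ^ i0" by (simp add: monom_altdef)
        then show ?thesis using dvd H by (metis order_divides)
      qed
      then have "G + 1 \<le> 2 * order 0 ?H + p" using i0 p by linarith
      moreover have "2 * degree ?H + p < G + a + 1" using degDp[OF H] M by blast
      ultimately have ncz: "\<not> cartier_zero p (monom 1 G * [:1, -1:] ^ a * ?H ^ (p - 2))"
        using three_point_obstruction[of p ?H a G] p a H by simp
      have gm0: "gm 0 = smult (lead_coeff g) (monom 1 G)"
      proof -
        have "gm 0 = (\<Sum>l\<in>{G}. monom (coeff g l * 0 ^ (2 * (G - l))) l)"
          unfolding gm_def by (intro sum.mono_neutral_right) auto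
        then show ?thesis by (simp add: G_def smult_monom)
      qed
      have "coeff (monom 1 G * [:1, -1:] ^ a * ?H ^ (p - 2)) (p * j + p - 1) = 0" for j
      proof (cases "G \<le> 2 * j + p - 1")
        case True
        have "lead_coeff g * coeff (monom 1 G * [:1, -1:] ^ a * ?H ^ (p - 2)) (p * j + p - 1) = high j 0 D"
          by (simp add: high_def gm0)
        then show ?thesis using high0[OF True] g by simp
      next
        case False
        \<comment> \<open>The high equations left out of \<open>Fs\<close> hold anyway: their
          exponents are below the order of vanishing at 0.\<close>
        have "monom 1 i0 ^ q dvd ?H ^ q" using dvd by (rule dvd_power_same)
        then have "monom 1 G * monom 1 i0 ^ q dvd (monom 1 G * [:1, -1:] ^ a) * ?H ^ (p - 2)"
          by (intro mult_dvd_mono) (simp_all add: q)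
        then have "monom 1 (G + i0 * q) dvd monom 1 G * [:1, -1:] ^ a * ?H ^ (p - 2)"
          by (simp only: monom_power mult_monom power_one mult_1)
        moreover have "p * j + p - 1 < G + i0 * q"
        proof -
          have "j \<le> i0" using False i0 by linarith
          then have "q * j \<le> i0 * q" by (simp add: mult.commute)
          moreover have "p * j + p - 1 = q * j + (2 * j + p - 1)" using q by (simp add: algebra_simps)
          ultimately show ?thesis using False by linarith
        qed
        ultimately show ?thesis by (simp add: monom_1_dvd_iff')
      qed
      with ncz show False unfolding cartier_zero_def by blast
    qed
    have Dz: "D i = 0" if "i < M" "G \<le> 2 * i + p - 1" for i
    proof -
      have "coeff ?H i = D i" using that by (simp add: coDp hi_def)
      then show ?thesis by (simp add: H0)
    qed
    have L: "?L \<noteq> 0"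
    proof -
      obtain i where i: "i < M" "D i \<noteq> 0" using D by blast
      then have "2 * i + p - 1 < G" using Dz by (meson not_le)
      then have "coeff ?L i = D i" using i by (simp add: coDp lo_def)
      then show ?thesis using i by force
    qed
    have dL: "2 * degree ?L + p - 1 < G"
    proof (rule ccontr)
      assume "\<not> ?thesis"
      then have "coeff ?L (degree ?L) = 0" using Dz degDp[OF L] by (simp add: coDp)
      then show False using L by simp
    qed
    have "coeff (g * ?L ^ (p - 2)) (p * j + p - 1) = 0" for j
    proof (cases "2 * j + p - 1 < G")
      case True
      then show ?thesis using low0 by (simp add: low_def pCons_one)
    next
      case False
      \<comment> \<open>The low equations left out of \<open>Fs\<close> hold because their exponents
        exceed the degree.\<close>
      have "degree (g * ?L ^ (p - 2)) = G + q * degree ?L"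
        using g L by (simp add: degree_mult_eq degree_power_eq G_def q)
      also have "\<dots> < p * j + p - 1"
      proof -
        have "degree ?L < j" using dL False by linarith
        then have "q * degree ?L < q * j" using q by simp
        moreover have "p * j + p - 1 = q * j + (2 * j + p - 1)" using q by (simp add: algebra_simps)
        ultimately show ?thesis using False by linarith
      qed
      finally show ?thesis by (rule coeff_eq_0)
    qed
    then have "G + 1 \<le> 2 * degree ?L + p" using old[OF L] unfolding cartier_zero_def G_def by blast
    with dL show False by linarith
  qed
  have "\<exists>h\<in>?A. h 0 \<noteq> 0 \<and> (\<forall>s D. h s \<noteq> 0 \<longrightarrow> (\<exists>i<M. D i \<noteq> 0) \<longrightarrow> (\<exists>F\<in>Fs. F s D \<noteq> 0))"
    by (rule main_theorem_of_elimination[OF fr, of "p - 2"])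
      (use p hlow hhigh special in \<open>auto simp: Fs_def\<close>)
  then obtain h :: "'k poly" where h: "poly h 0 \<noteq> 0"
    "\<forall>s D. poly h s \<noteq> 0 \<longrightarrow> (\<exists>i<M. D i \<noteq> 0) \<longrightarrow> (\<exists>F\<in>Fs. F s D \<noteq> 0)" by blast
  show ?thesis
  proof (rule that[of h])
    show "h \<noteq> 0" using h(1) by auto
    fix s :: 'k and D
    assume s: "s \<noteq> 0" "poly h s \<noteq> 0" and D: "D \<noteq> 0"
      and cz: "cartier_zero p (g * [:1, -(s ^ 2):] ^ a * D ^ (p - 2))"
    show "degree g + a + 1 \<le> 2 * degree D + p"
    proof (rule ccontr)
      assume "\<not> ?thesis"
      then have dM: "degree D < M" by (simp add: M G_def)
      \<comment> \<open>Undoes the scaling: \<open>Dp lo s D'\<close> is \<open>D\<close> and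
        \<open>Dp hi s D'\<close> is \<open>D(t / s ^ 2)\<close> up to a scalar, so all equations of
        \<open>Fs\<close> vanish at \<open>D'\<close>.\<close>
      define D' where "D' i = coeff D i / s ^ lo i" for i
      have "\<exists>i<M. D' i \<noteq> 0" using dM D s by (intro exI[of _ "degree D"]) (simp add: D'_def)
      then obtain F where F: "F \<in> Fs" "F s D' \<noteq> 0" using h(2) s(2) by blast
      have c0: "coeff D i = 0" if "\<not> i < M" for i using that dM by (intro coeff_eq_0) simp
      have Dlo: "Dp lo s D' = D"
        using s c0 by (intro poly_eqI) (simp add: coDp D'_def)
      define c where "c = 1 / s ^ 2"
      have cs: "coeff (pcompose P [:0, c:]) n = c ^ n * coeff P n" for P n
        by (rule coeff_pcompose_linear)
      have gm_s: "gm s = smult (s ^ (2 * G)) (pcompose g [:0, c:])"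
      proof (rule poly_eqI)
        fix l
        have "s ^ (2 * (G - l)) = s ^ (2 * G) * c ^ l" if "l \<le> G"
          using s that by (simp add: c_def power_diff diff_mult_distrib2 power_mult power_divide)
        then show "coeff (gm s) l = coeff (smult (s ^ (2 * G)) (pcompose g [:0, c:])) l"
          by (cases "l \<le> G") (auto simp: gm_def coeff_sum cs G_def coeff_eq_0)
      qed
      have Dhi: "Dp hi s D' = smult (s ^ G / s ^ (p - 1)) (pcompose D [:0, c:])"
      proof (rule poly_eqI)
        fix i
        have eq: "s ^ hi i / s ^ lo i = s ^ G / s ^ (p - 1) * c ^ i"
        proof -
          have "s ^ hi i * s ^ (2 * i + p - 1) = s ^ G * s ^ lo i"
            unfolding power_add[symmetric] by (rule arg_cong[of _ _ "power s"]) (simp add: hi_def lo_def)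
          moreover have "s ^ (2 * i + p - 1) = (s ^ 2) ^ i * s ^ (p - 1)"
            using p by (simp flip: power_mult power_add)
          ultimately show ?thesis using s by (simp add: c_def field_simps)
        qed
        have "coeff D i / s ^ lo i * s ^ hi i = coeff D i * (s ^ hi i / s ^ lo i)" by simp
        also have "\<dots> = s ^ G / s ^ (p - 1) * (c ^ i * coeff D i)" by (simp only: eq mult_ac)
        finally show "coeff (Dp hi s D') i = coeff (smult (s ^ G / s ^ (p - 1)) (pcompose D [:0, c:])) i"
          using c0[of i] by (simp only: coDp cs D'_def coeff_smult) simp
      qed
      have one_t: "[:1, -1:] = pcompose [:1, -(s ^ 2):] [:0, c:]"
        using s by (simp add: pcompose_pCons c_def)
      have "gm s * [:1, -1:] ^ a * Dp hi s D' ^ (p - 2) =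
          smult (s ^ (2 * G) * (s ^ G / s ^ (p - 1)) ^ (p - 2))
            (pcompose (g * [:1, -(s ^ 2):] ^ a * D ^ (p - 2)) [:0, c:])"
      proof -
        have "smult u X * Y * smult w Z ^ k = smult (u * w ^ k) (X * Y * Z ^ k)"
          for u w :: 'k and X Y Z :: "'k poly" and k by (simp add: smult_power mult_ac)
        then show ?thesis unfolding gm_s Dhi one_t pcompose_mult pcompose_power by blast
      qed
      then have "high j s D' = 0" for j
        using cz unfolding high_def cartier_zero_def by (simp only: coeff_smult cs mult_zero_right)
      moreover have "low j s D' = 0" for j
        using cz unfolding low_def cartier_zero_def Dlo by simp
      ultimately show False using F unfolding Fs_def by auto
    qed
  qed
qed

text \<open>The points are the inverses \<open>1 / Q i\<close>, so the new parameter is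
  \<open>s ^ 2\<close>, and \<open>degeneration_step\<close> rules out only finitely many
  \<open>s\<close>.\<close>

lemma generic_points_exist:
  fixes a :: "'i \<Rightarrow> nat"
  assumes p: "CHAR('k::alg_closed_field) = p" "2 < p" and "finite I" "\<And>i. i \<in> I \<Longrightarrow> a i < p"
  shows "\<exists>Q :: 'i \<Rightarrow> 'k. inj_on Q I \<and> (\<forall>i\<in>I. Q i \<noteq> 0) \<and>
    (\<forall>D. D \<noteq> 0 \<longrightarrow> cartier_zero p ((\<Prod>i\<in>I. [:1, - Q i:] ^ a i) * D ^ (p - 2)) \<longrightarrow>
       (\<Sum>i\<in>I. a i) + 1 \<le> 2 * degree D + p)"
  using assms(3,4)
proof (induction I rule: finite_induct)
  case empty
  then show ?case using p by auto
next
  case (insert k I)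
  then obtain Q :: "'i \<Rightarrow> 'k" where Q: "inj_on Q I" "\<And>i. i \<in> I \<Longrightarrow> Q i \<noteq> 0"
    "\<And>D. D \<noteq> 0 \<Longrightarrow> cartier_zero p ((\<Prod>i\<in>I. [:1, - Q i:] ^ a i) * D ^ (p - 2)) \<Longrightarrow>
       (\<Sum>i\<in>I. a i) + 1 \<le> 2 * degree D + p"
    by auto
  let ?g = "\<Prod>i\<in>I. [:1, - Q i:] ^ a i"
  have g0: "?g \<noteq> 0" using insert.hyps by (simp add: prod_zero_iff)
  have deg: "degree ?g = (\<Sum>i\<in>I. a i)"
    using Q(2) by (subst degree_prod_eq_sum_degree) (auto simp: degree_power_eq intro!: sum.cong)
  obtain h where h: "h \<noteq> 0"
    "\<And>s D. s \<noteq> 0 \<Longrightarrow> poly h s \<noteq> 0 \<Longrightarrow> D \<noteq> 0 \<Longrightarrow>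
      cartier_zero p (?g * [:1, -(s ^ 2):] ^ a k * D ^ (p - 2)) \<Longrightarrow> degree ?g + a k + 1 \<le> 2 * degree D + p"
    using degeneration_step[of p "a k" ?g] p insert.prems Q(3) g0 unfolding deg by blast
  \<comment> \<open>Its roots are the excluded values: the roots of \<open>h\<close>, zero, and the
    square roots of the parameters in use.\<close>
  define B where "B = h * [:0, 1:] * (\<Prod>i\<in>I. [:- Q i, 0, 1:])"
  have "B \<noteq> 0" using h(1) insert.hyps by (simp add: B_def prod_zero_iff del: mult_pCons_right)
  then have "finite {s. poly B s = 0}" by (rule poly_roots_finite)
  then have "{s. poly B s = 0} \<noteq> UNIV" using infinite_UNIV_alg_closed[where 'k='k] by auto
  then obtain s where "poly B s \<noteq> 0" by auto
  then have s: "s \<noteq> 0" "poly h s \<noteq> 0" "\<And>i. i \<in> I \<Longrightarrow> Q i \<noteq> s ^ 2"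
    using insert.hyps by (auto simp: B_def poly_prod prod_zero_iff power2_eq_square)
  let ?Q = "Q(k := s ^ 2)"
  have Qeq: "(\<Prod>i\<in>I. [:1, - ?Q i:] ^ a i) = ?g"
    using insert.hyps by (intro prod.cong) auto
  show ?case
  proof (intro exI[of _ ?Q] conjI allI impI ballI)
    show "inj_on ?Q (insert k I)" using Q(1) s(3) s(3)[THEN not_sym] insert.hyps by (auto simp: inj_on_def)
    show "?Q i \<noteq> 0" if "i \<in> insert k I" for i using that Q(2) s(1) by auto
    fix D :: "'k poly"
    assume "D \<noteq> 0" "cartier_zero p ((\<Prod>i\<in>insert k I. [:1, - ?Q i:] ^ a i) * D ^ (p - 2))"
    moreover have "(\<Prod>i\<in>insert k I. [:1, - ?Q i:] ^ a i) = ?g * [:1, - (s ^ 2):] ^ a k"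
      unfolding prod.insert[OF insert.hyps] Qeq by (simp add: mult.commute)
    ultimately have "(\<Sum>i\<in>I. a i) + a k + 1 \<le> 2 * degree D + p"
      using h(2)[OF s(1,2), of D] unfolding deg by simp
    then show "(\<Sum>i\<in>insert k I. a i) + 1 \<le> 2 * degree D + p"
      using insert.hyps by simp
  qed
qed

section \<open>Nonexistence for general points\<close>

lemma power_dvd_pderiv:
  fixes s X :: "'a::idom poly"
  assumes "X ^ e dvd s"
  shows "X ^ (e - 1) dvd pderiv s"
proof -
  obtain V where V: "s = X ^ e * V" using assms by (elim dvdE)
  have "pderiv s = X ^ e * pderiv V + V * smult (of_nat e) (X ^ (e - 1) * pderiv X)"
    by (simp only: V pderiv_mult pderiv_power)
  moreover have "X ^ (e - 1) dvd X ^ e" by (simp add: le_imp_power_dvd)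
  ultimately show ?thesis by (auto intro!: dvd_add dvd_smult)
qed

text \<open>The fibre form \<open>a N - b D\<close> has Wronskian \<open>a W\<close> with
  \<open>D\<close> and \<open>b W\<close> with \<open>N\<close>, where \<open>W\<close> is that of
  \<open>N\<close> and \<open>D\<close>. As \<open>a\<close> and \<open>b\<close> are not both zero,
  this covers poles and finite values alike.\<close>

lemma power_dvd_wronskian:
  fixes N D :: "'a::field poly"
  assumes N: "reduced_pair d N D" and v: "vord d (Aff x) (fibre_form d N D (Aff x)) = e"
  shows "[:-x, 1:] ^ (e - 1) dvd wronskian N D"
proof -
  let ?s = "fibre_form d N D (Aff x)" and ?X = "[:-x, 1:]"
  let ?a = "poly D x" and ?b = "poly N x"
  have s: "?s = smult ?a N - smult ?b D" by (simp add: fibre_form_def)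
  have dvd: "?X ^ e dvd ?s" using v by (auto simp: order_divides)
  then have dvd': "?X ^ (e - 1) dvd ?s" by (meson diff_le_self dvd_trans le_imp_power_dvd)
  have W: "?X ^ (e - 1) dvd wronskian ?s A" for A
    unfolding wronskian_def by (intro dvd_diff dvd_mult2 power_dvd_pderiv[OF dvd] dvd')
  have "wronskian ?s D = smult ?a (wronskian N D)" "wronskian ?s N = smult ?b (wronskian N D)"
    unfolding s wronskian_def by (simp_all add: pderiv_diff pderiv_smult smult_diff_right algebra_simps)
  then have "?X ^ (e - 1) dvd smult ?a (wronskian N D)" "?X ^ (e - 1) dvd smult ?b (wronskian N D)"
    using W[of D] W[of N] by simp_all
  moreover have "?a \<noteq> 0 \<or> ?b \<noteq> 0" using reduced_pair_hval[OF N, of "Aff x"] by auto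
  ultimately show ?thesis by (auto dest: dvd_smult_cancel)
qed

text \<open>The naive bound is \<open>2 * d - 1\<close>. If neither degree is below
  \<open>d\<close>, subtracting a multiple of \<open>D\<close> from \<open>N\<close> lowers one of
  them and leaves the Wronskian unchanged.\<close>

lemma degree_wronskian_le:
  fixes N D :: "'a::field poly"
  assumes "degree N \<le> d" "degree D \<le> d" "d \<ge> 2"
  shows "degree (wronskian N D) \<le> 2 * d - 2"
proof -
  have main: "degree (wronskian A B) \<le> 2 * d - 2" if "degree A \<le> d - 1" "degree B \<le> d" for A B :: "'a poly"
  proof -
    have "degree (pderiv A * B) \<le> (d - 2) + d"
      using that degree_pderiv_le[of A] by (intro order_trans[OF degree_mult_le] add_mono) auto
    moreover have "degree (A * pderiv B) \<le> (d - 1) + (d - 1)"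
      using that degree_pderiv_le[of B] by (intro order_trans[OF degree_mult_le] add_mono) auto
    ultimately show ?thesis unfolding wronskian_def using assms(3) by (intro degree_diff_le) auto
  qed
  have lt: "degree A \<le> d - 1" if "degree A \<le> d" "coeff A d = 0" for A :: "'a poly"
  proof (intro degree_le allI impI)
    fix i assume "d - 1 < i"
    then have "i = d \<or> degree A < i" using that(1) by linarith
    then show "coeff A i = 0" using that(2) by (auto simp: coeff_eq_0)
  qed
  show ?thesis
  proof (cases "coeff D d = 0")
    case True
    have "wronskian N D = - wronskian D N" by (simp add: wronskian_def)
    then show ?thesis using main[of D N] lt[OF assms(2) True] assms(1) by simp
  next
    case False
    define c where "c = coeff N d / coeff D d"
    have "wronskian N D = wronskian (N - smult c D) D"
      by (simp add: wronskian_def pderiv_diff pderiv_smult smult_diff_right algebra_simps)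
    moreover have "degree (N - smult c D) \<le> d - 1"
      using assms False by (intro lt degree_diff_le order_trans[OF degree_smult_le]) (simp_all add: c_def)
    ultimately show ?thesis using main[of "N - smult c D" D] assms(2) by simp
  qed
qed

lemma prod_linear_powers_dvd:
  fixes W :: "'k::alg_closed_field poly"
  assumes "finite I" "inj_on x I" "\<And>i. i \<in> I \<Longrightarrow> [:- x i, 1:] ^ k i dvd W"
  shows "(\<Prod>i\<in>I. [:- x i, 1:] ^ k i) dvd W"
  using assms
proof (induction I rule: finite_induct)
  case (insert j I)
  let ?T = "\<Prod>i\<in>I. [:- x i, 1:] ^ k i"
  have "?T dvd W" using insert by auto
  then obtain V where V: "W = ?T * V" by (elim dvdE)
  have "coprime ([:- x j, 1:] ^ k j) ?T"
  proof (rule coprime_no_root)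
    fix y assume "poly ([:- x j, 1:] ^ k j) y = 0"
    then have "y = x j" by (simp add: poly_power)
    then show "poly ?T y \<noteq> 0"
      using insert.prems(1) insert.hyps by (auto simp: poly_prod poly_power prod_zero_iff inj_on_def)
  qed simp
  moreover have "[:- x j, 1:] ^ k j dvd ?T * V" using insert.prems(2)[of j] V by simp
  ultimately have "[:- x j, 1:] ^ k j dvd V" by (rule poly_coprime_dvd_mult)
  then have "?T * [:- x j, 1:] ^ k j dvd ?T * V" by (rule mult_dvd_mono[OF dvd_refl])
  then show ?case using insert.hyps V by (simp add: mult.commute)
qed simp

lemma reflect_poly_linear: "reflect_poly [:-q, 1:] = [:1, -q :: 'a::idom:]"
  by (rule poly_eqI) (auto simp: coeff_reflect_poly coeff_pCons split: nat.splits)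

text \<open>
  Integrating \<open>f' = c \<Prod> (t - x\<^sub>i)\<^bsup>e\<^sub>i - 1\<^esup> / D ^ 2\<close> in characteristic \<open>p\<close>, with the pole of \<open>f\<close> at \<open>x\<^sub>1\<close>
  moved to infinity. Here the first coordinate \<open>t - x\<^sub>1\<close> is inverted by reflecting polynomials.
\<close>

lemma ramified_map_imp_cartier_zero:
  fixes x :: "nat \<Rightarrow> 'k::alg_closed_field"
  assumes p: "CHAR('k) = p" "prime p" "2 < p" and n: "n \<ge> 1"
    and e: "(\<Sum>i=1..n. e i - 1) = 2 * d - 2" "e 1 \<le> d" "e 1 > p"
    and x: "inj_on x {1..n}" "\<And>i. i \<in> {1..n} \<Longrightarrow> P i = Aff (x i)"
    and f: "f \<in> ramified_maps n d e P"
  obtains E where "E \<noteq> 0" "degree E \<le> d - e 1"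
    "cartier_zero p ((\<Prod>i\<in>{2..n}. [:1, - (x i - x 1):] ^ (e i - 1)) * E ^ (p - 2))"
proof -
  have d: "d > 0" "d \<ge> 2" using e p by auto
  have pp: "p > 0" "p \<ge> 2" using p by auto
  obtain N D where ND: "reduced_pair d N D" "hval d (P 1) D = 0" "Fract N D \<in> ramified_maps n d e P"
    using ramified_map_with_pole[OF p(1,2) d(1) f] .
  have D0: "D \<noteq> 0" using reduced_pair_nonzero[OF ND(1)] by simp
  have deg: "degree N \<le> d" "degree D \<le> d" using ND(1) by (auto simp: reduced_pair_def)
  have W: "wronskian N D \<noteq> 0"
    and v: "\<And>i. i \<in> {1..n} \<Longrightarrow> vord d (P i) (fibre_form d N D (P i)) = e i"
    using ND(3) ramified_maps_Fract_iff[OF p(1,2) ND(1)] by auto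
  have P1: "P 1 = Aff (x 1)" using x(2) n by simp
  have "hval d (P 1) N \<noteq> 0" using reduced_pair_hval[OF ND(1), of "P 1"] ND(2) by simp
  then have "order (x 1) D = e 1" using v[of 1] n ND(2) P1 by (simp add: fibre_form_def order_smult)
  then have "[:- x 1, 1:] ^ e 1 dvd D" using order_1[of "x 1" D] by simp
  then obtain D1 where D1: "D = [:- x 1, 1:] ^ e 1 * D1" by (elim dvdE)
  then have D10: "D1 \<noteq> 0" using D0 by auto
  define m where "m = d - e 1"
  have degD1: "degree D1 \<le> m"
    using deg(2) D10 by (simp add: D1 degree_mult_eq degree_power_eq m_def)
  let ?T = "\<Prod>i\<in>{1..n}. [:- x i, 1:] ^ (e i - 1)"
  have "?T dvd wronskian N D"
  proof (rule prod_linear_powers_dvd)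
    fix i assume i: "i \<in> {1..n}"
    show "[:- x i, 1:] ^ (e i - 1) dvd wronskian N D"
      using power_dvd_wronskian[OF ND(1), of "x i" "e i"] v[OF i] x(2)[OF i] by simp
  qed (use x in auto)
  then obtain V where V: "wronskian N D = ?T * V" by (elim dvdE)
  have V0: "V \<noteq> 0" using W V by auto
  have T0: "?T \<noteq> 0" by (simp add: prod_zero_iff)
  have degT: "degree ?T = 2 * d - 2"
    unfolding e(1)[symmetric] by (subst degree_prod_eq_sum_degree) (auto simp: degree_power_eq)
  \<comment> \<open>Riemann-Hurwitz: the prescribed ramification exhausts the degree of the
    Wronskian, so the cofactor is constant.\<close>
  have "degree ?T + degree V \<le> 2 * d - 2"
    using degree_wronskian_le[OF deg d(2)] T0 V0 by (simp add: V degree_mult_eq)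
  then have "degree V = 0" using degT by simp
  then obtain c where c: "V = [:c:]" by (rule degree_eq_zeroE)
  with V0 have c0: "c \<noteq> 0" by simp
  define sh where "sh A = pcompose A [:x 1, 1:]" for A :: "'k poly"
  have sh_lin: "sh [:- y, 1:] = [:- (y - x 1), 1:]" for y by (simp add: sh_def pcompose_pCons)
  have sh_mult: "sh (A * B) = sh A * sh B" for A B by (simp add: sh_def pcompose_mult)
  have sh_pow: "sh (A ^ k) = sh A ^ k" for A k by (simp add: sh_def pcompose_power)
  have sh_prod: "sh (\<Prod>i\<in>I. A i) = (\<Prod>i\<in>I. sh (A i))" for A and I :: "nat set"
    by (induction I rule: infinite_finite_induct) (simp_all add: sh_mult, simp_all add: sh_def pcompose_1)
  have "pderiv (sh (N * D ^ (p - 1))) = sh (pderiv (N * D ^ (p - 1)))"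
    by (simp add: sh_def pderiv_pcompose pderiv_pCons)
  also have "\<dots> = sh (?T * V * D ^ (p - 2))" by (simp only: pderiv_mult_power_CHAR[OF p(1) pp(2)] V)
  finally have cz: "cartier_zero p (sh (?T * V * D ^ (p - 2)))"
    using cartier_zero_pderiv[OF p(1) pp(1)] by metis
  define D2 where "D2 = sh D1"
  have D20: "D2 \<noteq> 0" and degD2: "degree D2 = degree D1"
    using D10 by (simp_all add: D2_def sh_def pcompose_eq_0_iff degree_pcompose)
  define g where "g = (\<Prod>i\<in>{2..n}. [:- (x i - x 1), 1:] ^ (e i - 1))"
  define Y where "Y = g * D2 ^ (p - 2)"
  have ins: "{1..n} = insert 1 {2..n}" using n by auto
  have "sh ?T = monom 1 (e 1 - 1) * g"
    unfolding sh_prod sh_pow sh_lin ins g_def by (simp add: monom_altdef)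
  moreover have "sh (D ^ (p - 2)) = monom 1 (e 1 * (p - 2)) * D2 ^ (p - 2)"
    unfolding D1 sh_pow sh_mult sh_lin D2_def
    by (simp add: monom_altdef power_mult_distrib power_mult)
  moreover have "sh V = [:c:]" by (simp add: c sh_def)
  ultimately have shift: "sh (?T * V * D ^ (p - 2)) = smult c (monom 1 (e 1 - 1 + e 1 * (p - 2)) * Y)"
    unfolding sh_mult using mult_monom[of "1::'k" "e 1 - 1" 1 "e 1 * (p - 2)", symmetric]
    by (simp add: Y_def mult_ac)
  obtain q where q: "p = q + 2" using pp(2) by (metis add.commute le_Suc_ex)
  \<comment> \<open>The power of \<open>t\<close> split off shifts the exponent \<open>l\<close> to
    \<open>l + e 1 * (p - 1) - 1\<close>, which is -1 modulo \<open>p\<close> here.\<close>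
  have Yz: "coeff Y l = 0" if dvd: "p dvd l + e 1 * (p - 1)" for l
  proof -
    obtain k where k: "l + e 1 * (p - 1) = p * k" using dvd by (elim dvdE)
    have "e 1 * (p - 1) > 0" using e(3) pp by simp
    then obtain j where j: "k = Suc j" using k by (cases k) auto
    have idx: "l + (e 1 - 1 + e 1 * (p - 2)) = p * j + p - 1"
      using k e(3) unfolding j by (simp add: q algebra_simps)
    have "coeff (smult c (monom 1 (e 1 - 1 + e 1 * (p - 2)) * Y)) (l + (e 1 - 1 + e 1 * (p - 2))) = 0"
      unfolding idx using cz unfolding shift cartier_zero_def by blast
    then show ?thesis using c0 by (simp add: coeff_monom_mult)
  qed
  define G where "G = (\<Sum>i\<in>{2..n}. e i - 1)"
  have G: "G + 1 = 2 * m + e 1"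
  proof -
    have "(e 1 - 1) + G = 2 * d - 2" using e(1) unfolding ins G_def by simp
    then show ?thesis using e(2,3) d pp unfolding m_def by linarith
  qed
  have degg: "degree g = G"
    unfolding g_def G_def by (subst degree_prod_eq_sum_degree) (auto simp: degree_power_eq)
  have g0: "g \<noteq> 0" by (simp add: g_def prod_zero_iff)
  have degY: "degree Y = G + q * degree D2"
    using g0 D20 by (simp add: Y_def degree_mult_eq degree_power_eq degg q)
  \<comment> \<open>\<open>D2\<close> reversed as a form of degree \<open>m\<close>; the monomial
    makes up for a smaller degree of \<open>D2\<close>.\<close>
  define E where "E = monom 1 (m - degree D2) * reflect_poly D2"
  define r where "r = q * (m - degree D2)"
  have prodE: "(\<Prod>i\<in>{2..n}. [:1, - (x i - x 1):] ^ (e i - 1)) * E ^ (p - 2) = monom 1 r * reflect_poly Y"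
  proof -
    have "reflect_poly Y = (\<Prod>i\<in>{2..n}. [:1, - (x i - x 1):] ^ (e i - 1)) * reflect_poly D2 ^ (p - 2)"
      unfolding Y_def g_def reflect_poly_mult reflect_poly_prod reflect_poly_power reflect_poly_linear ..
    moreover have "E ^ (p - 2) = monom 1 r * reflect_poly D2 ^ (p - 2)"
      by (simp add: E_def r_def power_mult_distrib monom_power q mult.commute)
    ultimately show ?thesis by (simp add: mult_ac)
  qed
  have "coeff (monom 1 r * reflect_poly Y) (p * j + p - 1) = 0" for j
  proof (cases "r \<le> p * j + p - 1 \<and> p * j + p - 1 - r \<le> degree Y")
    case True
    \<comment> \<open>The exponent before the reversal. The condition modulo \<open>p\<close> is
      preserved because \<open>G + (p - 2) * m + 1 + e 1 * (p - 1)\<close> equals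
      \<open>p * (m + e 1)\<close>.\<close>
    define l where "l = degree Y - (p * j + p - 1 - r)"
    have "l + (p * j + p - 1) = degree Y + r" using True unfolding l_def by linarith
    also have "\<dots> = G + q * (degree D2 + (m - degree D2))"
      by (simp add: degY r_def algebra_simps flip: add_mult_distrib2)
    also have "\<dots> = G + q * m" using degD1 degD2 by simp
    finally have l: "l + (p * j + p - 1) = G + q * m" .
    have "l + (p * j + p - 1) + 1 + e 1 * (p - 1) = p * (m + e 1)"
      unfolding l using G by (simp add: q algebra_simps)
    moreover have "p * (j + 1) = (p * j + p - 1) + 1" using pp by simp
    ultimately have "(l + e 1 * (p - 1)) + p * (j + 1) = p * (m + e 1)"
      by linarith
    then have "p dvd (l + e 1 * (p - 1)) + p * (j + 1)" by simp
    then have "p dvd l + e 1 * (p - 1)" by (subst (asm) dvd_add_left_iff) simp_all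
    then have "coeff Y l = 0" by (rule Yz)
    then show ?thesis using True by (simp add: coeff_monom_mult coeff_reflect_poly l_def)
  next
    case False
    then show ?thesis by (auto simp: coeff_monom_mult coeff_reflect_poly)
  qed
  then have "cartier_zero p ((\<Prod>i\<in>{2..n}. [:1, - (x i - x 1):] ^ (e i - 1)) * E ^ (p - 2))"
    unfolding prodE cartier_zero_def by blast
  moreover have "E \<noteq> 0" using D20 by (simp add: E_def)
  moreover have "degree E \<le> d - e 1"
  proof -
    have "degree E \<le> (m - degree D2) + degree D2"
      unfolding E_def by (intro order_trans[OF degree_mult_le] add_mono degree_monom_le degree_reflect_poly_le)
    then show ?thesis using degD1 degD2 by (simp add: m_def)
  qed
  ultimately show ?thesis using that by blast
qed

section \<open>Polynomial functions of the points and their multihomogenization\<close>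

definition monomial_sum :: "nat \<Rightarrow> ((nat \<Rightarrow> nat) \<times> 'k) list \<Rightarrow> (nat \<Rightarrow> 'k::comm_ring_1) \<Rightarrow> 'k" where
  "monomial_sum n L x = (\<Sum>(a, c)\<leftarrow>L. c * (\<Prod>i\<in>{1..n}. x i ^ a i))"

lemma monomial_sum_coordinate:
  assumes "i \<in> {1..n}"
  shows "(\<lambda>x. x i) = monomial_sum n [(\<lambda>j. if j = i then 1 else 0, 1)]"
proof
  fix x :: "nat \<Rightarrow> 'a"
  have "(\<Prod>j\<in>{1..n}. x j ^ (if j = i then 1 else 0)) = (\<Prod>j\<in>{1..n}. if j = i then x j else 1)"
    by (intro prod.cong) auto
  then show "x i = monomial_sum n [(\<lambda>j. if j = i then 1 else 0, 1)] x"
    using assms by (simp add: monomial_sum_def)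
qed

lemma function_ring_monomial_sum:
  "function_ring (range (monomial_sum n :: _ \<Rightarrow> (nat \<Rightarrow> 'k::comm_ring_1) \<Rightarrow> 'k))"
  unfolding function_ring_def
proof (intro conjI allI ballI)
  show "(\<lambda>_. c) \<in> range (monomial_sum n)" for c :: 'k
    by (rule range_eqI[of _ _ "[(\<lambda>_. 0, c)]"]) (simp add: fun_eq_iff monomial_sum_def)
  fix f g :: "(nat \<Rightarrow> 'k) \<Rightarrow> 'k"
  assume "f \<in> range (monomial_sum n)" "g \<in> range (monomial_sum n)"
  then obtain L L' where fg: "f = monomial_sum n L" "g = monomial_sum n L'" by auto
  show "(\<lambda>y. f y + g y) \<in> range (monomial_sum n)"
    by (rule range_eqI[of _ _ "L @ L'"]) (simp add: fun_eq_iff fg monomial_sum_def)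
  let ?mul = "\<lambda>a c. map (\<lambda>(b, c'). (\<lambda>i. a i + b i, c * c')) L'"
  have mul: "monomial_sum n (?mul a c) y = c * (\<Prod>i\<in>{1..n}. y i ^ a i) * monomial_sum n L' y" for a c y
    unfolding monomial_sum_def
    by (induction L') (auto simp: power_add prod.distrib algebra_simps)
  have "monomial_sum n (concat (map (\<lambda>(a, c). ?mul a c) L)) y = monomial_sum n L y * monomial_sum n L' y" for y
  proof (induction L)
    case (Cons ac L)
    obtain a c where ac: "ac = (a, c)" by (cases ac)
    have app: "monomial_sum n (K @ K') y = monomial_sum n K y + monomial_sum n K' y"
      for K K' :: "((nat \<Rightarrow> nat) \<times> 'k) list" by (simp add: monomial_sum_def)
    have "monomial_sum n (ac # L) y = c * (\<Prod>i\<in>{1..n}. y i ^ a i) + monomial_sum n L y"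
      by (simp add: monomial_sum_def ac)
    moreover have "monomial_sum n (concat (map (\<lambda>(a, c). ?mul a c) (ac # L))) y =
        monomial_sum n (?mul a c) y + monomial_sum n (concat (map (\<lambda>(a, c). ?mul a c) L)) y"
      by (simp only: list.map concat.simps app ac prod.case)
    ultimately show ?case unfolding mul Cons by (simp only: distrib_right)
  qed (simp add: monomial_sum_def)
  then show "(\<lambda>y. f y * g y) \<in> range (monomial_sum n)"
    by (intro range_eqI[of _ _ "concat (map (\<lambda>(a, c). ?mul a c) L)"]) (simp add: fun_eq_iff fg)
qed

text \<open>Choosing the multidegree larger than all exponents makes the form vanish if a coordinate is \<open>Infty\<close>.\<close>

lemma multihomogenization:
  fixes H :: "(nat \<Rightarrow> 'k::field) \<Rightarrow> 'k"
  assumes "H \<in> range (monomial_sum n)"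
  shows "\<exists>m c. (\<forall>P x. (\<forall>i\<in>{1..n}. P i = Aff (x i)) \<longrightarrow> multihom_eval n m c P = H x) \<and>
    (\<forall>P. (\<exists>i\<in>{1..n}. P i = Infty) \<longrightarrow> multihom_eval n m c P = 0)"
proof -
  obtain L where L: "H = monomial_sum n L" using assms by blast
  define m where "m i = Suc (\<Sum>(a, c)\<leftarrow>L. a i)" for i
  \<comment> \<open>Exponent vectors are restricted to \<open>{1..n}\<close> because
    \<open>multihom_eval\<close> sums over extensional functions; terms that then agree are added
    up.\<close>
  define c where "c b = (\<Sum>(a, k)\<leftarrow>L. if restrict a {1..n} = b then k else 0)" for b
  have am: "a i < m i" if "(a, k) \<in> set L" for a k i
  proof -
    have "a i \<in> set (map (\<lambda>(a, c). a i) L)" using that by force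
    then have "a i \<le> (\<Sum>(a, c)\<leftarrow>L. a i)" by (rule member_le_sum_list) simp
    then show ?thesis by (simp add: m_def)
  qed
  have c0: "c b = 0" if "i \<in> {1..n}" "b i = m i" for b i
  proof -
    have "(if restrict a {1..n} = b then k else 0) = 0" if "(a, k) \<in> set L" for a k
      using am[OF that, of i] \<open>i \<in> {1..n}\<close> \<open>b i = m i\<close> by (auto simp: restrict_def split: if_splits)
    then have "map (\<lambda>(a, k). if restrict a {1..n} = b then k else 0) L = map (\<lambda>_. 0) L" by auto
    then have "c b = (\<Sum>_\<leftarrow>L. 0)" unfolding c_def by (rule arg_cong)
    then show ?thesis by simp
  qed
  show ?thesis
  proof (intro exI[of _ m] exI[of _ c] conjI allI impI)
    fix P and x :: "nat \<Rightarrow> 'k" assume P: "\<forall>i\<in>{1..n}. P i = Aff (x i)"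
    let ?B = "\<Pi>\<^sub>E i\<in>{1..n}. {..m i}"
    have fin: "finite ?B" by (intro finite_PiE) auto
    have "multihom_eval n m c P = (\<Sum>b\<in>?B. c b * (\<Prod>i\<in>{1..n}. x i ^ b i))"
      unfolding multihom_eval_def by (intro sum.cong arg_cong2[of _ _ _ _ "(*)"] prod.cong refl) (simp add: P)
    also have "\<dots> = (\<Sum>b\<in>?B. \<Sum>(a, k)\<leftarrow>L. if restrict a {1..n} = b then k * (\<Prod>i\<in>{1..n}. x i ^ b i) else 0)"
      unfolding c_def sum_list_mult_const[symmetric]
      by (intro sum.cong refl arg_cong[of _ _ sum_list]) auto
    also have "\<dots> = (\<Sum>(a, k)\<leftarrow>L. \<Sum>b\<in>?B. if restrict a {1..n} = b then k * (\<Prod>i\<in>{1..n}. x i ^ b i) else 0)"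
      by (induction L) (auto simp: sum.distrib)
    also have "\<dots> = (\<Sum>(a, k)\<leftarrow>L. k * (\<Prod>i\<in>{1..n}. x i ^ a i))"
    proof (intro arg_cong[of _ _ sum_list] map_cong refl)
      fix ak assume ak: "ak \<in> set L"
      obtain a k where akk: "ak = (a, k)" by (cases ak)
      have "restrict a {1..n} \<in> ?B" using am[of a k] ak unfolding akk by (auto intro: less_imp_le)
      then have "(\<Sum>b\<in>?B. if restrict a {1..n} = b then k * (\<Prod>i\<in>{1..n}. x i ^ b i) else 0) =
          k * (\<Prod>i\<in>{1..n}. x i ^ restrict a {1..n} i)"
        using fin by (simp add: sum.delta)
      also have "(\<Prod>i\<in>{1..n}. x i ^ restrict a {1..n} i) = (\<Prod>i\<in>{1..n}. x i ^ a i)"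
        by (intro prod.cong) auto
      finally show "(case ak of (a, k) \<Rightarrow> \<Sum>b\<in>?B. if restrict a {1..n} = b then k * (\<Prod>i\<in>{1..n}. x i ^ b i) else 0) =
          (case ak of (a, k) \<Rightarrow> k * (\<Prod>i\<in>{1..n}. x i ^ a i))"
        unfolding akk prod.case .
    qed
    also have "\<dots> = H x" by (simp add: L monomial_sum_def)
    finally show "multihom_eval n m c P = H x" .
  next
    fix P :: "nat \<Rightarrow> 'k proj_line" assume "\<exists>i\<in>{1..n}. P i = Infty"
    then obtain i where i: "i \<in> {1..n}" "P i = Infty" by blast
    have "c b * (\<Prod>i\<in>{1..n}. hcoord_x (P i) ^ b i * hcoord_y (P i) ^ (m i - b i)) = 0"
      if b: "b \<in> (\<Pi>\<^sub>E i\<in>{1..n}. {..m i})" for b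
    proof (cases "b i = m i")
      case True
      then show ?thesis using c0[OF i(1)] by simp
    next
      case False
      then have "b i < m i" using b i(1) by (force simp: PiE_iff le_less)
      then have "hcoord_x (P i) ^ b i * hcoord_y (P i) ^ (m i - b i) = 0" using i(2) by simp
      then show ?thesis using i(1) by (metis (no_types, lifting) finite_atLeastAtMost mult_zero_right prod_zero)
    qed
    then show "multihom_eval n m c P = 0" unfolding multihom_eval_def by (intro sum.neutral) blast
  qed
qed

lemma no_ramified_maps_generic:
  fixes p n d :: nat and e :: "nat \<Rightarrow> nat"
  assumes p: "CHAR('k::alg_closed_field) = p" "prime p" "2 < p" and n: "n \<ge> 1"
    and e: "(\<Sum>i=1..n. e i - 1) = 2 * d - 2" "e 1 \<le> d" "e 1 > p" "\<forall>i\<in>{2..n}. e i < p"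
  shows "\<exists>U :: (nat \<Rightarrow> 'k proj_line) set. zariski_open n U \<and> U \<noteq> {} \<and>
    (\<forall>P\<in>U. ramified_maps n d e P = {})"
proof -
  define a where "a i = e i - 1" for i
  \<comment> \<open>The number of coefficients of a polynomial of degree at most
    \<open>d - e 1\<close>.\<close>
  define M where "M = d - e 1 + 1"
  let ?A = "range (monomial_sum n :: _ \<Rightarrow> (nat \<Rightarrow> 'k) \<Rightarrow> 'k)"
  note fr = function_ring_monomial_sum[of n, where 'k='k]
  have ins: "{1..n} = insert 1 {2..n}" using n by auto
  define g where "g x = (\<Prod>i\<in>{2..n}. [:1, - (x i - x 1):] ^ a i)" for x :: "nat \<Rightarrow> 'k"
  define Dp where "Dp D = (\<Sum>i<M. monom (D i) i)" for D :: "nat \<Rightarrow> 'k"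
  define F where "F j x D = coeff (g x * Dp D ^ (p - 2)) (p * j + p - 1)" for j x D
  have const_in: "(\<lambda>x. c) \<in> ?A" for c using fr by (simp add: function_ring_def)
  have add_in: "(\<lambda>x. u x + v x) \<in> ?A" and mult_in: "(\<lambda>x. u x * v x) \<in> ?A" if "u \<in> ?A" "v \<in> ?A" for u v
    using fr that unfolding function_ring_def by blast+
  have diff_in: "(\<lambda>x. x i - x j) \<in> ?A" if "i \<in> {1..n}" "j \<in> {1..n}" for i j
  proof -
    have "(\<lambda>x. x i + (-1) * x j) \<in> ?A"
      using that by (intro add_in mult_in const_in) (metis monomial_sum_coordinate rangeI)+
    then show ?thesis by simp
  qed
  have hF: "hform ?A M (p - 2) (F j)" for j
  proof -
    have "(\<lambda>x. coeff [:1, - (x i - x 1):] k) \<in> ?A" if "i \<in> {2..n}" for i k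
    proof -
      have "(\<lambda>x. coeff [:1, - (x i - x 1):] k) =
          (\<lambda>x :: nat \<Rightarrow> 'k. if k = 0 then 1 else if k = 1 then x 1 - x i else 0)"
        by (auto simp: fun_eq_iff coeff_pCons split: nat.split)
      moreover have "(\<lambda>x. x 1 - x i) \<in> ?A" using that n by (intro diff_in) auto
      ultimately show ?thesis using const_in[of 0] const_in[of 1]
        by (cases "k = 0"; cases "k = 1") simp_all
    qed
    then have "hform ?A M (a i * 0) (\<lambda>x D. coeff ([:1, - (x i - x 1):] ^ a i) k)" if "i \<in> {2..n}" for i k
      using that by (intro hform_coeff_power[OF fr] hform_coef)
    then have 1: "hform ?A M 0 (\<lambda>x D. coeff (g x) k)" for k
      unfolding g_def by (intro hform_coeff_prod[OF fr]) simp
    have "hform ?A M 1 (\<lambda>x D. coeff (\<Sum>i<M. monom (D i * 1) i) k)" for k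
      by (rule hform_coeff_form) (rule const_in)
    then have 2: "hform ?A M ((p - 2) * 1) (\<lambda>x D. coeff (Dp D ^ (p - 2)) k)" for k
      unfolding Dp_def by (intro hform_coeff_power[OF fr]) simp
    have "hform ?A M (0 + (p - 2) * 1) (F j)" unfolding F_def by (intro hform_coeff_mult 1 2)
    then show ?thesis by simp
  qed
  obtain Q :: "nat \<Rightarrow> 'k" where Q: "inj_on Q {2..n}" "\<And>i. i \<in> {2..n} \<Longrightarrow> Q i \<noteq> 0"
    "\<And>D. D \<noteq> 0 \<Longrightarrow> cartier_zero p ((\<Prod>i\<in>{2..n}. [:1, - Q i:] ^ a i) * D ^ (p - 2)) \<Longrightarrow>
       (\<Sum>i\<in>{2..n}. a i) + 1 \<le> 2 * degree D + p"
    using generic_points_exist[where 'k='k, OF p(1,3), of "{2..n}" a] e(4) unfolding a_def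
    by (metis (no_types, lifting) finite_atLeastAtMost less_imp_diff_less)
  \<comment> \<open>The first point, where the normalized map has its pole, is put at 0, so that the
    differences \<open>x i - x 1\<close> become the \<open>Q i\<close>.\<close>
  define y0 where "y0 = Q(1 := 0)"
  have gy0: "g y0 = (\<Prod>i\<in>{2..n}. [:1, - Q i:] ^ a i)"
    unfolding g_def by (intro prod.cong refl) (simp add: y0_def)
  have y0: "inj_on y0 {1..n}"
    unfolding ins using Q(1,2) by (auto simp: y0_def inj_on_def)
  have G: "(\<Sum>i\<in>{2..n}. a i) + 1 = 2 * (d - e 1) + e 1"
  proof -
    have "(e 1 - 1) + (\<Sum>i\<in>{2..n}. a i) = 2 * d - 2" using e(1) unfolding ins a_def by simp
    then show ?thesis using e(2,3) p(3) by linarith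
  qed
  have "\<exists>H\<in>?A. H y0 \<noteq> 0 \<and> (\<forall>x D. H x \<noteq> 0 \<longrightarrow> (\<exists>i<M. D i \<noteq> 0) \<longrightarrow> (\<exists>f\<in>range F. f x D \<noteq> 0))"
  proof (rule main_theorem_of_elimination[OF fr, of "p - 2"])
    show "p - 2 > 0" using p(3) by simp
    show "hform ?A M (p - 2) f" if "f \<in> range F" for f using that hF by blast
    fix D :: "nat \<Rightarrow> 'k" assume D: "\<exists>i<M. D i \<noteq> 0"
    have co: "coeff (Dp D) i = (if i < M then D i else 0)" for i by (simp add: Dp_def coeff_sum)
    have D0: "Dp D \<noteq> 0" using D co by (metis coeff_0)
    have "degree (Dp D) < M"
      using co[of "degree (Dp D)"] D0 by (metis leading_coeff_0_iff)
    \<comment> \<open>Here \<open>e 1 > p\<close> enters: \<open>degree (Dp D) \<le> d - e 1\<close>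
      makes the right hand side smaller than \<open>2 * (d - e 1) + e 1\<close>.\<close>
    then have "\<not> (\<Sum>i\<in>{2..n}. a i) + 1 \<le> 2 * degree (Dp D) + p"
      unfolding G using e(3) by (simp add: M_def)
    then have "\<not> cartier_zero p (g y0 * Dp D ^ (p - 2))" using Q(3)[OF D0] unfolding gy0 by blast
    then show "\<exists>f\<in>range F. f y0 D \<noteq> 0" by (auto simp: cartier_zero_def F_def)
  qed
  then obtain H where H: "H \<in> ?A" "H y0 \<noteq> 0"
    "\<And>x D. H x \<noteq> 0 \<Longrightarrow> \<exists>i<M. D i \<noteq> 0 \<Longrightarrow> \<exists>j. F j x D \<noteq> 0"
    by blast
  \<comment> \<open>The product of differences removes tuples with coinciding coordinates, since
    distinct points are needed to collect the factors of the Wronskian.\<close>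
  define V where "V x = (\<Prod>i\<in>{1..n}. \<Prod>j\<in>{1..n} - {i}. x i - x j)" for x :: "nat \<Rightarrow> 'k"
  have V0: "V x \<noteq> 0 \<longleftrightarrow> inj_on x {1..n}" for x
  proof -
    have "V x \<noteq> 0 \<longleftrightarrow> (\<forall>i\<in>{1..n}. \<forall>j\<in>{1..n} - {i}. x i \<noteq> x j)"
      unfolding V_def by (simp add: prod_zero_iff)
    also have "\<dots> \<longleftrightarrow> inj_on x {1..n}" unfolding inj_on_def by blast
    finally show ?thesis .
  qed
  have prod_in: "(\<lambda>x. \<Prod>s\<in>S. u s x) \<in> ?A" if "\<And>s. s \<in> S \<Longrightarrow> u s \<in> ?A" for S :: "nat set" and u
    using that by (induction S rule: infinite_finite_induct) (simp_all add: const_in mult_in)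
  have "V \<in> ?A"
    unfolding V_def by (intro prod_in diff_in) auto
  then have HV: "(\<lambda>x. H x * V x) \<in> ?A" using H(1) by (intro mult_in)
  obtain m c where mc:
    "\<forall>P x. (\<forall>i\<in>{1..n}. P i = Aff (x i)) \<longrightarrow> multihom_eval n m c P = H x * V x"
    "\<forall>P. (\<exists>i\<in>{1..n}. P i = Infty) \<longrightarrow> multihom_eval n m c P = 0"
    using multihomogenization[OF HV] by (elim exE conjE)
  \<comment> \<open>The form vanishes once a coordinate is \<open>Infty\<close>, so the tuples in
    \<open>U\<close> are affine and are covered by the calculation with \<open>x\<close>.\<close>
  define U where "U = {P \<in> proj_line_power n. multihom_eval n m c P \<noteq> 0}"
  have "zariski_open n U"
    unfolding zariski_open_def zariski_closed_def U_def
    by (intro conjI exI[of _ "{(m, c)}"]) auto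
  moreover have "U \<noteq> {}"
  proof -
    let ?P = "restrict (\<lambda>i. Aff (y0 i)) {1..n}"
    have "multihom_eval n m c ?P = H y0 * V y0" by (rule mc(1)[rule_format]) simp
    then have "multihom_eval n m c ?P \<noteq> 0" using H(2) V0 y0 by simp
    then have "?P \<in> U" by (simp add: U_def proj_line_power_def)
    then show ?thesis by blast
  qed
  moreover have "ramified_maps n d e P = {}" if PU: "P \<in> U" for P
  proof (rule ccontr)
    assume "ramified_maps n d e P \<noteq> {}"
    then obtain f where f: "f \<in> ramified_maps n d e P" by blast
    have "\<exists>x. P i = Aff x" if "i \<in> {1..n}" for i
    proof (cases "P i")
      case Infty
      then have "multihom_eval n m c P = 0" using mc(2) that by blast
      then show ?thesis using PU by (simp add: U_def)
    qed blast
    then obtain x where x: "\<And>i. i \<in> {1..n} \<Longrightarrow> P i = Aff (x i)" by metis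
    then have "H x \<noteq> 0" "V x \<noteq> 0" using PU mc(1)[rule_format, of P x] x by (auto simp: U_def)
    then have inj: "inj_on x {1..n}" by (simp add: V0)
    obtain E where E: "E \<noteq> 0" "degree E \<le> d - e 1" "cartier_zero p (g x * E ^ (p - 2))"
      using ramified_map_imp_cartier_zero[OF p n e(1-3) inj x f] unfolding g_def a_def by blast
    have DpE: "Dp (coeff E) = E"
      using E(2) by (intro poly_eqI) (auto simp: Dp_def coeff_sum M_def coeff_eq_0)
    have "\<exists>i<M. coeff E i \<noteq> 0" using E(1,2) by (intro exI[of _ "degree E"]) (simp add: M_def)
    then obtain j where "F j x (coeff E) \<noteq> 0" using H(3) \<open>H x \<noteq> 0\<close> by blast
    then show False using E(3) by (simp add: F_def DpE cartier_zero_def)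
  qed
  ultimately show ?thesis by blast
qed

theorem proposition5p4:
  fixes p n d :: nat and e :: "nat \<Rightarrow> nat"
  assumes "CHAR('k::alg_closed_field) = p" and "p > 2"
    and "n \<ge> 1"
    and "\<forall>i\<in>{1..n}. e i \<ge> 2"
    and "(\<Sum>i=1..n. e i - 1) = 2 * d - 2"
    and "\<forall>i\<in>{1..n}. e i \<le> d"
    and "e 1 > p" and "coprime (e 1) p"
    and "\<forall>i\<in>{2..n}. e i < p"
  shows "(\<forall>P :: nat \<Rightarrow> 'k proj_line. inj_on P {1..n} \<longrightarrow>
            ramified_maps n d e P \<noteq> {} \<longrightarrow>
            infinite (ramified_maps n d e P // mod_image_aut (ramified_maps n d e P)))
       \<and> (\<exists>U :: (nat \<Rightarrow> 'k proj_line) set. zariski_open n U \<and> U \<noteq> {} \<and>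
            (\<forall>P\<in>U. ramified_maps n d e P = {}))"
proof -
  have prime: "prime p" using assms(1,2) prime_CHAR_semidom[where 'a='k] by simp
  have e1: "e 1 \<le> d" using assms(3,6) by simp
  then have "d > 0" using assms(7) by simp
  then show ?thesis
    using infinitely_many_ramified_maps[OF assms(1) prime assms(3) _ assms(7,9)]
      no_ramified_maps_generic[OF assms(1) prime assms(2,3,5) e1 assms(7,9)] by blast
qed

end
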